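(* Let $q>1$ be a prime power and $n\ge1$. (i) $$\mathrm{Hilb}(\widetilde A(U_{n,n}(q)),t)=\sum_{\sigma\in\widetilde{\mathfrak S}_n}q^{\mathrm{maj}(\sigma)-\mathrm{exc}(\sigma)}t^{\mathrm{exc}(\sigma)+1}=\widetilde A_n(q,t).$$ (ii) If $n\ge2$, $$\mathrm{Hilb}(\widetilde A(U_{n-1,n}(q)),t)=\sum_{\sigma\in\mathfrak S_n}q^{\mathrm{maj}(\sigma)-\mathrm{exc}(\sigma)}t^{\mathrm{exc}(\sigma)}=A_n(q,t).$$
   Context: For $1\le r\le n$, the $q$-uniform matroid $U_{r,n}(q)$ is the rank $r$ matroid on the ground set $E=\mathbb{F}_q^n\setminus\{0\}$ whose flats are the sets $V\setminus\{0\}$, where $V$ is a linear subspace of $\mathbb{F}_q^n$ with $\dim V\le r-1$ or $V=\mathbb{F}_q^n$. For a loopless matroid $M$ on $E$ with lattice of flats $\mathcal L(M)$, the augmented Chow ring is the graded $\mathbb{Q}$-algebra (all variables in degree 1) $$\widetilde A(M)=\mathbb{Q}\big[\{x_F\}_{F\in\mathcal L(M)\setminus\{E\}}\cup\{y_i\}_{i\in E}\big]/(\widetilde I_1+\widetilde I_2+\widetilde J),$$ where $\widetilde I_1$ is generated by $x_Fx_{F'}$ for incomparable proper flats $F,F'$; $\widetilde I_2$ by $y_ix_F$ for $i\in E$ and proper flats $F$ with $i\notin F$; $\widetilde J$ by $y_i-\sum_{F\in\mathcal L(M)\setminus\{E\}:\, i\notin F}x_F$ for $i\in E$. For a graded $\mathbb{Q}$-algebra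 $A=\bigoplus_j A^j$, $\mathrm{Hilb}(A,t)=\sum_j\dim_{\mathbb{Q}}(A^j)t^j$. $[m]_q=1+q+\cdots+q^{m-1}$, $[m]_q!=\prod_{i=1}^m[i]_q$, $\binom{n}{k}_q=\frac{[n]_q!}{[k]_q![n-k]_q!}$. For $\sigma\in\mathfrak S_n$: $\mathrm{exc}(\sigma)=|\{i:\sigma_i>i\}|$, $\mathrm{maj}(\sigma)=\sum_{i:\sigma_i>\sigma_{i+1}}i$. $A_n(q,t)=\sum_{\sigma\in\mathfrak S_n}q^{\mathrm{maj}(\sigma)-\mathrm{exc}(\sigma)}t^{\mathrm{exc}(\sigma)}$ and $\widetilde A_n(q,t)=1+t\sum_{k=1}^n\binom{n}{k}_qA_k(q,t)$. A decorated permutation of $[n]=\{1,\dots,n\}$ is a permutation $\sigma$ of a subset $S\subseteq[n]$; its one-line notation is $\sigma_1\cdots\sigma_n$ with $\sigma_i=\sigma(i)$ for $i\in S$ and $\sigma_i=0$ for $i\notin S$. $\widetilde{\mathfrak S}_n$ is the set of these and $\theta=0\cdots0$ is the permutation of $\emptyset$. For $\sigma\ne\theta$: $\mathrm{exc}(\sigma)=|\{i\in[n]:i<\sigma_i\}|$ and $\mathrm{maj}(\sigma)=\sum_{i:\sigma_i>\sigma_{i+1}}i$; and $\mathrm{exc}(\theta)=\mathrm{maj}(\theta)=-1$. *)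

theory Defs
  imports
    "HOL-Analysis.Cartesian_Space"
    "HOL-Algebra.Embedded_Algebras"
    "HOL-Algebra.QuotRing"
    "HOL-Library.Poly_Mapping"
    "HOL-Computational_Algebra.Formal_Power_Series"
    "HOL-Combinatorics.Permutations"
begin

section \<open>Matroids given by their flats\<close>

definition covers_in :: "'a set set \<Rightarrow> 'a set \<Rightarrow> 'a set \<Rightarrow> bool" where
  "covers_in L F G \<longleftrightarrow> F \<in> L \<and> G \<in> L \<and> F \<subset> G \<and> \<not> (\<exists>H\<in>L. F \<subset> H \<and> H \<subset> G)"

text \<open>A matroid on \<open>E\<close> is presented by its collection \<open>L\<close> of flats; it is loopless iff the
  empty set is a flat.\<close>

locale loopless_matroid =
  fixes E :: "'a set" and L :: "'a set set"
  assumes finite_ground: "finite E"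
    and flats_subset: "L \<subseteq> Pow E"
    and ground_flat: "E \<in> L"
    and inter_flat: "F \<in> L \<Longrightarrow> G \<in> L \<Longrightarrow> F \<inter> G \<in> L"
    and unique_cover: "F \<in> L \<Longrightarrow> i \<in> E - F \<Longrightarrow> \<exists>!G. covers_in L F G \<and> i \<in> G"
    and loopless: "{} \<in> L"

text \<open>The flats of the \<open>q\<close>-uniform matroid of rank \<open>r\<close> on the nonzero vectors of \<open>'k ^ 'n\<close>, where
  \<open>q = CARD('k)\<close> and \<open>n = CARD('n)\<close>.\<close>

definition q_uniform_ground :: "('k::{field,finite} ^ 'n) set" where
  "q_uniform_ground = UNIV - {0}"

definition q_uniform_flats :: "nat \<Rightarrow> ('k::{field,finite} ^ 'n) set set" where
  "q_uniform_flats r = {V - {0} | V. vec.subspace V \<and> (vec.dim V < r \<or> V = UNIV)}"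

lemma q_uniform_loopless_matroid:
  assumes "r \<ge> 1"
  shows "loopless_matroid q_uniform_ground (q_uniform_flats r :: ('k::{field,finite} ^ 'n) set set)"
proof
  let ?E = "q_uniform_ground :: ('k ^ 'n) set"
  let ?L = "q_uniform_flats r :: ('k ^ 'n) set set"
  show "finite ?E" by simp
  show "?L \<subseteq> Pow ?E" by (auto simp: q_uniform_flats_def q_uniform_ground_def)
  have flatI: "V - {0} \<in> ?L" if "vec.subspace V" "vec.dim V < r \<or> V = UNIV" for V
    using that unfolding q_uniform_flats_def by blast
  show "?E \<in> ?L" unfolding q_uniform_ground_def by (rule flatI) simp_all
  have "vec.subspace {0 :: 'k ^ 'n}" "vec.dim {0 :: 'k ^ 'n} = 0"
    by (auto simp: vec.subspace_def)
  then show "{} \<in> ?L"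
    using assms flatI[of "{0}"] by simp
  show "F \<inter> G \<in> ?L" if FG: "F \<in> ?L" "G \<in> ?L" for F G
  proof -
    obtain V W where V: "F = V - {0}" "vec.subspace V" "vec.dim V < r \<or> V = UNIV"
      and W: "G = W - {0}" "vec.subspace W" "vec.dim W < r \<or> W = UNIV"
      using FG unfolding q_uniform_flats_def by auto
    have "vec.dim (V \<inter> W) \<le> vec.dim V" "vec.dim (V \<inter> W) \<le> vec.dim W"
      by (auto intro: vec.dim_subset)
    then have "vec.dim (V \<inter> W) < r \<or> V \<inter> W = UNIV"
      using V(3) W(3) by auto
    moreover have "F \<inter> G = (V \<inter> W) - {0}" using V W by auto
    ultimately show ?thesis
      using vec.subspace_inter[OF V(2) W(2)] flatI[of "V \<inter> W"] by simp
  qed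
  show "\<exists>!G. covers_in ?L F G \<and> i \<in> G" if F: "F \<in> ?L" and i: "i \<in> ?E - F" for F i
  proof -
    obtain V where V: "F = V - {0}" "vec.subspace V" "vec.dim V < r \<or> V = UNIV"
      using F unfolding q_uniform_flats_def by auto
    have i': "i \<noteq> 0" "i \<notin> V" using i V by (auto simp: q_uniform_ground_def)
    then have dV: "vec.dim V < r" using V(3) by auto
    have zero: "0 \<in> U" if "vec.subspace U" for U :: "('k ^ 'n) set"
      using that by (rule vec.subspace_0)
    have mono: "A \<subseteq> B"
      if "vec.subspace B" "A - {0} \<subseteq> B - {0}" for A B :: "('k ^ 'n) set"
      using that zero by blast
    have strict: "vec.dim A < vec.dim B"
      if "vec.subspace A" "vec.subspace B" "A - {0} \<subset> B - {0}" for A B :: "('k ^ 'n) set"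
    proof -
      have "vec.span A \<subset> vec.span B"
        using that mono[of B A] by (auto simp: vec.span_eq_iff[THEN iffD2])
      then show ?thesis by (rule vec.dim_psubset)
    qed
    define S where "S = vec.span (insert i V)"
    define C where "C = (if Suc (vec.dim V) < r then S else UNIV)"
    have dS: "vec.dim S \<le> Suc (vec.dim V)"
      unfolding S_def vec.dim_span vec.dim_insert by auto
    have subC: "vec.subspace C" unfolding C_def S_def by auto
    have CL: "C - {0} \<in> ?L"
      by (rule flatI[OF subC]) (use dS in \<open>auto simp: C_def\<close>)
    have iC: "i \<in> C" "V \<subseteq> C" unfolding C_def S_def by (auto intro: vec.span_base)
    have min: "C \<subseteq> W"
      if W: "vec.subspace W" "vec.dim W < r \<or> W = UNIV" and sub: "F \<subset> W - {0}"
        and alt: "i \<in> W \<or> \<not> Suc (vec.dim V) < r" for W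
    proof (cases "Suc (vec.dim V) < r")
      case True
      then have "insert i V \<subseteq> W" using alt sub V W mono[of W V] by auto
      then show ?thesis using True W unfolding C_def S_def by (simp add: vec.span_minimal)
    next
      case False
      then show ?thesis using strict[of V W] V W sub by auto
    qed
    have "covers_in ?L F (C - {0})"
      unfolding covers_in_def
    proof (intro conjI notI)
      show "F \<subset> C - {0}" using iC i' V by auto
      assume "\<exists>H\<in>?L. F \<subset> H \<and> H \<subset> C - {0}"
      then obtain W where W: "vec.subspace W" "vec.dim W < r \<or> W = UNIV"
        "F \<subset> W - {0}" "W - {0} \<subset> C - {0}"
        unfolding q_uniform_flats_def by auto
      show False
      proof (cases "Suc (vec.dim V) < r")
        case True
        then have "vec.dim C \<le> Suc (vec.dim V)" using dS by (simp add: C_def)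
        then show False using strict[of V W] strict[of W C] V W subC by auto
      next
        case False
        then show False using min[of W] W by auto
      qed
    qed (use F CL in auto)
    moreover have "G = C - {0}" if G: "covers_in ?L F G \<and> i \<in> G" for G
    proof -
      obtain W where W: "G = W - {0}" "vec.subspace W" "vec.dim W < r \<or> W = UNIV"
        using G unfolding covers_in_def q_uniform_flats_def by auto
      have "C - {0} \<subseteq> G" using min[of W] W G unfolding covers_in_def by auto
      moreover have "F \<subset> C - {0}" using iC i' V by auto
      ultimately show ?thesis using CL G unfolding covers_in_def by blast
    qed
    ultimately show ?thesis using iC i' by blast
  qed
qed

section \<open>Polynomial rings over the rationals\<close>

text \<open>\<open>'v \<Rightarrow>\<^sub>0 nat\<close> is the type of monomials (exponent vectors) in variables from \<open>'v\<close>, and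
  \<open>('v \<Rightarrow>\<^sub>0 nat) \<Rightarrow>\<^sub>0 rat\<close> the type of polynomials in them; \<open>mpoly_ring V\<close> is the subring of
  those that only use variables from \<open>V\<close>.\<close>

type_synonym 'v mpolynomial = "('v \<Rightarrow>\<^sub>0 nat) \<Rightarrow>\<^sub>0 rat"

definition mpoly_ring :: "'v set \<Rightarrow> 'v mpolynomial ring" where
  "mpoly_ring V =
    \<lparr>carrier = {p. \<forall>m\<in>Poly_Mapping.keys p. Poly_Mapping.keys m \<subseteq> V},
     monoid.mult = (*), one = 1, zero = 0, add = (+)\<rparr>"

definition mvar :: "'v \<Rightarrow> 'v mpolynomial" where
  "mvar v = Poly_Mapping.single (Poly_Mapping.single v 1) 1"

definition mconst :: "rat \<Rightarrow> 'v mpolynomial" where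
  "mconst c = Poly_Mapping.single 0 c"

definition homogeneous :: "nat \<Rightarrow> 'v mpolynomial \<Rightarrow> bool" where
  "homogeneous j p \<longleftrightarrow>
    (\<forall>m\<in>Poly_Mapping.keys p. (\<Sum>v\<in>Poly_Mapping.keys m. Poly_Mapping.lookup m v) = j)"

lemma cring_mpoly_ring: "cring (mpoly_ring V)"
proof (rule cringI)
  have ops: "\<And>p r. p \<oplus>\<^bsub>mpoly_ring V\<^esub> r = p + r" "\<And>p r. p \<otimes>\<^bsub>mpoly_ring V\<^esub> r = p * r"
    "\<zero>\<^bsub>mpoly_ring V\<^esub> = 0" "\<one>\<^bsub>mpoly_ring V\<^esub> = 1"
    by (simp_all add: mpoly_ring_def)
  have zero_one: "0 \<in> carrier (mpoly_ring V)" "1 \<in> carrier (mpoly_ring V)"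
    by (simp_all add: mpoly_ring_def)
  have add: "p + r \<in> carrier (mpoly_ring V)"
    if "p \<in> carrier (mpoly_ring V)" "r \<in> carrier (mpoly_ring V)" for p r
    using that Poly_Mapping.keys_add[of p r] by (fastforce simp: mpoly_ring_def)
  have uminus: "- p \<in> carrier (mpoly_ring V)" if "p \<in> carrier (mpoly_ring V)" for p
    using that by (auto simp: mpoly_ring_def in_keys_iff)
  have mult: "p * r \<in> carrier (mpoly_ring V)"
    if p: "p \<in> carrier (mpoly_ring V)" and r: "r \<in> carrier (mpoly_ring V)" for p r
  proof -
    have "Poly_Mapping.keys m \<subseteq> V" if m: "m \<in> Poly_Mapping.keys (p * r)" for m
    proof -
      obtain a b where "m = a + b" "a \<in> Poly_Mapping.keys p" "b \<in> Poly_Mapping.keys r"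
        using m Poly_Mapping.keys_mult[of p r] by blast
      then show ?thesis
        using p r Poly_Mapping.keys_add[of a b] by (fastforce simp: mpoly_ring_def)
    qed
    then show ?thesis by (simp add: mpoly_ring_def)
  qed
  show "abelian_group (mpoly_ring V)"
  proof (rule abelian_groupI)
    show "\<exists>y\<in>carrier (mpoly_ring V). y \<oplus>\<^bsub>mpoly_ring V\<^esub> x = \<zero>\<^bsub>mpoly_ring V\<^esub>"
      if "x \<in> carrier (mpoly_ring V)" for x
      using uminus[OF that] by (intro bexI[of _ "- x"]) (simp_all add: ops)
  qed (simp_all add: ops zero_one add add.assoc add.commute)
  show "Group.comm_monoid (mpoly_ring V)"
    by (rule comm_monoidI) (simp_all add: ops zero_one mult mult.assoc mult.commute)
qed (simp add: mpoly_ring_def distrib_right)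

section \<open>Augmented Chow rings\<close>

datatype 'a chow_var = X "'a set" | Y 'a

definition chow_vars :: "'a set \<Rightarrow> 'a set set \<Rightarrow> 'a chow_var set" where
  "chow_vars E L = X ` (L - {E}) \<union> Y ` E"

definition chow_I1 :: "'a set \<Rightarrow> 'a set set \<Rightarrow> 'a chow_var mpolynomial set" where
  "chow_I1 E L = {mvar (X F) * mvar (X G) | F G.
     F \<in> L - {E} \<and> G \<in> L - {E} \<and> \<not> F \<subseteq> G \<and> \<not> G \<subseteq> F}"

definition chow_I2 :: "'a set \<Rightarrow> 'a set set \<Rightarrow> 'a chow_var mpolynomial set" where
  "chow_I2 E L = {mvar (Y i) * mvar (X F) | i F. i \<in> E \<and> F \<in> L - {E} \<and> i \<notin> F}"

definition chow_J :: "'a set \<Rightarrow> 'a set set \<Rightarrow> 'a chow_var mpolynomial set" where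
  "chow_J E L = {mvar (Y i) - (\<Sum>F\<in>{F \<in> L - {E}. i \<notin> F}. mvar (X F)) | i. i \<in> E}"

definition chow_ideal :: "'a set \<Rightarrow> 'a set set \<Rightarrow> 'a chow_var mpolynomial set" where
  "chow_ideal E L =
    genideal (mpoly_ring (chow_vars E L)) (chow_I1 E L \<union> chow_I2 E L \<union> chow_J E L)"

definition augmented_chow_ring ::
  "'a set \<Rightarrow> 'a set set \<Rightarrow> 'a chow_var mpolynomial set ring" where
  "augmented_chow_ring E L = mpoly_ring (chow_vars E L) Quot chow_ideal E L"

definition augmented_chow_class ::
  "'a set \<Rightarrow> 'a set set \<Rightarrow> 'a chow_var mpolynomial \<Rightarrow> 'a chow_var mpolynomial set" where
  "augmented_chow_class E L p = chow_ideal E L +>\<^bsub>mpoly_ring (chow_vars E L)\<^esub> p"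

text \<open>The copy of the rationals inside the augmented Chow ring, and its graded pieces.\<close>

definition augmented_chow_scalars :: "'a set \<Rightarrow> 'a set set \<Rightarrow> 'a chow_var mpolynomial set set" where
  "augmented_chow_scalars E L = range (\<lambda>c. augmented_chow_class E L (mconst c))"

definition augmented_chow_piece ::
  "'a set \<Rightarrow> 'a set set \<Rightarrow> nat \<Rightarrow> 'a chow_var mpolynomial set set" where
  "augmented_chow_piece E L j =
    augmented_chow_class E L ` {p \<in> carrier (mpoly_ring (chow_vars E L)). homogeneous j p}"

text \<open>The Hilbert series of \<open>R\<close> graded by \<open>piece\<close>, with \<open>K\<close> the copy of the base field in \<open>R\<close>.\<close>

definition Hilb :: "('a, 'b) ring_scheme \<Rightarrow> 'a set \<Rightarrow> (nat \<Rightarrow> 'a set) \<Rightarrow> rat fps" where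
  "Hilb R K piece = Abs_fps (\<lambda>j. of_nat (ring.dim R K (piece j)))"

definition augmented_chow_Hilb :: "'a set \<Rightarrow> 'a set set \<Rightarrow> rat fps" where
  "augmented_chow_Hilb E L =
    Hilb (augmented_chow_ring E L) (augmented_chow_scalars E L) (augmented_chow_piece E L)"

section \<open>Permutation statistics and \<open>q\<close>-Eulerian polynomials\<close>

definition exc :: "nat \<Rightarrow> (nat \<Rightarrow> nat) \<Rightarrow> nat" where
  "exc n \<sigma> = card {i \<in> {1..n}. i < \<sigma> i}"

definition maj :: "nat \<Rightarrow> (nat \<Rightarrow> nat) \<Rightarrow> nat" where
  "maj n \<sigma> = (\<Sum>i\<in>{i \<in> {1..<n}. \<sigma> i > \<sigma> (Suc i)}. i)"

text \<open>A decorated permutation is represented by its one-line word \<open>\<sigma>\<close>, extended by \<open>0\<close> outside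
  \<open>{1..n}\<close>; the permuted set is recovered as \<open>{i. \<sigma> i \<noteq> 0}\<close>.\<close>

definition decorated_permutations :: "nat \<Rightarrow> (nat \<Rightarrow> nat) set" where
  "decorated_permutations n =
    {\<lambda>i. if i \<in> S then \<pi> i else 0 | S \<pi>. S \<subseteq> {1..n} \<and> \<pi> permutes S}"

definition dexc :: "nat \<Rightarrow> (nat \<Rightarrow> nat) \<Rightarrow> int" where
  "dexc n \<sigma> = (if \<sigma> = (\<lambda>_. 0) then - 1 else int (exc n \<sigma>))"

definition dmaj :: "nat \<Rightarrow> (nat \<Rightarrow> nat) \<Rightarrow> int" where
  "dmaj n \<sigma> = (if \<sigma> = (\<lambda>_. 0) then - 1 else int (maj n \<sigma>))"

definition q_int :: "'a::field \<Rightarrow> nat \<Rightarrow> 'a" where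
  "q_int q m = (\<Sum>i<m. q ^ i)"

definition q_fact :: "'a::field \<Rightarrow> nat \<Rightarrow> 'a" where
  "q_fact q m = (\<Prod>i=1..m. q_int q i)"

definition q_binomial :: "'a::field \<Rightarrow> nat \<Rightarrow> nat \<Rightarrow> 'a" where
  "q_binomial q n k = q_fact q n / (q_fact q k * q_fact q (n - k))"

text \<open>Polynomials in \<open>t\<close> are power series in \<open>fps_X\<close>. The exponents of \<open>q\<close> are written as integers,
  so that no subtraction is truncated.\<close>

definition q_Eulerian :: "nat \<Rightarrow> 'a::field \<Rightarrow> 'a fps" where
  "q_Eulerian n q =
    (\<Sum>\<sigma> | \<sigma> permutes {1..n}.
      fps_const (q powi (int (maj n \<sigma>) - int (exc n \<sigma>))) * fps_X ^ exc n \<sigma>)"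

definition binomial_q_Eulerian :: "nat \<Rightarrow> 'a::field \<Rightarrow> 'a fps" where
  "binomial_q_Eulerian n q =
    1 + fps_X * (\<Sum>k=1..n. fps_const (q_binomial q n k) * q_Eulerian k q)"

end

theory Submission
  imports Defs "HOL-Library.FuncSet" "HOL-Computational_Algebra.Polynomial"
begin

text \<open>The proof has two independent halves, joined by a common recursion.

  Algebra. Give the top flat a variable \<open>x\<^sub>E\<close> by letting the sum of all \<open>x\<^sub>F\<close> vanish, and let
  \<open>S\<^sub>G\<close> be the sum of the \<open>x\<^sub>H\<close> over all flats \<open>H \<supseteq> G\<close>. For every matroid a basis of the augmented
  Chow ring is given by the monomials \<open>\<Prod> x\<^sub>G S\<^sub>G\<^bsup>a-1\<^esup>\<close> over chains of flats \<open>G\<close>, where \<open>1 \<le> a\<close> and \<open>a\<close>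
  is less than the jump of rank at \<open>G\<close>, the bottom of the chain lying at rank \<open>-1\<close>. They span by straightening
  (\<open>normal_span\<close>). They are independent because a linear functional on polynomials in the \<open>S\<^sub>G\<close>
  pairs them with dual monomials in a triangular way (\<open>deg_map_dual_nonzero\<close>,
  \<open>deg_map_dual_triangular\<close>): the functional takes the value \<open>1\<close> on a monomial if every flat \<open>T\<close>
  contains at most \<open>rk T\<close> of its factors, and \<open>0\<close> otherwise, a condition of Hall and Rado. The
  relations of the ring lie in its kernel because the rank is submodular and grows in steps of one.
  Cutting a chain at its lowest flat expresses the Hilbert
  series through those of upper intervals (\<open>chain_series_recursion\<close>), and for a uniform matroid over
  a finite field the flats above a given one are counted by Gaussian binomial coefficients
  (\<open>card_extensions\<close>, \<open>q_uniform_Hilb\<close>).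

  Combinatorics. The resulting recursion is solved by the \<open>q\<close>-Eulerian polynomials because of the
  theorem of Shareshian and Wachs that their \<open>q\<close>-exponential generating function is
  \<open>(1 - t) e(z) / (e(t z) - t e(z))\<close>; this is \<open>q_Eulerian_recursion\<close>. For its proof, permutations are
  paired with weakly decreasing sequences bounded by \<open>N\<close>. Summing over the sequences turns a permutation
  into a power of \<open>q\<close> times a Gaussian binomial coefficient, while summing over the permutations for
  a fixed sequence turns them into words with barred letters, whose weight is a coefficient of a
  product of linear forms (\<open>compat_sum_eq_diag_coeff\<close>). An identity in the style of MacMahon's Master
  theorem evaluates the latter (\<open>master_identity\<close>). Both sides are polynomials in \<open>u = q\<^sup>N\<close>, and the
  value at \<open>u = 0\<close> is the claim.

  The first formula of the theorem for decorated permutations follows by summing over the positions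
  of the zeros (\<open>decorated_sum\<close>). For rank \<open>n - 1\<close> the missing hyperplanes change the recursion; its
  solution, the polynomials \<open>derangement\<close> divided by \<open>t\<close>, is the \<open>q\<close>-binomial inverse of the
  Eulerian polynomials, and one more summation returns to the latter.\<close>

section \<open>Ranked lattices of flats\<close>

text \<open>The last axiom is the covering axiom of matroids in graded form: a flat and a further element
  span a flat of the next rank. All rank inequalities below come from it.\<close>

locale ranked_flats =
  fixes E :: "'a set" and L :: "'a set set" and rk :: "'a set \<Rightarrow> nat"
  assumes finite_E: "finite E"
    and L_subset: "L \<subseteq> Pow E"
    and E_in: "E \<in> L"
    and empty_in: "{} \<in> L"
    and inter_in: "F \<in> L \<Longrightarrow> G \<in> L \<Longrightarrow> F \<inter> G \<in> L"
    and rk_empty: "rk {} = 0"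
    and rk_insert: "F \<in> L \<Longrightarrow> i \<in> E - F \<Longrightarrow> rk (\<Inter>{H \<in> L. insert i F \<subseteq> H}) = Suc (rk F)"
begin

definition cl :: "'a set \<Rightarrow> 'a set" where
  "cl A = \<Inter>{H \<in> L. A \<subseteq> H}"

lemma finite_L: "finite L"
  using finite_E L_subset by (meson finite_Pow_iff finite_subset)

lemma flat_subset: "F \<in> L \<Longrightarrow> F \<subseteq> E"
  using L_subset by auto

lemma Inter_in: "finite \<F> \<Longrightarrow> \<F> \<noteq> {} \<Longrightarrow> \<F> \<subseteq> L \<Longrightarrow> \<Inter>\<F> \<in> L"
  by (induction \<F> rule: finite_ne_induct) (auto intro: inter_in)

lemma cl_in: "A \<subseteq> E \<Longrightarrow> cl A \<in> L"
  unfolding cl_def by (rule Inter_in) (use finite_L E_in in auto)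

lemma subset_cl: "A \<subseteq> cl A"
  by (auto simp: cl_def)

lemma cl_least: "G \<in> L \<Longrightarrow> A \<subseteq> G \<Longrightarrow> cl A \<subseteq> G"
  by (auto simp: cl_def)

lemma cl_subset_iff: "G \<in> L \<Longrightarrow> cl A \<subseteq> G \<longleftrightarrow> A \<subseteq> G"
  using subset_cl cl_least by blast

lemma cl_flat: "F \<in> L \<Longrightarrow> cl F = F"
  using subset_cl cl_least by blast

lemma rk_cl_insert: "F \<in> L \<Longrightarrow> i \<in> E - F \<Longrightarrow> rk (cl (insert i F)) = Suc (rk F)"
  using rk_insert by (simp add: cl_def)

lemma rk_strict: "F \<in> L \<Longrightarrow> G \<in> L \<Longrightarrow> F \<subset> G \<Longrightarrow> rk F < rk G"
proof (induction "card (G - F)" arbitrary: F rule: less_induct)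
  case less
  then obtain i where i: "i \<in> G - F" by auto
  let ?F = "cl (insert i F)"
  have iE: "insert i F \<subseteq> E" using i less.prems flat_subset by blast
  have F: "?F \<in> L" "?F \<subseteq> G" "insert i F \<subseteq> ?F"
    using less.prems i iE by (simp_all add: cl_in subset_cl cl_subset_iff)
  have r: "rk ?F = Suc (rk F)" using i less.prems flat_subset by (intro rk_cl_insert) auto
  show ?case
  proof (cases "?F = G")
    case False
    have "finite (G - F)" using less.prems finite_E flat_subset by (meson finite_Diff finite_subset)
    then have "card (G - ?F) < card (G - F)"
      using i F(3) by (intro psubset_card_mono) auto
    moreover have "?F \<subset> G" using F False by auto
    ultimately show ?thesis using less.hyps[of ?F] less.prems F r by auto
  qed (use r in auto)
qed

lemma rk_mono: "F \<in> L \<Longrightarrow> G \<in> L \<Longrightarrow> F \<subseteq> G \<Longrightarrow> rk F \<le> rk G"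
  using rk_strict by (metis order_less_imp_le order.order_iff_strict)

text \<open>Both joins arise by adding the same elements one at a time; each addition raises the
  smaller rank by exactly one and the larger one by at most one.\<close>

lemma semimodular:
  "A \<in> L \<Longrightarrow> B \<in> L \<Longrightarrow> A \<subseteq> B \<Longrightarrow> G \<subseteq> E \<Longrightarrow> rk (cl (B \<union> G)) + rk A \<le> rk (cl (A \<union> G)) + rk B"
proof (induction "card (G - A)" arbitrary: A B rule: less_induct)
  case less
  show ?case
  proof (cases "G \<subseteq> A")
    case True
    then have "A \<union> G = A" "B \<union> G = B" using less.prems by auto
    then show ?thesis using less.prems by (simp add: cl_flat)
  next
    case False
    then obtain i where i: "i \<in> G - A" by auto
    let ?A = "cl (insert i A)" and ?B = "cl (insert i B)"
    have sub: "insert i A \<subseteq> E" "insert i B \<subseteq> E" using i less.prems flat_subset by blast+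
    have A: "?A \<in> L" "?B \<in> L" using sub by (auto intro: cl_in)
    have AB: "?A \<subseteq> ?B" using A less.prems subset_cl[of "insert i B"] by (auto simp: cl_subset_iff)
    have c: "card (G - ?A) < card (G - A)"
      using i subset_cl[of "insert i A"] less.prems finite_E
      by (intro psubset_card_mono) (auto intro: finite_subset)
    have ih: "rk (cl (?B \<union> G)) + rk ?A \<le> rk (cl (?A \<union> G)) + rk ?B"
      using less.hyps[OF c A AB] less.prems by auto
    have j: "cl (cl (insert i C) \<union> G) = cl (C \<union> G)" if "C \<in> L" for C
    proof -
      have CE: "C \<union> G \<subseteq> E" "insert i C \<subseteq> E" using that less.prems flat_subset i by blast+
      have "cl (insert i C) \<union> G \<subseteq> E" using cl_in[OF CE(2)] flat_subset less.prems by auto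
      then have D: "cl (C \<union> G) \<in> L" "cl (cl (insert i C) \<union> G) \<in> L" using CE by (auto intro: cl_in)
      have "insert i C \<subseteq> cl (C \<union> G)" using subset_cl[of "C \<union> G"] i by auto
      then have 1: "cl (insert i C) \<union> G \<subseteq> cl (C \<union> G)"
        using subset_cl[of "C \<union> G"] D cl_least by blast
      have 2: "C \<union> G \<subseteq> cl (cl (insert i C) \<union> G)"
        using subset_cl[of "insert i C"] subset_cl[of "cl (insert i C) \<union> G"] by auto
      show ?thesis using 1 2 D by (meson cl_least subset_antisym)
    qed
    have rA: "rk ?A = Suc (rk A)" using i less.prems by (intro rk_cl_insert) auto
    have rB: "rk ?B \<le> Suc (rk B)"
    proof (cases "i \<in> B")
      case True
      then show ?thesis using less.prems by (simp add: insert_absorb cl_flat)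
    next
      case False
      then show ?thesis using i less.prems rk_cl_insert[of B i] by auto
    qed
    show ?thesis using ih rA rB j less.prems by simp
  qed
qed

subsection \<open>Normal chains\<close>

abbreviation r :: nat where "r \<equiv> rk E"

text \<open>A normal chain is built over a bottom \<open>p\<close>, which is a flat or \<open>None\<close>; the latter is a formal
  bottom of rank \<open>-1\<close> below the empty flat, and is what distinguishes the augmented Chow ring from the
  Chow ring. An entry \<open>(G, a)\<close> stands for the factor of degree \<open>a\<close> at the flat \<open>G\<close>.\<close>

fun valid :: "'a set option \<Rightarrow> bool" where
  "valid None = True" | "valid (Some F) = (F \<in> L)"

fun above :: "'a set option \<Rightarrow> 'a set \<Rightarrow> bool" where
  "above None G = True" | "above (Some F) G = (F \<subset> G)"

fun gap :: "'a set option \<Rightarrow> 'a set \<Rightarrow> nat" where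
  "gap None G = Suc (rk G)" | "gap (Some F) G = rk G - rk F"

fun normal :: "'a set option \<Rightarrow> ('a set \<times> nat) list \<Rightarrow> bool" where
  "normal p [] = True"
| "normal p ((G, a) # xs) = (G \<in> L \<and> above p G \<and> 1 \<le> a \<and> a < gap p G \<and> normal (Some G) xs)"

definition deg :: "('a set \<times> nat) list \<Rightarrow> nat" where
  "deg xs = sum_list (map snd xs)"

lemma deg_simps [simp]: "deg [] = 0" "deg ((G, a) # xs) = a + deg xs"
  by (simp_all add: deg_def)

lemma gap_pos: "valid p \<Longrightarrow> G \<in> L \<Longrightarrow> above p G \<Longrightarrow> gap p G > 0"
  by (cases p) (auto simp: rk_strict)

lemma gap_trans: "valid p \<Longrightarrow> G \<in> L \<Longrightarrow> above p G \<Longrightarrow> H \<in> L \<Longrightarrow> G \<subseteq> H \<Longrightarrow>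
    gap p H = gap p G + (rk H - rk G)"
  using rk_mono[of G H] by (cases p) (auto simp: rk_strict less_imp_le)

lemma normal_deg: "normal p xs \<Longrightarrow> valid p \<Longrightarrow> deg xs \<le> gap p E - 1"
proof (induction p xs rule: normal.induct)
  case (2 p G a xs)
  then have G: "G \<in> L" "above p G" "a < gap p G" and "deg xs \<le> gap (Some G) E - 1" by auto
  then show ?case using gap_trans[of p G E] 2 E_in flat_subset by auto
qed auto

end

section \<open>The relations of the Chow ring\<close>

locale ring_ideal =
  fixes I :: "'r::comm_ring_1 set"
  assumes I_zero: "0 \<in> I" and I_add: "a \<in> I \<Longrightarrow> b \<in> I \<Longrightarrow> a + b \<in> I"
    and I_mult: "a \<in> I \<Longrightarrow> c * a \<in> I"
begin

lemma I_uminus: "a \<in> I \<Longrightarrow> - a \<in> I"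
  using I_mult[of a "-1"] by simp

lemma I_diff: "a \<in> I \<Longrightarrow> b \<in> I \<Longrightarrow> a - b \<in> I"
  using I_add[of a "- b"] I_uminus by simp

lemma I_mult2: "a \<in> I \<Longrightarrow> a * c \<in> I"
  using I_mult[of a c] by (simp add: mult.commute)

lemma I_sum: "(\<And>i. i \<in> A \<Longrightarrow> f i \<in> I) \<Longrightarrow> sum f A \<in> I"
  by (induction A rule: infinite_finite_induct) (auto intro: I_zero I_add)

lemma I_cong: "a - b \<in> I \<Longrightarrow> a \<in> I \<longleftrightarrow> b \<in> I"
  using I_diff[of a "a - b"] I_add[of "a - b" b] by auto

end

text \<open>Straightening has integer coefficients, so additive hulls suffice to speak about spanning, and
  no action of scalars has to be carried along.\<close>

inductive_set add_hull :: "'r::ab_group_add set \<Rightarrow> 'r set" for A where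
  zero: "0 \<in> add_hull A"
| base: "a \<in> A \<Longrightarrow> a \<in> add_hull A"
| diff: "a \<in> add_hull A \<Longrightarrow> b \<in> add_hull A \<Longrightarrow> a - b \<in> add_hull A"

lemma add_hull_add: "a \<in> add_hull A \<Longrightarrow> b \<in> add_hull A \<Longrightarrow> a + b \<in> add_hull A"
  using add_hull.diff[of a A "0 - b"] add_hull.diff[of 0 A b] by (simp add: add_hull.zero)

lemma add_hull_sum: "(\<And>i. i \<in> J \<Longrightarrow> f i \<in> add_hull A) \<Longrightarrow> sum f J \<in> add_hull A"
  by (induction J rule: infinite_finite_induct) (auto intro: add_hull.zero add_hull_add)

lemma add_hull_mult:
  fixes c :: "'r::comm_ring_1"
  assumes "a \<in> add_hull A" "\<And>a. a \<in> A \<Longrightarrow> c * a \<in> add_hull B"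
  shows "c * a \<in> add_hull B"
  using assms(1) by induction (auto intro: add_hull.intros assms(2) simp: right_diff_distrib)

lemma prod_list_filter:
  fixes f :: "'b \<Rightarrow> 'r::comm_monoid_mult"
  shows "prod_list (map f ms) = prod_list (map f (filter P ms)) * prod_list (map f (filter (\<lambda>x. \<not> P x) ms))"
  by (induction ms) (auto simp: ac_simps)

lemma prod_list_split2:
  fixes f :: "'b \<Rightarrow> 'r::comm_monoid_mult"
  assumes "B \<in> set ms" "C \<in> set ms" "B \<noteq> C"
  shows "\<exists>y. prod_list (map f ms) = f B * f C * y"
proof -
  have one: "\<exists>y. prod_list (map f ks) = f B * y" if "B \<in> set ks" for B ks
    using split_list[OF that] by (auto simp: ac_simps)
  have "C \<in> set (filter (\<lambda>x. x \<noteq> B) ms)" "B \<in> set (filter (\<lambda>x. \<not> x \<noteq> B) ms)" using assms by auto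
  from one[OF this(1)] one[OF this(2)] show ?thesis
    by (subst prod_list_filter[of f ms "\<lambda>x. x \<noteq> B"]) (metis mult.assoc mult.commute)
qed

text \<open>These relations are all that straightening uses. They are stated for arbitrary ring elements
  because they are needed twice: in the presentation of the ring, and in the target of the functional
  that proves independence.\<close>

locale chow_relations = ranked_flats E L rk + ring_ideal I
  for E :: "'a set" and L rk and I :: "'r::comm_ring_1 set" +
  fixes x :: "'a set \<Rightarrow> 'r"
  assumes x_incomparable: "F \<in> L \<Longrightarrow> G \<in> L \<Longrightarrow> \<not> F \<subseteq> G \<Longrightarrow> \<not> G \<subseteq> F \<Longrightarrow> x F * x G \<in> I"
    and x_total: "(\<Sum>F\<in>L. x F) \<in> I"
    and x_atom: "F \<in> L \<Longrightarrow> i \<in> E - F \<Longrightarrow> x F * (\<Sum>H\<in>{H \<in> L. i \<in> H}. x H) \<in> I"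
begin

definition S :: "'a set \<Rightarrow> 'r" where
  "S G = (\<Sum>H\<in>{H \<in> L. G \<subseteq> H}. x H)"

fun start :: "'a set option \<Rightarrow> 'r" where
  "start None = 1" | "start (Some F) = x F"

lemma S_diff: "A \<subseteq> B \<Longrightarrow> S A - S B = (\<Sum>H\<in>{H \<in> L. A \<subseteq> H \<and> \<not> B \<subseteq> H}. x H)"
proof -
  assume AB: "A \<subseteq> B"
  have "{H \<in> L. A \<subseteq> H} = {H \<in> L. B \<subseteq> H} \<union> {H \<in> L. A \<subseteq> H \<and> \<not> B \<subseteq> H}" using AB by auto
  then have "S A = S B + (\<Sum>H\<in>{H \<in> L. A \<subseteq> H \<and> \<not> B \<subseteq> H}. x H)"
    unfolding S_def by (simp add: sum.union_disjoint[symmetric] finite_L disjoint_iff)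
  then show ?thesis by simp
qed

lemma x_S_join: "A \<in> L \<Longrightarrow> \<not> G \<subseteq> A \<Longrightarrow> x A * S G - x A * S (A \<union> G) \<in> I"
proof -
  assume A: "A \<in> L" "\<not> G \<subseteq> A"
  have "x A * S G - x A * S (A \<union> G) = (\<Sum>H\<in>{H \<in> L. G \<subseteq> H \<and> \<not> A \<union> G \<subseteq> H}. x A * x H)"
    using S_diff[of G "A \<union> G"] by (simp add: right_diff_distrib[symmetric] sum_distrib_left)
  also have "\<dots> \<in> I" by (rule I_sum) (use A in \<open>auto intro!: x_incomparable\<close>)
  finally show ?thesis .
qed

text \<open>Choose \<open>i \<in> G - A\<close>. Since \<open>x A\<close> kills \<open>S (A \<union> {i})\<close>, the factor \<open>S G\<close> may be replaced by
  minus the sum of the \<open>x B\<close> over flats \<open>B\<close> containing \<open>A\<close> and \<open>i\<close> but not \<open>G\<close>; over each of these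
  the rank of \<open>G\<close> has dropped.\<close>

lemma x_S_power: "A \<in> L \<Longrightarrow> G \<subseteq> E \<Longrightarrow> \<not> G \<subseteq> A \<Longrightarrow> rk (cl (A \<union> G)) \<le> rk A + d \<Longrightarrow> x A * S G ^ d \<in> I"
proof (induction d arbitrary: A)
  case 0
  have AG: "A \<union> G \<subseteq> E" using 0 flat_subset by auto
  have "A \<subset> cl (A \<union> G)" using subset_cl[of "A \<union> G"] 0 by auto
  then have "rk A < rk (cl (A \<union> G))" using 0 cl_in[OF AG] by (intro rk_strict) auto
  then show ?case using 0 by auto
next
  case (Suc d)
  obtain i where i: "i \<in> G - A" using Suc.prems by auto
  have iE: "insert i A \<subseteq> E" "i \<in> E - A" using i Suc.prems flat_subset by blast+
  have a0: "x A * S {i} \<in> I" using x_atom[OF Suc.prems(1) iE(2)] by (simp add: S_def)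
  have ai: "x A * S (insert i A) \<in> I"
    using x_S_join[of A "{i}"] a0 Suc.prems i I_cong by auto
  have eq: "x A * S G ^ Suc d = (x A * S G - x A * S (A \<union> G)) * S G ^ d
      + x A * S (insert i A) * S G ^ d
      - (\<Sum>B\<in>{B \<in> L. insert i A \<subseteq> B \<and> \<not> A \<union> G \<subseteq> B}. x B * S G ^ d) * x A"
    using S_diff[of "insert i A" "A \<union> G"] i
    by (simp add: sum_distrib_right[symmetric] algebra_simps)
  have "x B * S G ^ d \<in> I" if B: "B \<in> L" "insert i A \<subseteq> B" "\<not> A \<union> G \<subseteq> B" for B
  proof (rule Suc.IH)
    let ?A = "cl (insert i A)"
    have A': "?A \<in> L" "?A \<subseteq> B" using cl_in[OF iE(1)] B by (auto simp: cl_subset_iff)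
    have "cl (?A \<union> G) = cl (A \<union> G)"
    proof -
      have AG: "A \<union> G \<subseteq> E" "?A \<union> G \<subseteq> E" using Suc.prems flat_subset A' by blast+
      have "insert i A \<subseteq> cl (A \<union> G)" using subset_cl[of "A \<union> G"] i by auto
      then have "?A \<subseteq> cl (A \<union> G)" using cl_in[OF AG(1)] cl_least by blast
      then have "cl (?A \<union> G) \<subseteq> cl (A \<union> G)"
        using cl_in[OF AG(1)] subset_cl[of "A \<union> G"] by (intro cl_least) auto
      moreover have "cl (A \<union> G) \<subseteq> cl (?A \<union> G)"
        using cl_in[OF AG(2)] subset_cl[of "?A \<union> G"] subset_cl[of "insert i A"]
        by (intro cl_least) auto
      ultimately show ?thesis by auto
    qed
    moreover have "rk ?A = Suc (rk A)" using iE Suc.prems by (intro rk_cl_insert) auto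
    ultimately show "rk (cl (B \<union> G)) \<le> rk B + d"
      using semimodular[OF A'(1) B(1) A'(2), of G] Suc.prems by auto
  qed (use Suc.prems B in auto)
  then have "(\<Sum>B\<in>{B \<in> L. insert i A \<subseteq> B \<and> \<not> A \<union> G \<subseteq> B}. x B * S G ^ d) \<in> I"
    by (intro I_sum) auto
  moreover have "x A * S G - x A * S (A \<union> G) \<in> I" using x_S_join Suc.prems by blast
  ultimately show ?case unfolding eq using ai by (intro I_diff[OF I_add[OF I_mult2 I_mult2] I_mult2])
qed

lemma S_power: "G \<in> L \<Longrightarrow> S G ^ Suc (rk G) \<in> I"
proof -
  assume G: "G \<in> L"
  have "S {} \<in> I" using x_total by (simp add: S_def)
  moreover have "S G ^ Suc (rk G) = S {} * S G ^ rk G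
     - (\<Sum>B\<in>{B \<in> L. {} \<subseteq> B \<and> \<not> G \<subseteq> B}. x B * S G ^ rk G)"
    using S_diff[of "{}" G] by (simp add: sum_distrib_right[symmetric] algebra_simps)
  moreover have "x B * S G ^ rk G \<in> I" if "B \<in> L" "\<not> G \<subseteq> B" for B
    using that G semimodular[of "{}" B G] flat_subset
    by (intro x_S_power) (auto simp: empty_in rk_empty cl_flat)
  ultimately show ?thesis by (metis (no_types, lifting) I_diff I_mult2 I_sum mem_Collect_eq)
qed

lemma start_S_power:
  assumes "valid p" "G \<in> L" "above p G" "gap p G \<le> d"
  shows "start p * S G ^ d \<in> I"
proof -
  have "start p * S G ^ gap p G \<in> I"
  proof (cases p)
    case (Some F)
    then have "F \<union> G = G" "rk F \<le> rk G" using assms rk_mono by auto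
    then show ?thesis using assms Some flat_subset by (auto intro!: x_S_power simp: cl_flat)
  qed (use assms S_power in auto)
  then have "start p * S G ^ gap p G * S G ^ (d - gap p G) \<in> I" by (rule I_mult2)
  then show ?thesis using assms by (simp add: mult.assoc power_add[symmetric])
qed

subsection \<open>Normal monomials span\<close>

fun nmon :: "('a set \<times> nat) list \<Rightarrow> 'r" where
  "nmon [] = 1" | "nmon ((G, a) # xs) = x G * S G ^ (a - 1) * nmon xs"

abbreviation xprod :: "'a set list \<Rightarrow> 'r" where "xprod ms \<equiv> prod_list (map x ms)"
abbreviation Sprod :: "'a set list \<Rightarrow> 'r" where "Sprod ms \<equiv> prod_list (map S ms)"

definition normal_hull :: "'a set option \<Rightarrow> nat \<Rightarrow> 'r set" where
  "normal_hull p d = add_hull (I \<union> {start p * nmon xs | xs. normal p xs \<and> deg xs = d})"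

fun not_below :: "'a set option \<Rightarrow> 'a set \<Rightarrow> bool" where
  "not_below None B = True" | "not_below (Some F) B = (\<not> B \<subseteq> F)"

definition weight :: "'a set list \<Rightarrow> nat" where
  "weight ms = sum_list (map (\<lambda>B. Suc r - rk B) ms)"

lemma weight_simps [simp]: "weight [] = 0" "weight (B # ms) = Suc r - rk B + weight ms"
  "weight (ms @ ns) = weight ms + weight ns" "weight (replicate k B) = k * (Suc r - rk B)"
  by (simp_all add: weight_def sum_list_replicate)

lemma hull_I: "a \<in> I \<Longrightarrow> a \<in> normal_hull p d"
  unfolding normal_hull_def by (auto intro: add_hull.base)

lemma hull_S_power:
  assumes G: "G \<in> L" "not_below p G"
    and hyp: "\<And>ms. weight ms < w \<Longrightarrow> set ms \<subseteq> L \<Longrightarrow> (\<forall>B\<in>set ms. not_below p B) \<Longrightarrow> length ms = d \<Longrightarrow>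
      start p * xprod ms \<in> normal_hull p d"
  shows "weight ms + j * (Suc r - rk G) < w \<Longrightarrow> set ms \<subseteq> L \<Longrightarrow> (\<forall>B\<in>set ms. not_below p B) \<Longrightarrow>
    length ms + j = d \<Longrightarrow> start p * xprod ms * S G ^ j \<in> normal_hull p d"
proof (induction j arbitrary: ms)
  case 0
  then show ?case using hyp[of ms] by simp
next
  case (Suc j)
  have "start p * xprod ms * S G ^ Suc j
      = (\<Sum>H\<in>{H \<in> L. G \<subseteq> H}. start p * xprod (H # ms) * S G ^ j)"
    unfolding list.map prod_list.Cons power_Suc2
    by (subst (2) S_def) (simp only: sum_distrib_left sum_distrib_right ac_simps)
  also have "\<dots> \<in> normal_hull p d"
    unfolding normal_hull_def
  proof (rule add_hull_sum, fold normal_hull_def)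
    fix H assume H: "H \<in> {H \<in> L. G \<subseteq> H}"
    then have "rk G \<le> rk H" using rk_mono G by auto
    moreover have "not_below p H" using H G by (cases p) auto
    ultimately show "start p * xprod (H # ms) * S G ^ j \<in> normal_hull p d"
      using Suc.prems H by (intro Suc.IH) auto
  qed
  finally show ?case .
qed

lemma minimal_of_chain:
  assumes "ms \<noteq> []" "\<And>B C. B \<in> set ms \<Longrightarrow> C \<in> set ms \<Longrightarrow> B \<subseteq> C \<or> C \<subseteq> B"
  shows "\<exists>G\<in>set ms. \<forall>B\<in>set ms. G \<subseteq> (B::'a set)"
  using assms
proof (induction ms rule: list_nonempty_induct)
  case (cons A ms)
  then obtain G where G: "G \<in> set ms" "\<forall>B\<in>set ms. G \<subseteq> B" by (metis list.set_intros(2))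
  show ?case using cons.prems[of A G] G by (cases "A \<subseteq> G") auto
qed simp

text \<open>Products of incomparable flats vanish, so the flats form a chain. For its lowest flat \<open>G\<close> of
  multiplicity \<open>a\<close>, replace \<open>x G\<close> by \<open>S G\<close> minus the \<open>x H\<close> for larger \<open>H\<close> until at most one factor \<open>x G\<close> is
  left: the correction terms have flats of larger rank, hence smaller weight. Too high a power of \<open>S G\<close>
  vanishes; otherwise the rest of the chain is straightened above \<open>G\<close>.\<close>

theorem normal_span:
  "valid p \<Longrightarrow> set ms \<subseteq> L \<Longrightarrow> (\<forall>B\<in>set ms. not_below p B) \<Longrightarrow>
    start p * xprod ms \<in> normal_hull p (length ms)"
proof (induction "weight ms" arbitrary: p ms rule: less_induct)
  case less
  show ?case
  proof (cases "ms = []")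
    case True
    then show ?thesis unfolding normal_hull_def
      by (intro add_hull.base UnI2 CollectI exI[of _ "[]"]) simp
  next
    case ne: False
    consider (inc) B C where "B \<in> set ms" "C \<in> set ms" "\<not> B \<subseteq> C" "\<not> C \<subseteq> B"
      | (incp) B where "B \<in> set ms" "\<not> above p B"
      | (chain) "\<And>B C. B \<in> set ms \<Longrightarrow> C \<in> set ms \<Longrightarrow> B \<subseteq> C \<or> C \<subseteq> B" "\<And>B. B \<in> set ms \<Longrightarrow> above p B"
      by blast
    then show ?thesis
    proof cases
      case inc
      then obtain y where y: "xprod ms = x B * x C * y" using prod_list_split2[of B ms C x] by auto
      show ?thesis unfolding y
        by (intro hull_I I_mult I_mult2 x_incomparable) (use inc less.prems in auto)
    next
      case incp
      then obtain F where F: "p = Some F" by (cases p) auto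
      obtain ys zs where y: "ms = ys @ B # zs" using split_list[OF incp(1)] by auto
      have "x F * x B \<in> I" using incp less.prems F by (intro x_incomparable) auto
      then have "x F * x B * (xprod ys * xprod zs) \<in> I" by (rule I_mult2)
      then show ?thesis unfolding y F by (intro hull_I) (simp add: ac_simps)
    next
      case chain
      then obtain G where G: "G \<in> set ms" "\<forall>B\<in>set ms. G \<subseteq> B"
        using minimal_of_chain[OF ne] by blast
      define R where "R = filter (\<lambda>B. B \<noteq> G) ms"
      define a where "a = length (filter (\<lambda>B. B = G) ms)"
      define w where "w = weight ms"
      define d where "d = length ms"
      have GL: "G \<in> L" "above p G" "not_below p G" using G less.prems chain by auto
      have fr: "filter (\<lambda>B. B = G) ms = replicate a G" unfolding a_def by (induction ms) auto
      have ms: "xprod ms = x G ^ a * xprod R"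
        using prod_list_filter[of x ms "\<lambda>B. B = G"] fr by (simp add: R_def prod_list_replicate)
      have lenw: "length ms = a + length R \<and> weight ms = a * (Suc r - rk G) + weight R"
        unfolding a_def R_def by (induction ms) auto
      then have len: "d = a + length R" and wt: "w = a * (Suc r - rk G) + weight R"
        by (auto simp: d_def w_def)
      have a1: "a \<ge> 1" using G(1) unfolding a_def by (induction ms) auto
      have rG: "Suc r - rk G > 0" using rk_mono[OF GL(1) E_in flat_subset[OF GL(1)]] by simp
      have R: "set R \<subseteq> L" "\<forall>B\<in>set R. not_below p B" "\<forall>B\<in>set R. G \<subset> B"
        using less.prems G by (auto simp: R_def)
      have hyp: "start p * xprod ms' \<in> normal_hull p d"
        if "weight ms' < w" "set ms' \<subseteq> L" "\<forall>B\<in>set ms'. not_below p B" "length ms' = d" for ms'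
        using less.hyps[of ms' p] that less.prems by (auto simp: w_def)
      \<comment> \<open>Trading one factor \<open>S G\<close> for \<open>x G\<close> costs terms of smaller weight.\<close>
      have step: "start p * x G ^ Suc i * S G ^ j * xprod R \<in> normal_hull p d"
        if "start p * x G ^ i * S G ^ Suc j * xprod R \<in> normal_hull p d" "Suc i + j = a" for i j
      proof -
        let ?U = "{H \<in> L. G \<subseteq> H \<and> H \<noteq> G}"
        have SG: "S G = x G + (\<Sum>H\<in>?U. x H)"
        proof -
          have "{H \<in> L. G \<subseteq> H} = insert G ?U" using GL by auto
          then show ?thesis unfolding S_def by (simp add: finite_L)
        qed
        have "start p * x G ^ Suc i * S G ^ j * xprod R = start p * x G ^ i * S G ^ Suc j * xprod R
          - (\<Sum>H\<in>?U. start p * xprod (H # replicate i G @ R) * S G ^ j)"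
          by (subst power_Suc[of "S G"], subst SG)
             (simp add: sum_distrib_left sum_distrib_right algebra_simps prod_list_replicate)
        also have "\<dots> \<in> normal_hull p d"
          unfolding normal_hull_def
        proof (intro add_hull.diff add_hull_sum, fold normal_hull_def)
          fix H assume H: "H \<in> ?U"
          then have rH: "rk G < rk H" using GL by (intro rk_strict) auto
          show "start p * xprod (H # replicate i G @ R) * S G ^ j \<in> normal_hull p d"
          proof (rule hull_S_power[OF GL(1,3) hyp])
            have "w = (Suc r - rk G) + i * (Suc r - rk G) + j * (Suc r - rk G) + weight R"
              unfolding wt that(2)[symmetric] by (simp add: distrib_right)
            then show "weight (H # replicate i G @ R) + j * (Suc r - rk G) < w"
              using rH rG by simp
            show "\<forall>B\<in>set (H # replicate i G @ R). not_below p B"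
              using H R GL by (cases p) auto
          qed (use H R GL len that in auto)
        qed (use that in auto)
        finally show ?thesis .
      qed
      have up: "start p * x G ^ a * xprod R \<in> normal_hull p d"
        if "start p * x G ^ i * S G ^ j * xprod R \<in> normal_hull p d" "i + j = a" for i j
        using that
      proof (induction j arbitrary: i)
        case (Suc j)
        then show ?case using step[of i j] by auto
      qed auto
      show ?thesis
      proof (cases "a < gap p G")
        case False
        then have "start p * S G ^ a \<in> I" using start_S_power GL less.prems by auto
        then have "start p * S G ^ a * xprod R \<in> I" by (rule I_mult2)
        then show ?thesis using up[of 0 a] hull_I by (simp add: ms d_def mult.assoc)
      next
        case True
        have "weight R < weight ms" using wt a1 rG by (auto simp: w_def)
        then have "start (Some G) * xprod R \<in> normal_hull (Some G) (length R)"
          using GL R by (intro less.hyps) auto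
        then have "start p * S G ^ (a - 1) * (start (Some G) * xprod R) \<in> normal_hull p d"
          unfolding normal_hull_def
        proof (rule add_hull_mult, fold normal_hull_def)
          fix u assume "u \<in> I \<union> {start (Some G) * nmon xs |xs. normal (Some G) xs \<and> deg xs = length R}"
          then consider "u \<in> I" | xs where "u = start (Some G) * nmon xs" "normal (Some G) xs" "deg xs = length R" by blast
          then show "start p * S G ^ (a - 1) * u \<in> normal_hull p d"
          proof cases
            case 2
            have "start p * S G ^ (a - 1) * u = start p * nmon ((G, a) # xs)"
              using 2 by (simp add: ac_simps)
            moreover have "normal p ((G, a) # xs)" "deg ((G, a) # xs) = d"
              using 2 GL a1 True len by auto
            ultimately show ?thesis unfolding normal_hull_def by (blast intro: add_hull.base)
          qed (auto intro: hull_I I_mult)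
        qed
        then show ?thesis using up[of 1 "a - 1"] a1 by (simp add: ms d_def ac_simps)
      qed
    qed
  qed
qed

text \<open>Straightening above \<open>A\<close> leaves only normal monomials of degree at least \<open>r - rk A\<close>, and there
  are none.\<close>

lemma x_top_degree:
  assumes "A \<in> L" "A \<noteq> E" "set ms \<subseteq> L" "\<forall>B\<in>set ms. \<not> B \<subseteq> A" "r - rk A \<le> length ms"
  shows "x A * xprod ms \<in> I"
proof -
  have "rk A < r" using assms E_in flat_subset by (intro rk_strict) auto
  then have "\<not> (normal (Some A) xs \<and> deg xs = length ms)" for xs
    using normal_deg[of "Some A" xs] assms by auto
  then have none: "{start (Some A) * nmon xs |xs. normal (Some A) xs \<and> deg xs = length ms} = {}"
    by blast
  have "x A * xprod ms \<in> add_hull I"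
    using normal_span[of "Some A" ms] assms(1,3,4) unfolding normal_hull_def none by simp
  then show ?thesis by induction (auto intro: I_zero I_diff)
qed

lemma x_top_degree_mixed:
  "A \<in> L \<Longrightarrow> A \<noteq> E \<Longrightarrow> set ms \<subseteq> L \<Longrightarrow> set ks \<subseteq> L \<Longrightarrow> \<forall>B\<in>set ms \<union> set ks. \<not> B \<subseteq> A \<Longrightarrow>
    r - rk A \<le> length ms + length ks \<Longrightarrow> x A * xprod ms * Sprod ks \<in> I"
proof (induction ks arbitrary: ms)
  case Nil
  then show ?case using x_top_degree[of A ms] by simp
next
  case (Cons G ks)
  have "x A * xprod ms * Sprod (G # ks) = (\<Sum>H\<in>{H \<in> L. G \<subseteq> H}. x A * xprod (H # ms) * Sprod ks)"
    unfolding list.map prod_list.Cons S_def[of G] sum_distrib_left sum_distrib_right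
    by (rule sum.cong) (simp_all only: ac_simps)
  also have "\<dots> \<in> I"
  proof (rule I_sum)
    fix H assume H: "H \<in> {H \<in> L. G \<subseteq> H}"
    show "x A * xprod (H # ms) * Sprod ks \<in> I" by (rule Cons.IH) (use Cons.prems H in auto)
  qed
  finally show ?case .
qed

end

context ranked_flats begin

fun next_flat :: "('a set \<times> nat) list \<Rightarrow> 'a set" where
  "next_flat [] = E" | "next_flat ((G, a) # xs) = G"

text \<open>The chain \<open>dual p xs\<close> lists the factors \<open>S B\<close> that complete the normal monomial of \<open>xs\<close> to top
  degree, and \<open>full p xs\<close> lists the factors \<open>S B\<close> of the resulting product, up to sign. A power of
  \<open>S G\<close> that would reach the jump of rank at \<open>G\<close> vanishes, so one factor moves on to the next flat of the
  chain.\<close>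

fun dual :: "'a set option \<Rightarrow> ('a set \<times> nat) list \<Rightarrow> 'a set list" where
  "dual p [] = replicate (gap p E - 1) E"
| "dual p ((G, a) # xs) = (if G = E then replicate (gap p E - 1 - a) E
     else replicate (gap p G - a) G @ dual (Some G) xs)"

fun full :: "'a set option \<Rightarrow> ('a set \<times> nat) list \<Rightarrow> 'a set list" where
  "full p [] = replicate (gap p E - 1) E"
| "full p ((G, a) # xs) = (if G = E then replicate (gap p E - 1) E
     else replicate (gap p G - 1) G @ next_flat xs # full (Some G) xs)"

lemma rk_less_top: "G \<in> L \<Longrightarrow> G \<noteq> E \<Longrightarrow> rk G < r"
  using rk_strict E_in flat_subset by (metis psubsetI)

lemma normal_top: "normal (Some E) xs \<Longrightarrow> xs = []"
proof (cases xs)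
  case (Cons y ys)
  assume "normal (Some E) xs"
  then have "fst y \<in> L" "E \<subset> fst y" using Cons by (cases y; auto)+
  then show ?thesis using flat_subset by blast
qed

lemma top_subset_iff: "T \<in> L \<Longrightarrow> E \<subseteq> T \<longleftrightarrow> T = E"
  using flat_subset by blast

lemma list_all2_replicate: "\<forall>B\<in>set D. B \<subseteq> G \<Longrightarrow> list_all2 (\<subseteq>) D (replicate (length D) G)"
  by (induction D) auto

lemma list_all2_replicate_top: "set D \<subseteq> L \<Longrightarrow> list_all2 (\<subseteq>) D (replicate (length D) E)"
  using flat_subset by (intro list_all2_replicate) blast

lemma sorted_replicate: "sorted_wrt (\<subseteq>) (replicate k G)"
  by (induction k) auto

lemma normal_next: "normal p xs \<Longrightarrow> valid p \<Longrightarrow> p \<noteq> Some E \<Longrightarrow> next_flat xs \<in> L \<and> above p (next_flat xs)"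
  using flat_subset E_in by (cases xs; cases p) auto

lemma length_dual: "normal p xs \<Longrightarrow> valid p \<Longrightarrow> length (dual p xs) + deg xs = gap p E - 1"
proof (induction p xs rule: normal.induct)
  case (2 p G a xs)
  show ?case
  proof (cases "G = E")
    case True
    then show ?thesis using 2 normal_top by auto
  next
    case False
    then have "length (dual (Some G) xs) + deg xs = gap (Some G) E - 1" using 2 by auto
    then show ?thesis using 2 False gap_trans[of p G E] E_in flat_subset rk_less_top[of G] by auto
  qed
qed auto

lemma length_full: "normal p xs \<Longrightarrow> valid p \<Longrightarrow> length (full p xs) = gap p E - 1"
proof (induction p xs rule: normal.induct)
  case (2 p G a xs)
  show ?case
  proof (cases "G = E")
    case True
    then show ?thesis using 2 normal_top by auto
  next
    case False
    then have "length (full (Some G) xs) = gap (Some G) E - 1" using 2 by auto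
    then show ?thesis using 2 False gap_trans[of p G E] E_in flat_subset rk_less_top[of G] by auto
  qed
qed auto

lemma dual_in_L: "normal p xs \<Longrightarrow> set (dual p xs) \<subseteq> L"
  by (induction p xs rule: normal.induct) (auto simp: E_in)

lemma next_subset_full: "normal p xs \<Longrightarrow> valid p \<Longrightarrow> B \<in> set (full p xs) \<Longrightarrow> B \<in> L \<and> next_flat xs \<subseteq> B"
proof (induction p xs rule: normal.induct)
  case (2 p G a xs)
  show ?case
  proof (cases "G = E")
    case False
    have "next_flat xs \<in> L \<and> G \<subset> next_flat xs" using 2 False normal_next[of "Some G" xs] by auto
    then show ?thesis using 2 False by (auto split: if_splits)
  qed (use 2 E_in in auto)
qed (auto simp: E_in)

lemma next_subset_dual: "normal p xs \<Longrightarrow> valid p \<Longrightarrow> B \<in> set (dual p xs) \<Longrightarrow> next_flat xs \<subseteq> B"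
proof (induction p xs rule: normal.induct)
  case (2 p G a xs)
  show ?case
  proof (cases "G = E")
    case False
    have "next_flat xs \<in> L \<and> G \<subset> next_flat xs" using 2 False normal_next[of "Some G" xs] by auto
    then show ?thesis using 2 False by (auto split: if_splits)
  qed (use 2 E_in in auto)
qed auto

lemma dual_sorted: "normal p xs \<Longrightarrow> valid p \<Longrightarrow> sorted_wrt (\<subseteq>) (dual p xs)"
proof (induction p xs rule: normal.induct)
  case (2 p G a xs)
  show ?case
  proof (cases "G = E")
    case False
    have "next_flat xs \<in> L \<and> G \<subset> next_flat xs" using 2 False normal_next[of "Some G" xs] by auto
    then show ?thesis using 2 False next_subset_dual[of "Some G" xs]
      by (auto simp: sorted_wrt_append sorted_replicate)
  qed (simp add: sorted_replicate)
qed (simp add: sorted_replicate)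

text \<open>A normal chain can be read off from its dual, because every proper flat of the chain occurs
  in the dual.\<close>

lemma dual_inj:
  "normal p xs \<Longrightarrow> normal p ys \<Longrightarrow> valid p \<Longrightarrow> dual p xs = dual p ys \<Longrightarrow> xs = ys"
proof (induction xs arbitrary: p ys)
  case Nil
  show ?case
  proof (cases ys)
    case (Cons y ys')
    then obtain G a where y: "y = (G, a)" by (cases y)
    have "deg ys = 0" using length_dual[OF Nil(1,3)] length_dual[OF Nil(2,3)]
      unfolding Nil(4)[symmetric] by simp
    then show ?thesis using Nil Cons y by auto
  qed simp
next
  case (Cons x xs)
  obtain G a where x: "x = (G, a)" by (cases x)
  have d: "deg ys = deg (x # xs)"
    using length_dual[OF Cons(2,4)] length_dual[OF Cons(3,4)] Cons(5) by (simp del: dual.simps)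
  then obtain H b ys' where ys: "ys = (H, b) # ys'"
    using Cons.prems x by (cases ys) (auto simp: deg_def)
  have *: "H \<noteq> E \<Longrightarrow> hd (dual p ((H, b) # zs)) = H \<and> dual p ((H, b) # zs) \<noteq> []"
    if "normal p ((H, b) # zs)" for H b zs
    using that by (cases "gap p H - b") auto
  have **: "K = E" if "K \<in> set (dual p ((E, b) # zs))" for b zs K using that by auto
  have GH: "G = H"
  proof (rule ccontr)
    assume "G \<noteq> H"
    moreover have "G = E \<or> H = E \<Longrightarrow> False"
      using *[of G a xs] *[of H b ys'] **[of _ a xs] **[of _ b ys'] Cons.prems x ys \<open>G \<noteq> H\<close>
      by (metis hd_in_set)
    ultimately show False
      using *[of G a xs] *[of H b ys'] Cons.prems x ys by metis
  qed
  show ?case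
  proof (cases "G = E")
    case True
    then have "xs = []" "ys' = []" using Cons.prems x ys GH normal_top by auto
    then show ?thesis using d x ys GH by auto
  next
    case False
    have len: "length (filter (\<lambda>B. B = G) (dual p ((G, c) # zs))) = gap p G - c"
      if "normal p ((G, c) # zs)" for c zs
    proof -
      have "next_flat zs \<in> L \<and> G \<subset> next_flat zs" using that False normal_next[of "Some G" zs] by auto
      then have "filter (\<lambda>B. B = G) (dual (Some G) zs) = []"
        using next_subset_dual[of "Some G" zs] that by (auto simp: filter_empty_conv)
      then show ?thesis using False by simp
    qed
    have "gap p G - a = gap p G - b" "a < gap p G" "b < gap p G"
      using len[of a xs] len[of b ys'] Cons.prems x ys GH by (auto simp del: dual.simps)
    then have ab: "a = b" by linarith
    have "dual (Some G) xs = dual (Some G) ys'" using Cons.prems x ys GH ab False by simp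
    then show ?thesis using Cons.IH[of "Some G" ys'] Cons.prems x ys GH ab by auto
  qed
qed

text \<open>The Hall--Rado condition for \<open>full p xs\<close>: a flat \<open>T\<close> contains at most as many entries as the
  jumps of rank below \<open>T\<close> allow.\<close>

lemma full_hall_rado:
  "normal p xs \<Longrightarrow> valid p \<Longrightarrow> p \<noteq> Some E \<Longrightarrow> T \<in> L \<Longrightarrow> (\<forall>F. p = Some F \<longrightarrow> F \<subseteq> T) \<Longrightarrow>
    length (filter (\<lambda>B. B \<subseteq> T) (full p xs)) \<le> gap p T - 1"
proof (induction p xs rule: normal.induct)
  case (1 p)
  then show ?case by (cases "T = E") (auto simp: top_subset_iff)
next
  case (2 p G a xs)
  have pg: "valid p" "G \<in> L" "above p G" using 2 by auto
  show ?case
  proof (cases "G = E")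
    case True
    then show ?thesis using 2 by (cases "T = E") (auto simp: top_subset_iff)
  next
    case False
    have n: "next_flat xs \<in> L" "G \<subset> next_flat xs" using 2 False normal_next[of "Some G" xs] by auto
    let ?c = "\<lambda>ms. length (filter (\<lambda>B. B \<subseteq> T) ms)"
    have none: "?c (full (Some G) xs) = 0" if "\<not> next_flat xs \<subseteq> T"
      using next_subset_full[of "Some G" xs] 2 that by (fastforce simp: filter_empty_conv)
    show ?thesis
    proof (cases "G \<subseteq> T")
      case True
      have t: "gap p T = gap p G + (rk T - rk G)" using gap_trans[OF pg 2(5) True] .
      have IH: "?c (full (Some G) xs) \<le> gap (Some G) T - 1" by (rule 2(1)) (use 2(2-) False True in auto)
      show ?thesis
      proof (cases "next_flat xs \<subseteq> T")
        case nx: True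
        then have "rk G < rk T" using n True 2 by (intro rk_strict) auto
        then show ?thesis using IH t False True nx gap_pos[OF pg] by simp
      next
        case nn: False
        then show ?thesis using none t False True by simp
      qed
    next
      case gt: False
      then have "\<not> next_flat xs \<subseteq> T" using n by auto
      then show ?thesis using none gt False by simp
    qed
  qed
qed

end

context chow_relations begin

lemma Sprod_replicate: "Sprod (replicate k G) = S G ^ k"
  by (simp add: prod_list_replicate)

lemma S_E: "S E = x E"
proof -
  have "{H \<in> L. E \<subseteq> H} = {E}" using E_in flat_subset by auto
  then show ?thesis by (simp add: S_def)
qed

text \<open>Modulo the relations, the product of \<open>x G\<close> with a product of \<open>S B\<close> of the top degree above
  \<open>G\<close> only depends on \<open>x G\<close> through \<open>S G - S H\<close>, where \<open>H\<close> is the smallest of the \<open>B\<close>.\<close>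

lemma x_as_S_difference:
  assumes "G \<in> L" "G \<subset> H" "set ks \<subseteq> L" "\<forall>B\<in>set ks. H \<subseteq> B" "length ks = r - rk G - 1" "H \<in> L"
  shows "x G * Sprod ks - (S G - S H) * Sprod ks \<in> I"
proof -
  let ?U = "{A \<in> L. G \<subseteq> A \<and> \<not> H \<subseteq> A}"
  have "S G - S H = (\<Sum>A\<in>?U. x A)" using S_diff[of G H] assms by auto
  also have "?U = insert G {A \<in> L. G \<subset> A \<and> \<not> H \<subseteq> A}" using assms by auto
  finally have *: "S G - S H = x G + (\<Sum>A\<in>{A \<in> L. G \<subset> A \<and> \<not> H \<subseteq> A}. x A)" by (simp add: finite_L)
  have "x A * Sprod ks \<in> I" if A: "A \<in> L" "G \<subset> A" "\<not> H \<subseteq> A" for A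
  proof -
    have "A \<noteq> E" using A flat_subset[OF assms(6)] by auto
    moreover have "rk G < rk A" using A assms by (intro rk_strict) auto
    moreover have "\<forall>B\<in>set ks. \<not> B \<subseteq> A" using A assms by blast
    ultimately show ?thesis
      using x_top_degree_mixed[of A "[]" ks] A(1) assms(3,5) by simp
  qed
  then have "- (\<Sum>A\<in>{A \<in> L. G \<subset> A \<and> \<not> H \<subseteq> A}. x A * Sprod ks) \<in> I"
    by (intro I_uminus I_sum) auto
  moreover have "x G * Sprod ks - (S G - S H) * Sprod ks = - (\<Sum>A\<in>{A \<in> L. G \<subset> A \<and> \<not> H \<subseteq> A}. x A * Sprod ks)"
    unfolding * by (simp add: algebra_simps sum_distrib_left)
  ultimately show ?thesis by (simp only:)
qed

text \<open>From the top of the chain downwards, \<open>x G\<close> becomes \<open>S G - S H\<close> with \<open>H\<close> the next flat. Together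
  with the power of \<open>S G\<close> already present, the summand \<open>S G\<close> reaches the jump of rank at \<open>G\<close> and
  vanishes; only \<open>- S H\<close> survives.\<close>

theorem nmon_dual:
  "normal p xs \<Longrightarrow> valid p \<Longrightarrow> p \<noteq> Some E \<Longrightarrow>
    \<exists>k. start p * nmon xs * Sprod (dual p xs) - (- 1) ^ k * (start p * Sprod (full p xs)) \<in> I"
proof (induction p xs rule: normal.induct)
  case (1 p)
  then show ?case by (intro exI[of _ 0]) (simp add: I_zero)
next
  case (2 p G a xs)
  have pg: "valid p" "G \<in> L" "above p G" "1 \<le> a" "a < gap p G" using 2 by auto
  show ?case
  proof (cases "G = E")
    case True
    then have xs: "xs = []" using 2 normal_top by auto
    have "x E * S E ^ (a - 1) * S E ^ (gap p E - 1 - a) = S E ^ (1 + (a - 1) + (gap p E - 1 - a))"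
      by (simp add: power_add S_E)
    moreover have "1 + (a - 1) + (gap p E - 1 - a) = gap p E - 1" using pg True by auto
    ultimately have "x E * S E ^ (a - 1) * S E ^ (gap p E - 1 - a) = S E ^ (gap p E - 1)" by metis
    then show ?thesis using True xs
      by (intro exI[of _ 0]) (simp add: Sprod_replicate I_zero mult.assoc)
  next
    case False
    define H where "H = next_flat xs"
    define K where "K = full (Some G) xs"
    have H: "H \<in> L" "G \<subset> H" using 2 False normal_next[of "Some G" xs] by (auto simp: H_def)
    obtain k where k: "x G * nmon xs * Sprod (dual (Some G) xs) - (- 1) ^ k * (x G * Sprod K) \<in> I"
      using 2 False by (auto simp: K_def)
    let ?c = "start p * S G ^ (gap p G - 1)"
    have e1: "start p * nmon ((G, a) # xs) * Sprod (dual p ((G, a) # xs))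
        = ?c * (x G * nmon xs * Sprod (dual (Some G) xs))"
    proof -
      have "gap p G - 1 = (a - 1) + (gap p G - a)" using pg by auto
      then show ?thesis using False by (simp add: Sprod_replicate power_add ac_simps)
    qed
    have e2: "start p * Sprod (full p ((G, a) # xs)) = ?c * (S H * Sprod K)"
      using False by (simp add: Sprod_replicate H_def K_def ac_simps)
    have K: "set K \<subseteq> L" "\<forall>B\<in>set K. H \<subseteq> B" "length K = r - rk G - 1"
      using next_subset_full[of "Some G" xs] length_full[of "Some G" xs] 2 by (auto simp: K_def H_def)
    have d: "x G * Sprod K - (S G - S H) * Sprod K \<in> I"
      using x_as_S_difference[OF pg(2) H(2) K H(1)] .
    have "start p * S G ^ Suc (gap p G - 1) \<in> I" by (rule start_S_power[OF pg(1-3)]) simp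
    then have z: "?c * S G \<in> I" by (simp only: power_Suc2 mult.assoc)
    have "start p * nmon ((G, a) # xs) * Sprod (dual p ((G, a) # xs))
        - (- 1) ^ Suc k * (start p * Sprod (full p ((G, a) # xs)))
      = ?c * (x G * nmon xs * Sprod (dual (Some G) xs) - (- 1) ^ k * (x G * Sprod K))
        + (- 1) ^ k * ?c * (x G * Sprod K - (S G - S H) * Sprod K)
        + (- 1) ^ k * Sprod K * (?c * S G)"
      unfolding e1 e2 by (simp add: algebra_simps)
    also have "\<dots> \<in> I" by (rule I_add[OF I_add[OF I_mult[OF k] I_mult[OF d]] I_mult[OF z]])
    finally show ?thesis by blast
  qed
qed

lemma nmon_mixed: "normal (Some G) xs \<Longrightarrow> G \<in> L \<Longrightarrow> \<exists>ms ks. nmon xs = xprod ms * Sprod ks \<and>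
    set ms \<subseteq> L \<and> set ks \<subseteq> L \<and> (\<forall>B\<in>set ms \<union> set ks. \<not> B \<subseteq> G) \<and> length ms + length ks = deg xs"
proof (induction xs arbitrary: G)
  case Nil
  show ?case by (intro exI[of _ "[]"]) auto
next
  case (Cons y xs)
  obtain H a where y: "y = (H, a)" by (cases y)
  obtain ms ks where m: "nmon xs = xprod ms * Sprod ks" "set ms \<subseteq> L" "set ks \<subseteq> L"
     "\<forall>B\<in>set ms \<union> set ks. \<not> B \<subseteq> H" "length ms + length ks = deg xs"
    using Cons.IH[of H] Cons.prems y by auto
  have nb: "\<forall>B\<in>set ms \<union> set ks \<union> {H}. \<not> B \<subseteq> G" using m(4) Cons.prems y by auto
  show ?case
    by (rule exI[of _ "H # ms"], rule exI[of _ "replicate (a - 1) H @ ks"])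
       (use m nb y Cons.prems in \<open>auto simp: Sprod_replicate ac_simps\<close>)
qed

text \<open>If the \<open>i\<close>-th entry of \<open>D\<close> is not contained in the \<open>i\<close>-th entry of the dual, then from this
  position on all factors lie outside the corresponding flat \<open>G\<close>, and there are enough of them for
  \<open>x_top_degree_mixed\<close>.\<close>

theorem nmon_triangular:
  "normal p xs \<Longrightarrow> valid p \<Longrightarrow> sorted_wrt (\<subseteq>) D \<Longrightarrow> set D \<subseteq> L \<Longrightarrow> length D = length (dual p xs) \<Longrightarrow>
    start p * nmon xs * Sprod D \<notin> I \<Longrightarrow> list_all2 (\<subseteq>) D (dual p xs)"
proof (induction p xs arbitrary: D rule: normal.induct)
  case (1 p)
  then show ?case using list_all2_replicate_top[of D] by simp
next
  case (2 p G a xs)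
  have pg: "valid p" "G \<in> L" "above p G" "1 \<le> a" "a < gap p G" using 2 by auto
  show ?case
  proof (cases "G = E")
    case True
    then show ?thesis using 2 list_all2_replicate_top[of D] by simp
  next
    case False
    define b where "b = gap p G - a"
    have lenD: "length D = b + length (dual (Some G) xs)" using 2 False by (simp add: b_def)
    obtain ms ks where m: "nmon xs = xprod ms * Sprod ks" "set ms \<subseteq> L" "set ks \<subseteq> L"
       "\<forall>B\<in>set ms \<union> set ks. \<not> B \<subseteq> G" "length ms + length ks = deg xs"
      using nmon_mixed[of G xs] 2 by auto
    have "B \<subseteq> G" if "B \<in> set (take b D)" for B
    proof (rule ccontr)
      assume nB: "\<not> B \<subseteq> G"
      have "\<exists>i<b. i < length D \<and> D ! i = B"
        using that by (auto simp: in_set_conv_nth)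
      then obtain i where i: "i < b" "i < length D" "D ! i = B" by blast
      have up: "\<not> C \<subseteq> G" if "C \<in> set (drop i D)" for C
      proof -
        obtain j where "j < length (drop i D)" "drop i D ! j = C"
          using \<open>C \<in> set (drop i D)\<close> by (metis in_set_conv_nth)
        then have j: "i + j < length D" "C = D ! (i + j)" by auto
        have "B \<subseteq> C" using sorted_wrt_nth_less[OF 2(4), of i "i + j"] i j by (cases j) auto
        then show ?thesis using nB by auto
      qed
      have "length (dual (Some G) xs) + deg xs = r - rk G - 1" using length_dual[of "Some G" xs] 2 by auto
      then have "r - rk G \<le> length ms + length (ks @ drop i D)" using i lenD m by auto
      then have "x G * xprod ms * Sprod (ks @ drop i D) \<in> I"
        using m(2,3,4) up False pg(2) set_drop_subset[of i D] 2(5)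
        by (intro x_top_degree_mixed) auto
      then have "start p * S G ^ (a - 1) * Sprod (take i D) * (x G * xprod ms * Sprod (ks @ drop i D)) \<in> I"
        by (rule I_mult)
      moreover have "Sprod D = Sprod (take i D) * Sprod (drop i D)"
        by (subst append_take_drop_id[of i D, symmetric], subst map_append) simp
      ultimately have "start p * nmon ((G, a) # xs) * Sprod D \<in> I"
        by (simp add: m ac_simps)
      then show False using 2 by simp
    qed
    then have t: "list_all2 (\<subseteq>) (take b D) (replicate b G)"
      using lenD list_all2_replicate[of "take b D" G] by simp
    have "list_all2 (\<subseteq>) (drop b D) (dual (Some G) xs)"
    proof (rule 2(1))
      show "start (Some G) * nmon xs * Sprod (drop b D) \<notin> I"
      proof
        assume "start (Some G) * nmon xs * Sprod (drop b D) \<in> I"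
        then have "start p * S G ^ (a - 1) * Sprod (take b D) * (start (Some G) * nmon xs * Sprod (drop b D)) \<in> I"
          by (rule I_mult)
        moreover have "Sprod D = Sprod (take b D) * Sprod (drop b D)"
          by (subst append_take_drop_id[of b D, symmetric], subst map_append) simp
        ultimately show False using 2 by (simp add: ac_simps)
      qed
    qed (use 2(2-5) lenD set_drop_subset[of b D] in \<open>auto intro: sorted_wrt_drop\<close>)
    then have "list_all2 (\<subseteq>) (take b D @ drop b D) (replicate b G @ dual (Some G) xs)"
      using t by (intro list_all2_appendI)
    then show ?thesis using False by (simp add: b_def)
  qed
qed

end

section \<open>Evaluation of polynomials\<close>

lemma sum_singles: "p = (\<Sum>m\<in>Poly_Mapping.keys p. Poly_Mapping.single m (Poly_Mapping.lookup p m))"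
  by (rule poly_mapping_eqI) (simp add: lookup_sum lookup_single when_def in_keys_iff)

definition eval_monom :: "('v \<Rightarrow> 'r::comm_monoid_mult) \<Rightarrow> ('v \<Rightarrow>\<^sub>0 nat) \<Rightarrow> 'r" where
  "eval_monom \<phi> m = (\<Prod>v\<in>Poly_Mapping.keys m. \<phi> v ^ Poly_Mapping.lookup m v)"

lemma eval_monom_superset:
  "finite A \<Longrightarrow> Poly_Mapping.keys m \<subseteq> A \<Longrightarrow> eval_monom \<phi> m = (\<Prod>v\<in>A. \<phi> v ^ Poly_Mapping.lookup m v)"
  unfolding eval_monom_def by (rule prod.mono_neutral_left) (auto simp: in_keys_iff)

lemma eval_monom_add: "eval_monom \<phi> (m + k) = eval_monom \<phi> m * eval_monom \<phi> k"
proof -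
  let ?A = "Poly_Mapping.keys m \<union> Poly_Mapping.keys k"
  have "eval_monom \<phi> l = (\<Prod>v\<in>?A. \<phi> v ^ Poly_Mapping.lookup l v)" if "l \<in> {m, k, m + k}" for l
    using that Poly_Mapping.keys_add[of m k] by (intro eval_monom_superset) auto
  then show ?thesis by (simp add: lookup_add power_add prod.distrib)
qed

lemma eval_monom_zero [simp]: "eval_monom \<phi> 0 = 1"
  by (simp add: eval_monom_def)

lemma eval_monom_single [simp]: "eval_monom \<phi> (Poly_Mapping.single v k) = \<phi> v ^ k"
  by (simp add: eval_monom_superset[of "{v}"])

text \<open>The linear extension of a map on monomials.\<close>

definition extend_linear :: "(rat \<Rightarrow> 'r::ring_1) \<Rightarrow> ('m \<Rightarrow> 'r) \<Rightarrow> ('m \<Rightarrow>\<^sub>0 rat) \<Rightarrow> 'r" where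
  "extend_linear \<iota> f p = (\<Sum>m\<in>Poly_Mapping.keys p. \<iota> (Poly_Mapping.lookup p m) * f m)"

locale scalar_embedding =
  fixes \<iota> :: "rat \<Rightarrow> 'r::comm_ring_1"
  assumes \<iota>_add: "\<iota> (a + b) = \<iota> a + \<iota> b" and \<iota>_mult: "\<iota> (a * b) = \<iota> a * \<iota> b" and \<iota>_one: "\<iota> 1 = 1"
begin

lemma \<iota>_zero: "\<iota> 0 = 0" using \<iota>_add[of 0 0] by simp

abbreviation ext where "ext \<equiv> extend_linear \<iota>"

lemma ext_superset:
  "finite A \<Longrightarrow> Poly_Mapping.keys p \<subseteq> A \<Longrightarrow> ext f p = (\<Sum>m\<in>A. \<iota> (Poly_Mapping.lookup p m) * f m)"
  unfolding extend_linear_def by (rule sum.mono_neutral_left) (auto simp: in_keys_iff \<iota>_zero)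

lemma ext_add: "ext f (p + r) = ext f p + ext f r"
proof -
  let ?A = "Poly_Mapping.keys p \<union> Poly_Mapping.keys r"
  have "ext f l = (\<Sum>m\<in>?A. \<iota> (Poly_Mapping.lookup l m) * f m)" if "l \<in> {p, r, p + r}" for l
    using that Poly_Mapping.keys_add[of p r] by (intro ext_superset) auto
  then show ?thesis by (simp add: lookup_add \<iota>_add distrib_right sum.distrib)
qed

lemma ext_zero [simp]: "ext f 0 = 0" by (simp add: extend_linear_def)

lemma ext_sum: "ext f (\<Sum>i\<in>A. p i) = (\<Sum>i\<in>A. ext f (p i))"
  by (induction A rule: infinite_finite_induct) (auto simp: ext_add)

lemma ext_uminus: "ext f (- p) = - ext f p"
  using ext_add[of f p "- p"] by (simp add: add_eq_0_iff)

lemma ext_diff: "ext f (p - r) = ext f p - ext f r"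
  using ext_add[of f p "- r"] by (simp add: ext_uminus)

lemma ext_single [simp]: "ext f (Poly_Mapping.single m c) = \<iota> c * f m"
  by (simp add: ext_superset[of "{m}"])

lemma ext_mult:
  assumes "\<And>m k. f (m + k) = f m * f k"
  shows "ext f (p * r) = ext f p * ext f r"
proof -
  have "ext f (p * r) = ext f ((\<Sum>m\<in>Poly_Mapping.keys p. Poly_Mapping.single m (Poly_Mapping.lookup p m))
     * (\<Sum>k\<in>Poly_Mapping.keys r. Poly_Mapping.single k (Poly_Mapping.lookup r k)))"
    using sum_singles[of p] sum_singles[of r] by simp
  also have "\<dots> = ext f p * ext f r"
    unfolding sum_product ext_sum mult_single ext_single
    by (simp add: extend_linear_def assms \<iota>_mult sum_product ac_simps)
  finally show ?thesis .
qed

end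

lemma mconst_simps: "mconst (a + b) = mconst a + mconst b" "mconst (a * b) = mconst a * mconst b"
  "mconst 1 = 1" "mconst 0 = 0"
  by (simp_all add: mconst_def single_add mult_single)

interpretation scalars: scalar_embedding "mconst :: rat \<Rightarrow> 'w mpolynomial"
  by unfold_locales (simp_all add: mconst_simps)

interpretation rat_scalars: scalar_embedding "\<lambda>c::rat. c"
  by unfold_locales simp_all

definition eval_poly :: "('v \<Rightarrow> 'w mpolynomial) \<Rightarrow> 'v mpolynomial \<Rightarrow> 'w mpolynomial" where
  "eval_poly \<phi> = extend_linear mconst (eval_monom \<phi>)"

lemma eval_poly_add: "eval_poly \<phi> (p + r) = eval_poly \<phi> p + eval_poly \<phi> r"
  and eval_poly_diff: "eval_poly \<phi> (p - r) = eval_poly \<phi> p - eval_poly \<phi> r"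
  and eval_poly_sum: "eval_poly \<phi> (sum f A) = (\<Sum>i\<in>A. eval_poly \<phi> (f i))"
  and eval_poly_zero: "eval_poly \<phi> 0 = 0"
  and eval_poly_mult: "eval_poly \<phi> (p * r) = eval_poly \<phi> p * eval_poly \<phi> r"
  by (simp_all add: eval_poly_def scalars.ext_add scalars.ext_diff scalars.ext_sum scalars.ext_mult
      eval_monom_add)

lemma eval_poly_mvar: "eval_poly \<phi> (mvar v) = \<phi> v"
  by (simp add: eval_poly_def mvar_def mconst_simps)

lemma eval_poly_mconst: "eval_poly \<phi> (mconst c) = mconst c"
  by (subst (1) mconst_def) (simp add: eval_poly_def)

lemma eval_poly_one: "eval_poly \<phi> 1 = 1"
  using eval_poly_mconst[of \<phi> 1] by (simp add: mconst_simps)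

section \<open>The Hall--Rado functional\<close>

lemma moebius_inversion:
  fixes z :: "'a set \<Rightarrow> 'r::ab_group_add"
  assumes "finite L"
  shows "\<exists>x. \<forall>F\<in>L. (\<Sum>H\<in>{H \<in> L. F \<subseteq> H}. x H) = z F"
  using assms
proof (induction "card L" arbitrary: L)
  case (Suc k)
  then have "L \<noteq> {}" by auto
  then obtain M where M: "M \<in> L" "\<And>F. F \<in> L \<Longrightarrow> F \<subseteq> M \<Longrightarrow> F = M"
    using finite_has_minimal[OF Suc.prems] by metis
  have "k = card (L - {M})" "finite (L - {M})" using Suc M by auto
  then obtain x where x: "\<And>F. F \<in> L - {M} \<Longrightarrow> (\<Sum>H\<in>{H \<in> L - {M}. F \<subseteq> H}. x H) = z F"
    using Suc.hyps(1) by metis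
  let ?x = "x(M := z M - (\<Sum>H\<in>{H \<in> L - {M}. M \<subseteq> H}. x H))"
  have "(\<Sum>H\<in>{H \<in> L. F \<subseteq> H}. ?x H) = z F" if F: "F \<in> L" for F
  proof (cases "F = M")
    case True
    have "{H \<in> L. M \<subseteq> H} = insert M {H \<in> L - {M}. M \<subseteq> H}" using M by auto
    moreover have "(\<Sum>H\<in>{H \<in> L - {M}. M \<subseteq> H}. ?x H) = (\<Sum>H\<in>{H \<in> L - {M}. M \<subseteq> H}. x H)"
      by (rule sum.cong) auto
    ultimately show ?thesis using True Suc.prems by (simp del: fun_upd_apply) simp
  next
    case False
    then have "{H \<in> L. F \<subseteq> H} = {H \<in> L - {M}. F \<subseteq> H}" using M F by auto
    moreover have "(\<Sum>H\<in>{H \<in> L - {M}. F \<subseteq> H}. ?x H) = (\<Sum>H\<in>{H \<in> L - {M}. F \<subseteq> H}. x H)"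
      by (rule sum.cong) auto
    ultimately show ?thesis using x False F by simp
  qed
  then show ?case by blast
qed auto

context ranked_flats begin

definition count_below :: "('a set \<Rightarrow>\<^sub>0 nat) \<Rightarrow> 'a set \<Rightarrow> nat" where
  "count_below m T = (\<Sum>B\<in>{B \<in> Poly_Mapping.keys m. B \<subseteq> T}. Poly_Mapping.lookup m B)"

definition hall_rado :: "('a set \<Rightarrow>\<^sub>0 nat) \<Rightarrow> bool" where
  "hall_rado m \<longleftrightarrow> (\<forall>T\<in>L. count_below m T \<le> rk T)"

text \<open>The variable indexed by \<open>B\<close> plays the role of \<open>S B\<close>. On products of top degree this is the volume
  polynomial of the matroid in these variables: up to sign, such a product has degree \<open>1\<close> or \<open>0\<close>
  according to the Hall--Rado condition.\<close>

definition deg_map :: "'a set mpolynomial \<Rightarrow> rat" where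
  "deg_map = extend_linear (\<lambda>c. c) (\<lambda>m. of_bool (hall_rado m))"

text \<open>The largest ideal on which the functional vanishes; the quotient by it is the ring in which
  independence is tested.\<close>

definition deg_kernel :: "'a set mpolynomial set" where
  "deg_kernel = {p. \<forall>g. deg_map (p * g) = 0}"

lemma deg_map_add: "deg_map (p + s) = deg_map p + deg_map s"
  and deg_map_diff: "deg_map (p - s) = deg_map p - deg_map s"
  and deg_map_zero: "deg_map 0 = 0"
  and deg_map_sum: "deg_map (sum f A) = (\<Sum>i\<in>A. deg_map (f i))"
  and deg_map_single: "deg_map (Poly_Mapping.single m c) = c * of_bool (hall_rado m)"
  by (simp_all add: deg_map_def rat_scalars.ext_add rat_scalars.ext_diff rat_scalars.ext_sum)

lemma deg_map_mconst: "deg_map (mconst c * p) = c * deg_map p"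
proof -
  have "deg_map (mconst c * (\<Sum>m\<in>Poly_Mapping.keys p. Poly_Mapping.single m (Poly_Mapping.lookup p m)))
      = c * deg_map (\<Sum>m\<in>Poly_Mapping.keys p. Poly_Mapping.single m (Poly_Mapping.lookup p m))"
    unfolding sum_distrib_left deg_map_sum mconst_def mult_single deg_map_single
    by (simp only: add_0 mult.assoc)
  then show ?thesis using sum_singles[of p] by simp
qed

lemma deg_kernelI: "(\<And>m. deg_map (p * Poly_Mapping.single m 1) = 0) \<Longrightarrow> p \<in> deg_kernel"
proof -
  assume *: "\<And>m. deg_map (p * Poly_Mapping.single m 1) = 0"
  have "deg_map (p * g) = 0" for g
  proof -
    have "deg_map (p * (\<Sum>m\<in>Poly_Mapping.keys g. Poly_Mapping.single m (Poly_Mapping.lookup g m)))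
      = (\<Sum>m\<in>Poly_Mapping.keys g. deg_map (mconst (Poly_Mapping.lookup g m) * (p * Poly_Mapping.single m 1)))"
      unfolding sum_distrib_left deg_map_sum
      by (rule sum.cong) (auto simp: mconst_def mult_single mult.left_commute)
    then show ?thesis using sum_singles[of g] by (simp add: deg_map_mconst *)
  qed
  then show ?thesis by (simp add: deg_kernel_def)
qed

lemma deg_map_kernel: "p \<in> deg_kernel \<Longrightarrow> deg_map p = 0"
  unfolding deg_kernel_def by (metis (mono_tags) mem_Collect_eq mult.right_neutral)

sublocale kernel: ring_ideal deg_kernel
proof
  show "c * a \<in> deg_kernel" if "a \<in> deg_kernel" for a c
    unfolding deg_kernel_def
  proof (intro CollectI allI)
    fix g
    have "deg_map (a * (c * g)) = 0" using that by (simp only: deg_kernel_def mem_Collect_eq)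
    then show "deg_map (c * a * g) = 0" by (simp only: ac_simps)
  qed
qed (auto simp: deg_kernel_def deg_map_zero distrib_right deg_map_add)

lemma count_below_superset:
  "finite A \<Longrightarrow> Poly_Mapping.keys m \<subseteq> A \<Longrightarrow> count_below m T = (\<Sum>B\<in>{B \<in> A. B \<subseteq> T}. Poly_Mapping.lookup m B)"
  unfolding count_below_def by (rule sum.mono_neutral_left) (auto simp: in_keys_iff)

lemma count_below_add: "count_below (m + k) T = count_below m T + count_below k T"
proof -
  let ?A = "Poly_Mapping.keys m \<union> Poly_Mapping.keys k"
  have "count_below l T = (\<Sum>B\<in>{B \<in> ?A. B \<subseteq> T}. Poly_Mapping.lookup l B)" if "l \<in> {m, k, m + k}" for l
    using that Poly_Mapping.keys_add[of m k] by (intro count_below_superset) auto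
  then show ?thesis by (simp add: lookup_add sum.distrib)
qed

lemma count_below_single: "count_below (Poly_Mapping.single B 1) T = of_bool (B \<subseteq> T)"
proof -
  have "{C \<in> {B}. C \<subseteq> T} = (if B \<subseteq> T then {B} else {})" by auto
  then show ?thesis by (subst count_below_superset[of "{B}"]) auto
qed

lemma count_below_mono: "S \<subseteq> T \<Longrightarrow> count_below m S \<le> count_below m T"
  unfolding count_below_def by (rule sum_mono2) auto

lemma count_below_supermodular:
  "count_below m S + count_below m T \<le> count_below m (cl (S \<union> T)) + count_below m (S \<inter> T)"
proof -
  let ?K = "Poly_Mapping.keys m" and ?l = "Poly_Mapping.lookup m"
  have "count_below m S + count_below m T
     = sum ?l ({B \<in> ?K. B \<subseteq> S} \<union> {B \<in> ?K. B \<subseteq> T}) + sum ?l ({B \<in> ?K. B \<subseteq> S} \<inter> {B \<in> ?K. B \<subseteq> T})"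
    unfolding count_below_def by (rule sum.union_inter[symmetric]) auto
  also have "sum ?l ({B \<in> ?K. B \<subseteq> S} \<union> {B \<in> ?K. B \<subseteq> T}) \<le> count_below m (cl (S \<union> T))"
    unfolding count_below_def using subset_cl[of "S \<union> T"] by (intro sum_mono2) auto
  also have "{B \<in> ?K. B \<subseteq> S} \<inter> {B \<in> ?K. B \<subseteq> T} = {B \<in> ?K. B \<subseteq> S \<inter> T}" by auto
  finally show ?thesis by (simp add: count_below_def)
qed

lemma rk_submodular: "S \<in> L \<Longrightarrow> T \<in> L \<Longrightarrow> rk (cl (S \<union> T)) + rk (S \<inter> T) \<le> rk S + rk T"
proof -
  assume ST: "S \<in> L" "T \<in> L"
  have "(S \<inter> T) \<union> T = T" by auto
  then show ?thesis using semimodular[of "S \<inter> T" S T] ST inter_in flat_subset by (simp add: cl_flat)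
qed

text \<open>Enough room for one, respectively two, further factors at \<open>A\<close>.\<close>

definition free :: "('a set \<Rightarrow>\<^sub>0 nat) \<Rightarrow> 'a set \<Rightarrow> bool" where
  "free m A \<longleftrightarrow> (\<forall>T\<in>L. A \<subseteq> T \<longrightarrow> count_below m T < rk T)"

definition free2 :: "('a set \<Rightarrow>\<^sub>0 nat) \<Rightarrow> 'a set \<Rightarrow> bool" where
  "free2 m A \<longleftrightarrow> (\<forall>T\<in>L. A \<subseteq> T \<longrightarrow> count_below m T + 2 \<le> rk T)"

lemma hall_rado_add2:
  "hall_rado (Poly_Mapping.single A 1 + Poly_Mapping.single B 1 + m)
     \<longleftrightarrow> hall_rado m \<and> free m A \<and> free m B \<and> free2 m (cl (A \<union> B))"
proof -
  have "hall_rado (Poly_Mapping.single A 1 + Poly_Mapping.single B 1 + m)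
    \<longleftrightarrow> (\<forall>T\<in>L. of_bool (A \<subseteq> T) + of_bool (B \<subseteq> T) + count_below m T \<le> rk T)"
    by (simp add: hall_rado_def count_below_add count_below_single del: One_nat_def)
  also have "\<dots> \<longleftrightarrow> hall_rado m \<and> free m A \<and> free m B \<and> free2 m (cl (A \<union> B))"
  proof -
    have "of_bool (A \<subseteq> T) + of_bool (B \<subseteq> T) + count_below m T \<le> rk T \<longleftrightarrow>
        count_below m T \<le> rk T \<and> (A \<subseteq> T \<longrightarrow> count_below m T < rk T) \<and>
        (B \<subseteq> T \<longrightarrow> count_below m T < rk T) \<and> (cl (A \<union> B) \<subseteq> T \<longrightarrow> count_below m T + 2 \<le> rk T)"
      if "T \<in> L" for T
      using that by (cases "A \<subseteq> T"; cases "B \<subseteq> T") (auto simp: cl_subset_iff)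
    then show ?thesis
      by (simp only: hall_rado_def free_def free2_def ball_conj_distrib cong: ball_cong)
  qed
  finally show ?thesis .
qed

lemma free_mono: "free m A \<Longrightarrow> A \<subseteq> B \<Longrightarrow> free m B"
  by (auto simp: free_def)

text \<open>Flats with no room left are closed under join, by submodularity of the rank.\<close>

lemma free_join:
  assumes "hall_rado m" "free m (cl (A \<union> B))"
  shows "free m A \<or> free m B"
proof (rule ccontr)
  assume "\<not> (free m A \<or> free m B)"
  then obtain S T where ST: "S \<in> L" "A \<subseteq> S" "count_below m S = rk S" "T \<in> L" "B \<subseteq> T" "count_below m T = rk T"
    using assms unfolding free_def hall_rado_def by (metis linorder_not_less order_antisym)
  let ?J = "cl (S \<union> T)"
  have J: "?J \<in> L" using ST flat_subset by (intro cl_in) auto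
  have "count_below m (S \<inter> T) \<le> rk (S \<inter> T)" using assms ST inter_in by (auto simp: hall_rado_def)
  then have "rk ?J \<le> count_below m ?J"
    using rk_submodular[of S T] count_below_supermodular[of m S T] ST by linarith
  moreover have "cl (A \<union> B) \<subseteq> ?J" using J ST subset_cl[of "S \<union> T"] by (intro cl_least) auto
  ultimately show False using assms(2) J by (auto simp: free_def)
qed

lemma mvar_mult_single:
  "mvar A * mvar B * Poly_Mapping.single m 1 = Poly_Mapping.single (Poly_Mapping.single A 1 + Poly_Mapping.single B 1 + m) 1"
  by (simp add: mvar_def mult_single)

lemma deg_map_pair:
  "deg_map (mvar A * mvar B * Poly_Mapping.single m 1)
    = of_bool (hall_rado m \<and> free2 m (cl (A \<union> B))) * of_bool (free m A) * of_bool (free m B)"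
  unfolding mvar_mult_single deg_map_single hall_rado_add2 by auto

text \<open>If there is room for two factors at the join \<open>H\<close>, then there is room for one at \<open>H\<close>, hence by
  \<open>free_join\<close> at \<open>F\<close> or at \<open>G\<close>. Expanding the product, the contribution of every monomial becomes a
  multiple of \<open>(1 - f) (1 - g)\<close>, with \<open>f\<close> and \<open>g\<close> the indicators of room at \<open>F\<close> and at \<open>G\<close>, and one of these
  two is \<open>1\<close>.\<close>

lemma join_relation:
  assumes "F \<in> L" "G \<in> L" and H: "H = cl (F \<union> G)"
  shows "(mvar F - mvar H) * (mvar G - mvar H) \<in> deg_kernel"
proof (rule deg_kernelI)
  fix m
  have FGE: "F \<union> G \<subseteq> E" using assms flat_subset by auto
  have HL: "H \<in> L" "F \<subseteq> H" "G \<subseteq> H" using FGE subset_cl[of "F \<union> G"] by (auto simp: H cl_in)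
  have u: "F \<union> H = H" "G \<union> H = H" "H \<union> G = H" "H \<union> H = H" using HL by auto
  have c: "cl (F \<union> H) = H" "cl (H \<union> G) = H" "cl (H \<union> H) = H" "cl (F \<union> G) = H"
    by (simp_all only: u cl_flat[OF HL(1)] H[symmetric])
  have e: "(mvar F - mvar H) * (mvar G - mvar H) * Poly_Mapping.single m 1
    = mvar F * mvar G * Poly_Mapping.single m 1 - mvar F * mvar H * Poly_Mapping.single m 1
      - (mvar H * mvar G * Poly_Mapping.single m 1 - mvar H * mvar H * Poly_Mapping.single m 1)"
    by (simp add: left_diff_distrib right_diff_distrib)
  have e': "deg_map ((mvar F - mvar H) * (mvar G - mvar H) * Poly_Mapping.single m 1)
    = of_bool (hall_rado m \<and> free2 m H) * of_bool (free m F) * of_bool (free m G)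
      - of_bool (hall_rado m \<and> free2 m H) * of_bool (free m F) * of_bool (free m H)
      - (of_bool (hall_rado m \<and> free2 m H) * of_bool (free m H) * of_bool (free m G)
        - of_bool (hall_rado m \<and> free2 m H) * of_bool (free m H) * of_bool (free m H))"
    by (simp only: e deg_map_diff deg_map_pair c)
  show "deg_map ((mvar F - mvar H) * (mvar G - mvar H) * Poly_Mapping.single m 1) = 0"
    unfolding e'
    using free_join[of m F G, folded H] free_mono[OF _ HL(2), of m] free_mono[OF _ HL(3), of m]
    by (cases "hall_rado m"; cases "free m F"; cases "free m G"; cases "free m H") simp_all
qed

text \<open>The two monomials differ only in the requirement of room at \<open>F\<close>. A flat \<open>T\<close> that contains \<open>F\<close> but
  not \<open>i\<close> has rank one less than its join with \<open>i\<close>; room for two factors at that join leaves room for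
  one at \<open>T\<close>.\<close>

lemma atom_relation:
  assumes "F \<in> L" "i \<in> E - F" and H: "H = cl (insert i F)"
  shows "mvar (cl {i}) * (mvar F - mvar H) \<in> deg_kernel"
proof (rule deg_kernelI)
  fix m
  have FE: "insert i F \<subseteq> E" using assms flat_subset by auto
  have HL: "H \<in> L" "F \<subseteq> H" "i \<in> H" using FE subset_cl[of "insert i F"] by (auto simp: H cl_in)
  have ci: "cl {i} \<in> L" "i \<in> cl {i}" using FE subset_cl[of "{i}"] by (auto intro: cl_in)
  have cH: "cl {i} \<subseteq> H" using HL by (intro cl_least) auto
  then have "cl {i} \<union> H = H" by auto
  then have c2: "cl (cl {i} \<union> H) = H" using HL by (simp add: cl_flat)
  have c1: "cl (cl {i} \<union> F) = H"
  proof
    show "cl (cl {i} \<union> F) \<subseteq> H" using HL cH by (intro cl_least) auto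
    have "cl {i} \<union> F \<subseteq> E" using ci flat_subset assms by auto
    then show "H \<subseteq> cl (cl {i} \<union> F)" unfolding H
      using cl_in ci subset_cl[of "cl {i} \<union> F"] by (intro cl_least) auto
  qed
  have e: "mvar (cl {i}) * (mvar F - mvar H) * Poly_Mapping.single m 1
    = mvar (cl {i}) * mvar F * Poly_Mapping.single m 1 - mvar (cl {i}) * mvar H * Poly_Mapping.single m 1"
    by (simp only: left_diff_distrib right_diff_distrib)
  have key: "free m F" if hr: "hall_rado m" and f2: "free2 m H" and fi: "free m (cl {i})"
  proof (rule ccontr)
    assume "\<not> free m F"
    then obtain T where T: "T \<in> L" "F \<subseteq> T" "count_below m T = rk T"
      using hr unfolding free_def hall_rado_def by (metis linorder_not_less order_antisym)
    have iT: "i \<notin> T" using T fi by (auto simp: free_def cl_subset_iff)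
    let ?T = "cl (insert i T)"
    have TE: "insert i T \<subseteq> E" using T assms flat_subset by auto
    have "rk ?T = Suc (rk T)" using T iT assms by (intro rk_cl_insert) auto
    moreover have T': "?T \<in> L" "T \<subseteq> ?T" "i \<in> ?T" using cl_in[OF TE] subset_cl[of "insert i T"] by auto
    moreover have "H \<subseteq> ?T" unfolding H using T T' by (intro cl_least) auto
    ultimately show False using f2 T count_below_mono[of T ?T m] by (fastforce simp: free2_def)
  qed
  show "deg_map (mvar (cl {i}) * (mvar F - mvar H) * Poly_Mapping.single m 1) = 0"
    unfolding e deg_map_diff deg_map_pair c1 c2
    using key free_mono[OF _ HL(2), of m]
    by (cases "hall_rado m"; cases "free m F"; cases "free m H"; cases "free m (cl {i})") auto
qed

lemma empty_relation: "mvar {} \<in> deg_kernel"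
proof (rule deg_kernelI)
  fix m
  have "\<not> hall_rado (Poly_Mapping.single {} 1 + m)"
    unfolding hall_rado_def using empty_in rk_empty
    by (auto simp: count_below_add count_below_single simp del: One_nat_def intro!: bexI[of _ "{}"])
  then show "deg_map (mvar {} * Poly_Mapping.single m 1) = 0"
    by (simp add: mvar_def mult_single deg_map_single)
qed

text \<open>No monomial with a factor at the empty flat satisfies the Hall--Rado condition, so this variable is
  set to zero. The elements \<open>xhat\<close> are then chosen so that their upper sums are the variables.\<close>

definition zvar :: "'a set \<Rightarrow> 'a set mpolynomial" where
  "zvar F = (if F = {} then 0 else mvar F)"

definition xhat :: "'a set \<Rightarrow> 'a set mpolynomial" where
  "xhat = (SOME x. \<forall>F\<in>L. (\<Sum>H\<in>{H \<in> L. F \<subseteq> H}. x H) = zvar F)"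

lemma xhat: "F \<in> L \<Longrightarrow> (\<Sum>H\<in>{H \<in> L. F \<subseteq> H}. xhat H) = zvar F"
  using someI_ex[OF moebius_inversion[OF finite_L, of zvar]] unfolding xhat_def by blast

lemma zvar_atom_relation:
  assumes "F \<in> L" "i \<in> E - F"
  shows "zvar (cl {i}) * (zvar F - zvar (cl (insert i F))) \<in> deg_kernel"
proof -
  let ?H = "cl (insert i F)"
  have n: "zvar ?H = mvar ?H" "zvar (cl {i}) = mvar (cl {i})"
    using subset_cl[of "insert i F"] subset_cl[of "{i}"] by (auto simp: zvar_def)
  show ?thesis
  proof (cases "F = {}")
    case True
    then have "zvar (cl {i}) * (zvar F - zvar ?H) = mvar (cl {i}) * (mvar F - mvar ?H) - mvar (cl {i}) * mvar {}"
      unfolding n by (simp add: zvar_def algebra_simps)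
    then show ?thesis
      using atom_relation[OF assms refl] empty_relation kernel.I_diff kernel.I_mult by metis
  next
    case False
    then show ?thesis using atom_relation[OF assms refl] n by (simp add: zvar_def)
  qed
qed

lemma xhat_diff:
  assumes "F \<in> L" "H \<in> L" "F \<subseteq> H"
  shows "zvar F - zvar H = (\<Sum>A\<in>{A \<in> L. F \<subseteq> A \<and> \<not> H \<subseteq> A}. xhat A)"
proof -
  have "{A \<in> L. F \<subseteq> A} = {A \<in> L. H \<subseteq> A} \<union> {A \<in> L. F \<subseteq> A \<and> \<not> H \<subseteq> A}" using assms by auto
  then have "zvar F = zvar H + (\<Sum>A\<in>{A \<in> L. F \<subseteq> A \<and> \<not> H \<subseteq> A}. xhat A)"
    using assms by (simp add: xhat[symmetric] sum.union_disjoint[symmetric] finite_L disjoint_iff)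
  then show ?thesis by simp
qed

lemma card_Diff_less: "F \<in> L \<Longrightarrow> A \<in> L \<Longrightarrow> F \<subset> A \<Longrightarrow> card (E - A) < card (E - F)"
  using flat_subset finite_E by (intro psubset_card_mono) auto

text \<open>With \<open>H\<close> the join of \<open>F\<close> and \<open>G\<close>, the product \<open>(zvar F - zvar H) * (zvar G - zvar H)\<close> expands into
  products \<open>xhat A * xhat B\<close> with \<open>A\<close> above \<open>F\<close>, \<open>B\<close> above \<open>G\<close> and neither above \<open>H\<close>. All these pairs are
  incomparable, so induction from the top leaves only \<open>xhat F * xhat G\<close>.\<close>

lemma xhat_incomparable:
  "F \<in> L \<Longrightarrow> G \<in> L \<Longrightarrow> \<not> F \<subseteq> G \<Longrightarrow> \<not> G \<subseteq> F \<Longrightarrow> xhat F * xhat G \<in> deg_kernel"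
proof (induction "card (E - F) + card (E - G)" arbitrary: F G rule: less_induct)
  case less
  let ?H = "cl (F \<union> G)"
  have FGE: "F \<union> G \<subseteq> E" using less.prems flat_subset by auto
  have H: "?H \<in> L" "F \<subseteq> ?H" "G \<subseteq> ?H" using FGE subset_cl[of "F \<union> G"] by (auto simp: cl_in)
  let ?U = "{A \<in> L. F \<subseteq> A \<and> \<not> ?H \<subseteq> A} \<times> {A \<in> L. G \<subseteq> A \<and> \<not> ?H \<subseteq> A}"
  let ?f = "\<lambda>(A, B). xhat A * xhat B"
  have "sum ?f ?U = (zvar F - zvar ?H) * (zvar G - zvar ?H)"
    using H less.prems by (simp add: xhat_diff sum_product sum.cartesian_product)
  also have "\<dots> = (mvar F - mvar ?H) * (mvar G - mvar ?H)"
    using less.prems H by (auto simp: zvar_def)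
  also have "\<dots> \<in> deg_kernel" using less.prems by (intro join_relation) auto
  finally have tot: "sum ?f ?U \<in> deg_kernel" .
  have "(F, G) \<in> ?U" using less.prems H by auto
  moreover have "finite ?U" using finite_L by auto
  ultimately have "xhat F * xhat G = sum ?f ?U - sum ?f (?U - {(F, G)})"
    using sum.remove[of ?U "(F, G)" ?f] by (simp only: prod.case add_diff_cancel_right')
  moreover have "sum ?f (?U - {(F, G)}) \<in> deg_kernel"
  proof (rule kernel.I_sum)
    fix z assume "z \<in> ?U - {(F, G)}"
    then obtain A B where z: "z = (A, B)" "A \<in> L" "F \<subseteq> A" "\<not> ?H \<subseteq> A" "B \<in> L" "G \<subseteq> B" "\<not> ?H \<subseteq> B"
      "A \<noteq> F \<or> B \<noteq> G" by auto
    have "\<not> A \<subseteq> B" "\<not> B \<subseteq> A" using z by (auto simp: cl_subset_iff)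
    moreover have "card (E - A) + card (E - B) < card (E - F) + card (E - G)"
      using z less.prems(1,2) card_Diff_less[of F A] card_Diff_less[of G B]
      by (cases "A = F"; cases "B = G") (simp_all add: psubset_eq)
    ultimately show "?f z \<in> deg_kernel" using less.hyps[of A B] z by auto
  qed
  ultimately show ?case using tot kernel.I_diff by simp
qed

lemma xhat_atom: "F \<in> L \<Longrightarrow> i \<in> E - F \<Longrightarrow> xhat F * zvar (cl {i}) \<in> deg_kernel"
proof (induction "card (E - F)" arbitrary: F rule: less_induct)
  case less
  let ?H = "cl (insert i F)"
  have FE: "insert i F \<subseteq> E" using less.prems flat_subset by auto
  have H: "?H \<in> L" "F \<subseteq> ?H" using FE subset_cl[of "insert i F"] by (auto simp: cl_in)
  let ?U = "{A \<in> L. F \<subseteq> A \<and> \<not> ?H \<subseteq> A}"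
  have tot: "(\<Sum>A\<in>?U. xhat A * zvar (cl {i})) \<in> deg_kernel"
    using zvar_atom_relation[OF less.prems] H less.prems
    by (simp add: xhat_diff sum_distrib_left mult.commute)
  have "\<not> ?H \<subseteq> F" using subset_cl[of "insert i F"] less.prems by auto
  then have "F \<in> ?U" using less.prems by auto
  then have "xhat F * zvar (cl {i}) = (\<Sum>A\<in>?U. xhat A * zvar (cl {i})) - (\<Sum>A\<in>?U - {F}. xhat A * zvar (cl {i}))"
    using finite_L sum.remove[of ?U F "\<lambda>A. xhat A * zvar (cl {i})"] by simp
  moreover have "(\<Sum>A\<in>?U - {F}. xhat A * zvar (cl {i})) \<in> deg_kernel"
  proof (rule kernel.I_sum)
    fix A assume A: "A \<in> ?U - {F}"
    then have "i \<notin> A" using cl_subset_iff[of A "insert i F"] by blast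
    then show "xhat A * zvar (cl {i}) \<in> deg_kernel"
      using less.hyps[of A] A less.prems card_Diff_less[of F A] by auto
  qed
  ultimately show ?case using tot kernel.I_diff by simp
qed

lemma sum_xhat_containing:
  assumes "i \<in> E" shows "(\<Sum>H\<in>{H \<in> L. i \<in> H}. xhat H) = zvar (cl {i})"
proof -
  have "{H \<in> L. i \<in> H} = {H \<in> L. cl {i} \<subseteq> H}" using cl_subset_iff[of _ "{i}"] by blast
  then show ?thesis using xhat[of "cl {i}"] assms by (simp add: cl_in)
qed

lemma xhat_total: "(\<Sum>F\<in>L. xhat F) = 0"
  using xhat[OF empty_in] by (simp add: zvar_def)

sublocale hr: chow_relations E L rk deg_kernel xhat
proof
  show "(\<Sum>F\<in>L. xhat F) \<in> deg_kernel"
    by (simp add: xhat_total kernel.I_zero)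
qed (auto simp: xhat_incomparable xhat_atom sum_xhat_containing)

lemma hr_S: "F \<in> L \<Longrightarrow> F \<noteq> {} \<Longrightarrow> hr.S F = mvar F"
  using xhat by (simp add: hr.S_def zvar_def)

lemma hr_Sprod: "set ms \<subseteq> L - {{}} \<Longrightarrow> prod_list (map hr.S ms) = Poly_Mapping.single (\<Sum>B\<leftarrow>ms. Poly_Mapping.single B 1) 1"
  by (induction ms) (auto simp: hr_S mvar_def mult_single)

lemma count_below_list: "count_below (\<Sum>B\<leftarrow>ms. Poly_Mapping.single B 1) T = length (filter (\<lambda>B. B \<subseteq> T) ms)"
  by (induction ms) (auto simp: count_below_add count_below_single count_below_def[of 0] simp del: One_nat_def)

text \<open>Up to sign the product is the monomial of \<open>full None xs\<close>, which satisfies the Hall--Rado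
  condition.\<close>

theorem deg_map_dual_nonzero:
  assumes "normal None xs"
  shows "deg_map (hr.nmon xs * prod_list (map hr.S (dual None xs))) \<noteq> 0"
proof -
  obtain k where k: "hr.nmon xs * prod_list (map hr.S (dual None xs))
      - (- 1) ^ k * prod_list (map hr.S (full None xs)) \<in> deg_kernel"
    using hr.nmon_dual[OF assms] by auto
  have "length (filter (\<lambda>B. B \<subseteq> {}) (full None xs)) = 0"
    using full_hall_rado[OF assms, of "{}"] empty_in rk_empty by simp
  then have L: "set (full None xs) \<subseteq> L - {{}}"
    using next_subset_full[OF assms] by (auto simp: filter_empty_conv)
  have "hall_rado (\<Sum>B\<leftarrow>full None xs. Poly_Mapping.single B 1)"
    unfolding hall_rado_def count_below_list using full_hall_rado[OF assms] by auto
  then have 1: "deg_map (prod_list (map hr.S (full None xs))) = 1"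
    by (simp add: hr_Sprod[OF L] deg_map_single)
  have "((- 1) ^ k :: 'a set mpolynomial) = mconst ((- 1) ^ k)"
  proof (induction k)
    case (Suc k)
    have "mconst (- 1) = - (1 :: 'a set mpolynomial)"
      by (simp add: mconst_def single_uminus)
    then show ?case using Suc by (simp only: power_Suc mconst_simps)
  qed (simp add: mconst_simps)
  then have "deg_map (hr.nmon xs * prod_list (map hr.S (dual None xs))) = (- 1) ^ k"
    using deg_map_kernel[OF k] by (simp add: deg_map_diff deg_map_mconst 1)
  then show ?thesis by simp
qed

theorem deg_map_dual_triangular:
  assumes "normal None xs" "normal None ys" "deg xs = deg ys"
    and "deg_map (hr.nmon xs * prod_list (map hr.S (dual None ys))) \<noteq> 0"
  shows "list_all2 (\<subseteq>) (dual None ys) (dual None xs)"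
proof (rule hr.nmon_triangular[OF assms(1)])
  show "length (dual None ys) = length (dual None xs)"
    using length_dual[OF assms(1)] length_dual[OF assms(2)] assms(3) by simp
  show "hr.start None * hr.nmon xs * prod_list (map hr.S (dual None ys)) \<notin> deg_kernel"
    using assms(4) deg_map_kernel by auto
qed (use assms dual_sorted dual_in_L in auto)

end

section \<open>Graded dimensions of the augmented Chow ring\<close>

lemma eval_monom_mvar: "eval_monom mvar m = Poly_Mapping.single m 1"
proof -
  have pow: "mvar v ^ k = Poly_Mapping.single (Poly_Mapping.single v k) 1" for v :: 'v and k
    by (induction k) (simp_all add: mvar_def mult_single single_add[symmetric] add.commute)
  have "(\<Prod>v\<in>A. mvar v ^ Poly_Mapping.lookup m v)
      = Poly_Mapping.single (\<Sum>v\<in>A. Poly_Mapping.single v (Poly_Mapping.lookup m v)) 1" if "finite A" for A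
    using that by (induction A) (simp_all add: pow mult_single)
  from this[of "Poly_Mapping.keys m"] show ?thesis
    by (simp add: eval_monom_def sum_singles[of m, symmetric])
qed

lemma monomial_as_list:
  fixes m :: "'v \<Rightarrow>\<^sub>0 nat"
  obtains vs where "set vs = Poly_Mapping.keys m"
    "length vs = (\<Sum>v\<in>Poly_Mapping.keys m. Poly_Mapping.lookup m v)"
    "Poly_Mapping.single m (1::rat) = prod_list (map mvar vs)"
proof -
  obtain ks where ks: "set ks = Poly_Mapping.keys m" "distinct ks"
    using finite_distinct_list[of "Poly_Mapping.keys m"] by auto
  define vs where "vs = concat (map (\<lambda>v. replicate (Poly_Mapping.lookup m v) v) ks)"
  have "set vs = Poly_Mapping.keys m"
    using ks(1) by (auto simp: vs_def in_keys_iff)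
  moreover have "length vs = (\<Sum>v\<in>Poly_Mapping.keys m. Poly_Mapping.lookup m v)"
    using ks by (simp add: vs_def length_concat comp_def sum.distinct_set_conv_list[symmetric])
  moreover have "prod_list (map mvar (concat (map (\<lambda>v. replicate (Poly_Mapping.lookup m v) v) ls)))
      = prod_list (map (\<lambda>v. mvar v ^ Poly_Mapping.lookup m v) ls)" for ls
    by (induction ls) (simp_all add: prod_list_replicate)
  then have "Poly_Mapping.single m (1::rat) = prod_list (map mvar vs)"
    using ks by (simp add: vs_def eval_monom_mvar[symmetric] eval_monom_def prod.distinct_set_conv_list[symmetric])
  ultimately show ?thesis using that by blast
qed

subsection \<open>Homogeneous polynomials\<close>

abbreviation monom_deg :: "('v \<Rightarrow>\<^sub>0 nat) \<Rightarrow> nat" where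
  "monom_deg m \<equiv> (\<Sum>v\<in>Poly_Mapping.keys m. Poly_Mapping.lookup m v)"

lemma monom_deg_add: "monom_deg (m + k) = monom_deg m + monom_deg k"
  by (rule setsum_keys_plus_distrib) auto

lemma homogeneous_zero: "homogeneous j 0"
  by (simp add: homogeneous_def)

lemma homogeneous_mconst: "homogeneous 0 (mconst c)"
  by (simp add: homogeneous_def mconst_def)

lemma homogeneous_mvar: "homogeneous 1 (mvar v)"
  by (simp add: homogeneous_def mvar_def)

lemma homogeneous_add: "homogeneous j p \<Longrightarrow> homogeneous j s \<Longrightarrow> homogeneous j (p + s)"
  using Poly_Mapping.keys_add[of p s] by (auto simp: homogeneous_def)

lemma homogeneous_uminus: "homogeneous j p \<Longrightarrow> homogeneous j (- p)"
  by (simp add: homogeneous_def)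

lemma homogeneous_sum: "(\<And>i. i \<in> A \<Longrightarrow> homogeneous j (f i)) \<Longrightarrow> homogeneous j (sum f A)"
  by (induction A rule: infinite_finite_induct) (auto simp: homogeneous_zero homogeneous_add)

lemma homogeneous_mult: "homogeneous j p \<Longrightarrow> homogeneous k s \<Longrightarrow> homogeneous (j + k) (p * s)"
  unfolding homogeneous_def
proof
  fix m assume p: "\<forall>m\<in>Poly_Mapping.keys p. monom_deg m = j" and s: "\<forall>m\<in>Poly_Mapping.keys s. monom_deg m = k"
    and "m \<in> Poly_Mapping.keys (p * s)"
  then obtain a b where "m = a + b" "a \<in> Poly_Mapping.keys p" "b \<in> Poly_Mapping.keys s"
    using Poly_Mapping.keys_mult[of p s] by blast
  then show "monom_deg m = j + k" using p s monom_deg_add[of a b] by simp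
qed

lemma homogeneous_power: "homogeneous j p \<Longrightarrow> homogeneous (k * j) (p ^ k)"
  by (induction k) (use homogeneous_mconst[of 1] in \<open>auto simp: mconst_simps intro: homogeneous_mult\<close>)

subsection \<open>The presentation\<close>

locale chow_presentation = ranked_flats E L rk for E :: "'a set" and L rk
begin

definition V :: "'a chow_var set" where "V = chow_vars E L"
definition P :: "'a chow_var mpolynomial set" where "P = carrier (mpoly_ring V)"
definition J :: "'a chow_var mpolynomial set" where "J = chow_ideal E L"

sublocale mp: cring "mpoly_ring V" by (rule cring_mpoly_ring)

lemma mp_ops: "p \<oplus>\<^bsub>mpoly_ring V\<^esub> s = p + s" "p \<otimes>\<^bsub>mpoly_ring V\<^esub> s = p * s"
    "\<zero>\<^bsub>mpoly_ring V\<^esub> = 0" "\<one>\<^bsub>mpoly_ring V\<^esub> = 1"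
  by (simp_all add: mpoly_ring_def)

lemma P_add: "p \<in> P \<Longrightarrow> s \<in> P \<Longrightarrow> p + s \<in> P"
  and P_mult: "p \<in> P \<Longrightarrow> s \<in> P \<Longrightarrow> p * s \<in> P"
  and P_zero: "0 \<in> P" and P_one: "1 \<in> P"
  using mp.add.m_closed mp.m_closed mp.zero_closed mp.one_closed by (simp_all add: P_def mp_ops)

lemma P_mconst: "mconst c \<in> P"
  by (simp add: P_def mpoly_ring_def mconst_def)

lemma P_mvar: "v \<in> V \<Longrightarrow> mvar v \<in> P"
  by (simp add: P_def mpoly_ring_def mvar_def)

lemma P_uminus: "p \<in> P \<Longrightarrow> - p \<in> P"
  by (simp add: P_def mpoly_ring_def)

lemma P_diff: "p \<in> P \<Longrightarrow> s \<in> P \<Longrightarrow> p - s \<in> P"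
  using P_add[of p "- s"] P_uminus by simp

lemma P_sum: "(\<And>i. i \<in> A \<Longrightarrow> f i \<in> P) \<Longrightarrow> sum f A \<in> P"
  by (induction A rule: infinite_finite_induct) (auto simp: P_zero P_add)

lemma P_prod: "(\<And>i. i \<in> A \<Longrightarrow> f i \<in> P) \<Longrightarrow> prod f A \<in> P"
  by (induction A rule: infinite_finite_induct) (auto simp: P_one P_mult)

lemma P_power: "p \<in> P \<Longrightarrow> p ^ k \<in> P"
  by (induction k) (auto simp: P_one P_mult)

lemma mp_minus: "p \<in> P \<Longrightarrow> s \<in> P \<Longrightarrow> p \<ominus>\<^bsub>mpoly_ring V\<^esub> s = p - s"
proof -
  assume ps: "p \<in> P" "s \<in> P"
  have "\<ominus>\<^bsub>mpoly_ring V\<^esub> s = - s"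
    using ps P_uminus[of s] by (intro mp.minus_equality) (auto simp: P_def mp_ops)
  then show ?thesis by (simp add: a_minus_def mp_ops)
qed

lemma X_in: "F \<in> L \<Longrightarrow> F \<noteq> E \<Longrightarrow> X F \<in> V" and Y_in: "i \<in> E \<Longrightarrow> Y i \<in> V"
  by (auto simp: V_def chow_vars_def)

lemma generators_in_P: "chow_I1 E L \<union> chow_I2 E L \<union> chow_J E L \<subseteq> P"
  unfolding chow_I1_def chow_I2_def chow_J_def
  by (auto intro!: P_mult P_diff P_sum P_mvar X_in Y_in)

lemma J_ideal: "ideal J (mpoly_ring V)"
  using mp.genideal_ideal generators_in_P by (simp add: J_def chow_ideal_def V_def[symmetric] P_def)

sublocale J: ideal J "mpoly_ring V" by (rule J_ideal)

lemma generators_in_J: "chow_I1 E L \<union> chow_I2 E L \<union> chow_J E L \<subseteq> J"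
  unfolding J_def chow_ideal_def V_def[symmetric]
  by (rule mp.genideal_self) (use generators_in_P in \<open>simp add: P_def\<close>)

lemma J_minimal: "ideal K (mpoly_ring V) \<Longrightarrow> chow_I1 E L \<union> chow_I2 E L \<union> chow_J E L \<subseteq> K \<Longrightarrow> J \<subseteq> K"
  using mp.genideal_minimal by (simp add: J_def chow_ideal_def V_def[symmetric])

lemma J_in_P: "p \<in> J \<Longrightarrow> p \<in> P" using J.Icarr by (simp add: P_def)

lemma J_mult: "p \<in> J \<Longrightarrow> s \<in> P \<Longrightarrow> s * p \<in> J" using J.I_l_closed by (simp add: P_def mp_ops)

lemma J_add: "p \<in> J \<Longrightarrow> s \<in> J \<Longrightarrow> p + s \<in> J" using J.a_closed by (simp add: mp_ops)

lemma J_zero: "0 \<in> J" using J.zero_closed by (simp add: mp_ops)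

text \<open>Retracting the big polynomial ring onto the ring in the variables \<open>V\<close> pulls \<open>J\<close> back to an
  ideal of the whole polynomial type.\<close>

definition retract :: "'a chow_var mpolynomial \<Rightarrow> 'a chow_var mpolynomial" where
  "retract = eval_poly (\<lambda>v. if v \<in> V then mvar v else 0)"

definition J' :: "'a chow_var mpolynomial set" where "J' = {p. retract p \<in> J}"

lemma retract_in_P: "retract p \<in> P"
proof -
  have "eval_monom (\<lambda>v. if v \<in> V then mvar v else 0) m \<in> P" for m
    unfolding eval_monom_def by (intro P_prod P_power) (auto simp: P_mvar P_zero)
  then show ?thesis unfolding retract_def eval_poly_def extend_linear_def
    by (intro P_sum P_mult P_mconst)
qed

lemma retract_id: "p \<in> P \<Longrightarrow> retract p = p"
proof -
  assume p: "p \<in> P"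
  have "retract p = (\<Sum>m\<in>Poly_Mapping.keys p. Poly_Mapping.single m (Poly_Mapping.lookup p m))"
    unfolding retract_def eval_poly_def extend_linear_def
  proof (rule sum.cong)
    fix m assume m: "m \<in> Poly_Mapping.keys p"
    have "eval_monom (\<lambda>v. if v \<in> V then mvar v else 0) m = eval_monom mvar m"
      unfolding eval_monom_def using p m by (intro prod.cong) (auto simp: P_def mpoly_ring_def)
    then show "mconst (Poly_Mapping.lookup p m) * eval_monom (\<lambda>v. if v \<in> V then mvar v else 0) m
        = Poly_Mapping.single m (Poly_Mapping.lookup p m)"
      by (simp add: eval_monom_mvar mconst_def mult_single)
  qed simp
  then show ?thesis using sum_singles[of p] by simp
qed

lemma J'_iff: "p \<in> P \<Longrightarrow> p \<in> J' \<longleftrightarrow> p \<in> J" by (simp add: J'_def retract_id)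

sublocale J': ring_ideal J'
  by unfold_locales (auto simp: J'_def retract_def eval_poly_zero eval_poly_add eval_poly_mult J_zero J_add
     intro: J_mult retract_in_P[unfolded retract_def])

text \<open>The top flat has no variable in the presentation; its value is forced by \<open>x_total\<close>.\<close>

definition xv :: "'a set \<Rightarrow> 'a chow_var mpolynomial" where
  "xv F = (if F = E then - (\<Sum>G\<in>L - {E}. mvar (X G)) else mvar (X F))"

lemma xv_in_P: "F \<in> L \<Longrightarrow> xv F \<in> P"
  by (auto simp: xv_def intro!: P_uminus P_sum P_mvar X_in)

lemma xv_homogeneous: "homogeneous 1 (xv F)"
  by (cases "F = E") (simp_all add: xv_def homogeneous_mvar homogeneous_uminus homogeneous_sum del: One_nat_def)

lemma sum_xv_containing:
  assumes "i \<in> E"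
  shows "(\<Sum>H\<in>{H \<in> L. i \<in> H}. xv H) = - (\<Sum>F\<in>{F \<in> L - {E}. i \<notin> F}. mvar (X F))"
proof -
  have "{H \<in> L. i \<in> H} = insert E {F \<in> L - {E}. i \<in> F}" using assms E_in by auto
  then have "(\<Sum>H\<in>{H \<in> L. i \<in> H}. xv H) = xv E + (\<Sum>F\<in>{F \<in> L - {E}. i \<in> F}. xv F)"
    using finite_L by simp
  also have "(\<Sum>F\<in>{F \<in> L - {E}. i \<in> F}. xv F) = (\<Sum>F\<in>{F \<in> L - {E}. i \<in> F}. mvar (X F))"
    by (rule sum.cong) (auto simp: xv_def)
  also have "xv E = - ((\<Sum>F\<in>{F \<in> L - {E}. i \<in> F}. mvar (X F)) + (\<Sum>F\<in>{F \<in> L - {E}. i \<notin> F}. mvar (X F)))"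
  proof -
    have "L - {E} = {F \<in> L - {E}. i \<in> F} \<union> {F \<in> L - {E}. i \<notin> F}" by auto
    then have "(\<Sum>G\<in>L - {E}. mvar (X G) :: 'a chow_var mpolynomial)
       = (\<Sum>F\<in>{F \<in> L - {E}. i \<in> F}. mvar (X F)) + (\<Sum>F\<in>{F \<in> L - {E}. i \<notin> F}. mvar (X F))"
      using finite_L by (subst sum.union_disjoint[symmetric]) (auto intro: sum.cong)
    then show ?thesis by (simp add: xv_def)
  qed
  finally show ?thesis by simp
qed

lemma Y_relation: "i \<in> E \<Longrightarrow> mvar (Y i) + (\<Sum>H\<in>{H \<in> L. i \<in> H}. xv H) \<in> J"
  using generators_in_J by (auto simp: sum_xv_containing chow_J_def)

sublocale pres: chow_relations E L rk J' xv
proof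
  fix F G assume FG: "F \<in> L" "G \<in> L" "\<not> F \<subseteq> G" "\<not> G \<subseteq> F"
  then have "F \<noteq> E" "G \<noteq> E" using flat_subset by auto
  then have "mvar (X F) * mvar (X G) \<in> chow_I1 E L"
    unfolding chow_I1_def using FG by (intro CollectI exI[of _ F] exI[of _ G]) simp
  then have "xv F * xv G \<in> J"
    using \<open>F \<noteq> E\<close> \<open>G \<noteq> E\<close> generators_in_J by (auto simp: xv_def)
  then show "xv F * xv G \<in> J'" using J'_iff J_in_P by auto
next
  have "(\<Sum>F\<in>L. xv F) = xv E + (\<Sum>F\<in>L - {E}. xv F)" using finite_L E_in by (simp add: sum.remove)
  also have "(\<Sum>F\<in>L - {E}. xv F) = (\<Sum>F\<in>L - {E}. mvar (X F))" by (rule sum.cong) (auto simp: xv_def)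
  finally show "(\<Sum>F\<in>L. xv F) \<in> J'" by (simp add: xv_def J'.I_zero)
next
  fix F i assume F: "F \<in> L" "i \<in> E - F"
  then have FE: "F \<noteq> E" by auto
  let ?s = "\<Sum>H\<in>{H \<in> L. i \<in> H}. xv H"
  have "mvar (Y i) * mvar (X F) \<in> chow_I2 E L"
    unfolding chow_I2_def using F FE by (intro CollectI exI[of _ i] exI[of _ F]) simp
  then have "mvar (Y i) * mvar (X F) \<in> J" using generators_in_J by auto
  then have "xv F * mvar (Y i) \<in> J'" using J'_iff J_in_P FE by (simp add: xv_def mult.commute)
  moreover have "xv F * (mvar (Y i) + ?s) \<in> J'"
    using Y_relation[of i] F J'_iff J_in_P by (intro J'.I_mult) auto
  ultimately have "xv F * (mvar (Y i) + ?s) - xv F * mvar (Y i) \<in> J'" by (intro J'.I_diff)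
  then show "xv F * ?s \<in> J'" by (simp add: algebra_simps)
qed

lemma S_in_P: "pres.S G \<in> P" and S_homogeneous: "homogeneous 1 (pres.S G)"
  unfolding pres.S_def by (rule P_sum, simp add: xv_in_P) (rule homogeneous_sum, rule xv_homogeneous)

lemma nmon_in_P: "normal p xs \<Longrightarrow> pres.nmon xs \<in> P"
  by (induction p xs rule: normal.induct) (auto intro!: P_mult P_power xv_in_P S_in_P P_one)

lemma nmon_homogeneous: "normal p xs \<Longrightarrow> homogeneous (deg xs) (pres.nmon xs)"
proof (induction p xs rule: normal.induct)
  case (1 p)
  then show ?case using homogeneous_mconst[of 1] by (simp add: mconst_simps)
next
  case (2 p G a xs)
  have "homogeneous (1 + (a - 1) * 1 + deg xs) (xv G * pres.S G ^ (a - 1) * pres.nmon xs)"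
    using 2 by (intro homogeneous_mult xv_homogeneous homogeneous_power S_homogeneous) auto
  then show ?case using 2 by simp
qed

definition basis :: "nat \<Rightarrow> ('a set \<times> nat) list set" where
  "basis j = {xs. normal None xs \<and> deg xs = j}"

subsection \<open>Spanning\<close>

text \<open>Modulo the relations \<open>Y i\<close> is a combination of the \<open>x F\<close>; eliminating these variables one at a time
  leads to products of the \<open>x F\<close>, which \<open>normal_span\<close> covers.\<close>

lemma var_product_in_hull:
  "set vs \<subseteq> V \<Longrightarrow> set ms \<subseteq> L \<Longrightarrow>
    prod_list (map mvar vs) * pres.xprod ms \<in> pres.normal_hull None (length vs + length ms)"
proof (induction vs arbitrary: ms)
  case Nil
  then show ?case using pres.normal_span[of None ms] by simp
next
  case (Cons v vs)
  from Cons.prems consider (X) F where "v = X F" "F \<in> L" "F \<noteq> E" | (Y) i where "v = Y i" "i \<in> E"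
    by (auto simp: V_def chow_vars_def)
  then show ?case
  proof cases
    case X
    then have "mvar v = xv F" by (simp add: xv_def)
    then show ?thesis using Cons.IH[of "F # ms"] Cons.prems X by (simp add: ac_simps)
  next
    case Y
    let ?s = "\<Sum>H\<in>{H \<in> L. i \<in> H}. xv H"
    let ?q = "prod_list (map mvar vs) * pres.xprod ms"
    have "?q * (mvar v + ?s) \<in> J'"
      using Y_relation[OF Y(2)] J'_iff J_in_P Y by (intro J'.I_mult) auto
    moreover have "(\<Sum>H\<in>{H \<in> L. i \<in> H}. prod_list (map mvar vs) * pres.xprod (H # ms))
        \<in> pres.normal_hull None (length (v # vs) + length ms)"
      unfolding pres.normal_hull_def
    proof (rule add_hull_sum, fold pres.normal_hull_def)
      fix H assume "H \<in> {H \<in> L. i \<in> H}"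
      then show "prod_list (map mvar vs) * pres.xprod (H # ms)
          \<in> pres.normal_hull None (length (v # vs) + length ms)"
        using Cons.IH[of "H # ms"] Cons.prems by simp
    qed
    ultimately have "?q * (mvar v + ?s) - (\<Sum>H\<in>{H \<in> L. i \<in> H}. prod_list (map mvar vs) * pres.xprod (H # ms))
        \<in> pres.normal_hull None (length (v # vs) + length ms)"
      unfolding pres.normal_hull_def by (intro add_hull.diff) (auto intro: add_hull.base)
    moreover have "?q * (mvar v + ?s) - (\<Sum>H\<in>{H \<in> L. i \<in> H}. prod_list (map mvar vs) * pres.xprod (H # ms))
      = prod_list (map mvar (v # vs)) * pres.xprod ms"
      by (simp add: distrib_left sum_distrib_left ac_simps)
    ultimately show ?thesis by simp
  qed
qed

end

context chow_presentation begin

subsection \<open>Independence\<close>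

text \<open>This homomorphism carries the relations of the ring into the kernel of the functional, which is
  all that is needed to transfer independence.\<close>

definition realize :: "'a chow_var mpolynomial \<Rightarrow> 'a set mpolynomial" where
  "realize = eval_poly (\<lambda>v. case v of X F \<Rightarrow> xhat F | Y i \<Rightarrow> - zvar (cl {i}))"

lemma realize_simps: "realize (mvar (X F)) = xhat F" "realize (mvar (Y i)) = - zvar (cl {i})"
  "realize (p + s) = realize p + realize s" "realize (p - s) = realize p - realize s"
  "realize (p * s) = realize p * realize s" "realize 0 = 0" "realize 1 = 1"
  "realize (mconst c) = mconst c" "realize (sum f A) = (\<Sum>i\<in>A. realize (f i))"
  by (simp_all add: realize_def eval_poly_mvar eval_poly_add eval_poly_diff eval_poly_mult
      eval_poly_zero eval_poly_one eval_poly_mconst eval_poly_sum)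

lemma realize_uminus: "realize (- p) = - realize p"
  using realize_simps(4)[of 0 p] by (simp add: realize_simps)

lemma realize_power: "realize (p ^ k) = realize p ^ k"
  by (induction k) (simp_all add: realize_simps)

lemma realize_Y_relation:
  assumes "i \<in> E"
  shows "realize (mvar (Y i) - (\<Sum>F\<in>{F \<in> L - {E}. i \<notin> F}. mvar (X F))) = 0"
proof -
  have L: "L = {H \<in> L. i \<in> H} \<union> {F \<in> L - {E}. i \<notin> F}" using assms by auto
  have "(\<Sum>F\<in>L. xhat F) = (\<Sum>H\<in>{H \<in> L. i \<in> H}. xhat H) + (\<Sum>F\<in>{F \<in> L - {E}. i \<notin> F}. xhat F)"
    using finite_L by (subst L, subst sum.union_disjoint) auto
  then have "0 = zvar (cl {i}) + (\<Sum>F\<in>{F \<in> L - {E}. i \<notin> F}. xhat F)"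
    unfolding xhat_total sum_xhat_containing[OF assms] .
  then have "(\<Sum>F\<in>{F \<in> L - {E}. i \<notin> F}. xhat F) = - zvar (cl {i})"
    by (metis add.commute eq_neg_iff_add_eq_0)
  then show ?thesis by (simp only: realize_simps diff_self)
qed

lemma realize_J: "p \<in> J \<Longrightarrow> realize p \<in> deg_kernel"
proof -
  let ?K = "{p \<in> P. realize p \<in> deg_kernel}"
  have "ideal ?K (mpoly_ring V)"
  proof (rule idealI)
    show "ring (mpoly_ring V)" by unfold_locales
    show "subgroup ?K (add_monoid (mpoly_ring V))"
    proof (rule mp.add.subgroupI)
      show "?K \<noteq> {}" using P_zero kernel.I_zero by (auto simp: realize_simps)
      show "\<ominus>\<^bsub>mpoly_ring V\<^esub> a \<in> ?K" if "a \<in> ?K" for a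
      proof -
        have "\<ominus>\<^bsub>mpoly_ring V\<^esub> a = - a"
          using that P_uminus[of a] by (intro mp.minus_equality) (auto simp: P_def mp_ops)
        then show ?thesis using that P_uminus kernel.I_uminus by (auto simp: realize_uminus)
      qed
    qed (auto simp: P_def[symmetric] mp_ops realize_simps intro: P_add kernel.I_add)
  qed (auto simp: P_def[symmetric] mp_ops realize_simps intro: P_mult kernel.I_mult kernel.I_mult2)
  moreover have "chow_I1 E L \<union> chow_I2 E L \<union> chow_J E L \<subseteq> ?K"
  proof -
    have "realize p \<in> deg_kernel" if p: "p \<in> chow_I1 E L" for p
    proof -
      obtain F G where FG: "p = mvar (X F) * mvar (X G)" "F \<in> L" "G \<in> L" "\<not> F \<subseteq> G" "\<not> G \<subseteq> F"
        using p unfolding chow_I1_def by blast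
      then show ?thesis by (simp add: realize_simps xhat_incomparable)
    qed
    moreover have "realize p \<in> deg_kernel" if p: "p \<in> chow_I2 E L" for p
    proof -
      obtain i F where iF: "p = mvar (Y i) * mvar (X F)" "i \<in> E" "F \<in> L" "i \<notin> F"
        using p by (auto simp: chow_I2_def)
      have "realize p = - (xhat F * zvar (cl {i}))" by (simp add: iF realize_simps)
      then show ?thesis using xhat_atom[of F i] iF kernel.I_uminus by auto
    qed
    moreover have "realize p \<in> deg_kernel" if "p \<in> chow_J E L" for p
      using that realize_Y_relation kernel.I_zero by (auto simp: chow_J_def)
    ultimately show ?thesis using generators_in_P by blast
  qed
  ultimately show "p \<in> J \<Longrightarrow> realize p \<in> deg_kernel" using J_minimal by blast
qed

lemma realize_xv: "F \<in> L \<Longrightarrow> realize (xv F) = xhat F"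
proof (cases "F = E")
  case True
  have "(\<Sum>G\<in>L. xhat G) = xhat E + (\<Sum>G\<in>L - {E}. xhat G)" using finite_L E_in by (simp add: sum.remove)
  then have "- (\<Sum>G\<in>L - {E}. xhat G) = xhat E"
    unfolding xhat_total by (metis add.commute eq_neg_iff_add_eq_0)
  then show ?thesis using True by (simp add: xv_def realize_uminus realize_simps)
qed (simp add: xv_def realize_simps)

lemma realize_S: "realize (pres.S G) = hr.S G"
  unfolding pres.S_def hr.S_def realize_simps by (rule sum.cong) (auto simp: realize_xv)

lemma realize_nmon: "normal p xs \<Longrightarrow> realize (pres.nmon xs) = hr.nmon xs"
  by (induction p xs rule: normal.induct) (auto simp: realize_simps realize_power realize_S realize_xv)

lemma finite_basis: "finite (basis j)"
proof -
  have "set xs \<subseteq> L \<times> {..j} \<and> length xs \<le> j" if "normal p xs" "deg xs \<le> j" for p xs j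
    using that
  proof (induction p xs arbitrary: j rule: normal.induct)
    case (2 p G a xs)
    then have "set xs \<subseteq> L \<times> {..j - a} \<and> length xs \<le> j - a" by auto
    then show ?case using 2(2,3) by (auto simp: subset_iff intro: order_trans[OF _ diff_le_self])
  qed auto
  then have "basis j \<subseteq> {xs. set xs \<subseteq> L \<times> {..j} \<and> length xs \<le> j}"
    by (auto simp: basis_def)
  then show ?thesis using finite_lists_length_le[of "L \<times> {..j}" j] finite_L finite_subset by auto
qed

definition dual_weight :: "('a set \<times> nat) list \<Rightarrow> nat" where
  "dual_weight xs = (\<Sum>B\<leftarrow>dual None xs. rk B)"

lemma rk_sum_less:
  "list_all2 (\<subseteq>) D D' \<Longrightarrow> set D \<subseteq> L \<Longrightarrow> set D' \<subseteq> L \<Longrightarrow>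
    (\<Sum>B\<leftarrow>D. rk B) \<le> (\<Sum>B\<leftarrow>D'. rk B) \<and> ((\<Sum>B\<leftarrow>D. rk B) = (\<Sum>B\<leftarrow>D'. rk B) \<longrightarrow> D = D')"
proof (induction rule: list_all2_induct)
  case (Cons B D C D')
  then have "rk B \<le> rk C" "rk B = rk C \<Longrightarrow> B = C"
    using rk_mono[of B C] rk_strict[of B C] by auto
  then show ?case using Cons by auto
qed auto

text \<open>Pair a vanishing combination with the dual of a monomial whose dual has the largest rank sum
  among those that occur: by triangularity only that monomial contributes.\<close>

theorem nmon_independent:
  assumes "(\<Sum>b\<in>basis j. mconst (c b) * pres.nmon b) \<in> J" "b \<in> basis j"
  shows "c b = 0"
proof (rule ccontr)
  assume "c b \<noteq> 0"
  let ?N = "{b \<in> basis j. c b \<noteq> 0}"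
  have N: "finite ?N" "?N \<noteq> {}" using finite_basis assms(2) \<open>c b \<noteq> 0\<close> by auto
  define w where "w = Max (dual_weight ` ?N)"
  have "w \<in> dual_weight ` ?N" unfolding w_def using N by (intro Max_in) auto
  then obtain b0 where b0: "b0 \<in> ?N" "dual_weight b0 = w" by auto
  have wmax: "dual_weight b \<le> dual_weight b0" if "b \<in> ?N" for b
    using that N b0 by (auto simp: w_def)
  let ?D = "prod_list (map hr.S (dual None b0))"
  have zero: "deg_map (hr.nmon b * ?D) = 0" if b: "b \<in> ?N" "b \<noteq> b0" for b
  proof (rule ccontr)
    assume "deg_map (hr.nmon b * ?D) \<noteq> 0"
    then have l: "list_all2 (\<subseteq>) (dual None b0) (dual None b)"
      using deg_map_dual_triangular b b0 by (auto simp: basis_def)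
    have L: "set (dual None b0) \<subseteq> L" "set (dual None b) \<subseteq> L"
      using dual_in_L b b0 by (auto simp: basis_def)
    have "dual None b0 = dual None b"
      using rk_sum_less[OF l L] wmax[OF b(1)] by (auto simp: dual_weight_def)
    then show False using dual_inj[of None b0 b] b b0 by (auto simp: basis_def)
  qed
  have "realize (\<Sum>b\<in>basis j. mconst (c b) * pres.nmon b) = (\<Sum>b\<in>basis j. mconst (c b) * hr.nmon b)"
    unfolding realize_simps by (rule sum.cong) (auto simp: basis_def realize_nmon)
  then have "(\<Sum>b\<in>basis j. mconst (c b) * hr.nmon b) \<in> deg_kernel" using realize_J[OF assms(1)] by simp
  then have "deg_map ((\<Sum>b\<in>basis j. mconst (c b) * hr.nmon b) * ?D) = 0" by (simp add: deg_kernel_def)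
  then have "(\<Sum>b\<in>basis j. c b * deg_map (hr.nmon b * ?D)) = 0"
    by (simp add: sum_distrib_right deg_map_sum mult.assoc deg_map_mconst)
  moreover have "(\<Sum>b\<in>basis j. c b * deg_map (hr.nmon b * ?D)) = (\<Sum>b\<in>{b0}. c b * deg_map (hr.nmon b * ?D))"
    using zero b0 finite_basis by (intro sum.mono_neutral_right) auto
  ultimately have "c b0 * deg_map (hr.nmon b0 * ?D) = 0" by simp
  then show False using b0 deg_map_dual_nonzero by (auto simp: basis_def)
qed

lemma one_notin_J: "1 \<notin> J"
proof
  assume "1 \<in> J"
  then have "(1 :: 'a set mpolynomial) \<in> deg_kernel" using realize_J[of 1] by (simp add: realize_simps)
  then have "deg_map 1 = 0" by (rule deg_map_kernel)
  moreover have "deg_map 1 = 1"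
    using deg_map_single[of 0 1] by (simp add: hall_rado_def count_below_def)
  ultimately show False by simp
qed

subsection \<open>Spanning the graded pieces\<close>

text \<open>Straightening preserves the degree, so only the normal chains of degree \<open>j\<close> occur.\<close>

lemma homogeneous_combination:
  assumes "p \<in> P" "homogeneous j p"
  shows "\<exists>c. p - (\<Sum>b\<in>basis j. mconst (c b) * pres.nmon b) \<in> J"
proof -
  let ?C = "\<lambda>c. \<Sum>b\<in>basis j. mconst (c b) * pres.nmon b"
  let ?W = "{p. \<exists>c. p - ?C c \<in> J'}"
  have C: "mconst k * ?C c - ?C c' = ?C (\<lambda>b. k * c b - c' b)" for k c c'
  proof -
    have m: "mconst (k * c b - c' b) = mconst k * mconst (c b) - (mconst (c' b) :: 'a chow_var mpolynomial)" for b
    proof -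
      have "mconst (k * c b - c' b) + mconst (c' b) = (mconst (k * c b) :: 'a chow_var mpolynomial)"
        by (simp add: mconst_simps(1)[symmetric])
      then show ?thesis by (simp add: mconst_simps(2) eq_diff_eq)
    qed
    show ?thesis by (simp add: m algebra_simps sum_distrib_left sum_subtractf)
  qed
  have W: "mconst k * u - v \<in> ?W" if "u \<in> ?W" "v \<in> ?W" for k u v
  proof -
    obtain c c' where "u - ?C c \<in> J'" "v - ?C c' \<in> J'" using \<open>u \<in> ?W\<close> \<open>v \<in> ?W\<close> by blast
    then have "mconst k * (u - ?C c) - (v - ?C c') \<in> J'" by (rule J'.I_diff[OF J'.I_mult])
    moreover have "mconst k * (u - ?C c) - (v - ?C c') = mconst k * u - v - (mconst k * ?C c - ?C c')"
      by (simp add: algebra_simps)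
    ultimately have "mconst k * u - v - ?C (\<lambda>b. k * c b - c' b) \<in> J'" by (simp only: C)
    then show ?thesis by (intro CollectI exI[of _ "\<lambda>b. k * c b - c' b"])
  qed
  have W0: "u \<in> ?W" if "u \<in> J'" for u
    using that by (intro CollectI exI[of _ "\<lambda>b. 0"]) (simp add: mconst_simps)
  have Wn: "pres.nmon b \<in> ?W" if "b \<in> basis j" for b
  proof -
    have "?C (\<lambda>b'. of_bool (b' = b)) = (\<Sum>b'\<in>{b}. mconst (of_bool (b' = b)) * pres.nmon b')"
      using that finite_basis by (intro sum.mono_neutral_right) (auto simp: mconst_simps)
    then have "pres.nmon b - ?C (\<lambda>b'. of_bool (b' = b)) = 0" by (simp add: mconst_simps)
    then show ?thesis using J'.I_zero by (intro CollectI exI[of _ "\<lambda>b'. of_bool (b' = b)"]) (simp only:)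
  qed
  have hull: "u \<in> ?W" if "u \<in> pres.normal_hull None j" for u
    using that unfolding pres.normal_hull_def
  proof induction
    case (base a)
    then show ?case using W0 Wn by (auto simp: basis_def)
  next
    case (diff a b)
    then show ?case using W[of a b 1] by (simp add: mconst_simps)
  next
    case zero
    show ?case by (rule W0[OF J'.I_zero])
  qed
  have mono: "Poly_Mapping.single m a \<in> ?W" if m: "m \<in> Poly_Mapping.keys p" for m a
  proof -
    obtain vs where vs: "set vs = Poly_Mapping.keys m" "length vs = monom_deg m"
      "Poly_Mapping.single m (1::rat) = prod_list (map mvar vs)" by (rule monomial_as_list)
    have "set vs \<subseteq> V" "length vs = j"
      using vs m assms by (auto simp: P_def mpoly_ring_def homogeneous_def)
    then have "Poly_Mapping.single m 1 \<in> pres.normal_hull None j"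
      using var_product_in_hull[of vs "[]"] vs by simp
    from W[OF hull[OF this] W0[OF J'.I_zero], of a] show ?thesis by (simp add: mconst_def mult_single)
  qed
  have "(\<Sum>m\<in>A. Poly_Mapping.single m (Poly_Mapping.lookup p m)) \<in> ?W" if "A \<subseteq> Poly_Mapping.keys p" for A
    using finite_subset[OF that finite_keys] that
  proof (induction A rule: finite_induct)
    case (insert m A)
    have "mconst (- 1) * (\<Sum>m\<in>A. Poly_Mapping.single m (Poly_Mapping.lookup p m)) - 0 \<in> ?W"
      using insert W[OF _ W0[OF J'.I_zero]] by auto
    then have "mconst 1 * Poly_Mapping.single m (Poly_Mapping.lookup p m)
        - (mconst (- 1) * (\<Sum>m\<in>A. Poly_Mapping.single m (Poly_Mapping.lookup p m)) - 0) \<in> ?W"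
      using W[OF mono] insert by auto
    moreover have "mconst (- 1) = - (1 :: 'a chow_var mpolynomial)"
      by (simp add: mconst_def single_uminus)
    ultimately show ?case using insert by (simp add: mconst_simps)
  next
    case empty
    show ?case unfolding sum.empty by (rule W0[OF J'.I_zero])
  qed
  from this[OF order_refl] have "p \<in> ?W" by (simp only: sum_singles[of p, symmetric])
  then obtain c where c: "p - ?C c \<in> J'" by blast
  have "p - ?C c \<in> P" using assms nmon_in_P by (auto simp: basis_def intro!: P_diff P_sum P_mult P_mconst)
  then show ?thesis using c J'_iff by blast
qed

subsection \<open>The quotient ring\<close>

abbreviation A where "A \<equiv> augmented_chow_ring E L"
abbreviation cls where "cls \<equiv> augmented_chow_class E L"

lemma A_def: "A = mpoly_ring V Quot J"
  by (simp add: augmented_chow_ring_def V_def J_def)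

lemma cls_def: "cls p = J +>\<^bsub>mpoly_ring V\<^esub> p"
  by (simp add: augmented_chow_class_def V_def J_def)

sublocale A: cring A
  unfolding A_def by (rule J.quotient_is_cring) unfold_locales

lemma cls_hom: "cls \<in> ring_hom (mpoly_ring V) A"
  using J.rcos_ring_hom by (simp add: A_def cls_def[abs_def])

lemma cls_in: "p \<in> P \<Longrightarrow> cls p \<in> carrier A"
  and cls_add: "p \<in> P \<Longrightarrow> s \<in> P \<Longrightarrow> cls (p + s) = cls p \<oplus>\<^bsub>A\<^esub> cls s"
  and cls_mult: "p \<in> P \<Longrightarrow> s \<in> P \<Longrightarrow> cls (p * s) = cls p \<otimes>\<^bsub>A\<^esub> cls s"
  and cls_one: "cls 1 = \<one>\<^bsub>A\<^esub>"
  using cls_hom by (auto simp: P_def ring_hom_def mp_ops)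

lemma cls_zero: "cls 0 = \<zero>\<^bsub>A\<^esub>"
  using cls_add[OF P_zero P_zero] cls_in[OF P_zero] by (simp add: A.add.l_cancel_one')

lemma cls_eq_iff: "p \<in> P \<Longrightarrow> s \<in> P \<Longrightarrow> cls p = cls s \<longleftrightarrow> p - s \<in> J"
  using mp.quotient_eq_iff_same_a_r_cos[OF J_ideal, of p s] mp_minus[of p s]
  by (simp add: cls_def P_def)

abbreviation K where "K \<equiv> augmented_chow_scalars E L"

lemma K_def: "K = range (\<lambda>c. cls (mconst c))"
  by (simp add: augmented_chow_scalars_def)

lemma cls_mconst_eq_zero: "cls (mconst c) = \<zero>\<^bsub>A\<^esub> \<longleftrightarrow> c = 0"
proof
  assume "cls (mconst c) = \<zero>\<^bsub>A\<^esub>"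
  then have c: "mconst c \<in> J" using cls_eq_iff[OF P_mconst P_zero, of c] by (simp add: cls_zero)
  show "c = 0"
  proof (rule ccontr)
    assume "c \<noteq> 0"
    have "mconst (inverse c) * mconst c \<in> J" using c by (intro J_mult P_mconst)
    then show False using one_notin_J \<open>c \<noteq> 0\<close> by (simp add: mconst_simps(2,3)[symmetric])
  qed
qed (simp add: mconst_simps cls_zero)

lemma K_subfield: "subfield K A"
proof (rule A.subfieldI)
  have um: "\<ominus>\<^bsub>A\<^esub> cls (mconst c) = cls (mconst (- c))" for c
    using cls_add[OF P_mconst P_mconst, of "- c" c, folded mconst_simps(1)]
    by (intro A.minus_equality) (auto simp: mconst_simps cls_zero cls_in P_mconst)
  show "subcring K A"
  proof (rule A.subcringI', rule A.subringI)
    show "K \<subseteq> carrier A" by (auto simp: K_def cls_in P_mconst)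
    show "\<one>\<^bsub>A\<^esub> \<in> K" using cls_one mconst_simps(3) by (metis K_def rangeI)
    show "\<ominus>\<^bsub>A\<^esub> h \<in> K" if "h \<in> K" for h using that um by (auto simp: K_def)
    show "h1 \<otimes>\<^bsub>A\<^esub> h2 \<in> K" if "h1 \<in> K" "h2 \<in> K" for h1 h2
      using that by (auto simp: K_def cls_mult[symmetric] P_mconst mconst_simps(2)[symmetric])
    show "h1 \<oplus>\<^bsub>A\<^esub> h2 \<in> K" if "h1 \<in> K" "h2 \<in> K" for h1 h2
      using that by (auto simp: K_def cls_add[symmetric] P_mconst mconst_simps(1)[symmetric])
  qed
  show "Units (A\<lparr>carrier := K\<rparr>) = K - {\<zero>\<^bsub>A\<^esub>}"
  proof
    show "Units (A\<lparr>carrier := K\<rparr>) \<subseteq> K - {\<zero>\<^bsub>A\<^esub>}"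
    proof
      fix u assume u: "u \<in> Units (A\<lparr>carrier := K\<rparr>)"
      then obtain v where v: "u \<in> K" "v \<in> K" "v \<otimes>\<^bsub>A\<^esub> u = \<one>\<^bsub>A\<^esub>" by (auto simp: Units_def)
      have "\<one>\<^bsub>A\<^esub> \<noteq> \<zero>\<^bsub>A\<^esub>" using cls_mconst_eq_zero[of 1] cls_one by (simp add: mconst_simps)
      moreover have "v \<in> carrier A" using v(2) by (auto simp: K_def cls_in P_mconst)
      then have "v \<otimes>\<^bsub>A\<^esub> \<zero>\<^bsub>A\<^esub> = \<zero>\<^bsub>A\<^esub>" by (rule A.r_null)
      ultimately have "u \<noteq> \<zero>\<^bsub>A\<^esub>" using v(3) by metis
      then show "u \<in> K - {\<zero>\<^bsub>A\<^esub>}" using v(1) by blast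
    qed
    show "K - {\<zero>\<^bsub>A\<^esub>} \<subseteq> Units (A\<lparr>carrier := K\<rparr>)"
    proof
      fix u assume u: "u \<in> K - {\<zero>\<^bsub>A\<^esub>}"
      then obtain c where c: "u = cls (mconst c)" "c \<noteq> 0" using cls_mconst_eq_zero by (auto simp: K_def)
      have "cls (mconst (inverse c)) \<otimes>\<^bsub>A\<^esub> u = \<one>\<^bsub>A\<^esub>" "u \<otimes>\<^bsub>A\<^esub> cls (mconst (inverse c)) = \<one>\<^bsub>A\<^esub>"
        using c by (simp_all add: cls_mult[symmetric] P_mconst mconst_simps(2)[symmetric] mconst_simps(3) cls_one)
      then show "u \<in> Units (A\<lparr>carrier := K\<rparr>)"
        using u by (auto simp: Units_def K_def)
    qed
  qed
qed

lemma combine_cls: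
  "set bs \<subseteq> basis j \<Longrightarrow> A.combine (map (\<lambda>b. cls (mconst (f b))) bs) (map (\<lambda>b. cls (pres.nmon b)) bs)
    = cls (\<Sum>b\<leftarrow>bs. mconst (f b) * pres.nmon b)"
proof (induction bs)
  case (Cons b bs)
  have P: "pres.nmon b \<in> P" if "b \<in> basis j" for b using that nmon_in_P by (auto simp: basis_def)
  have "(\<Sum>b\<leftarrow>bs. mconst (f b) * pres.nmon b) \<in> P"
    using Cons.prems by (induction bs) (auto intro!: P_zero P_add P_mult P_mconst P)
  then show ?case using Cons P[of b] by (simp add: cls_add cls_mult P_mult P_mconst)
qed (simp add: cls_zero)

theorem dim_piece: "ring.dim A K (augmented_chow_piece E L j) = card (basis j)"
proof -
  obtain bs where bs: "set bs = basis j" "distinct bs"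
    using finite_distinct_list[OF finite_basis] by blast
  let ?Us = "map (\<lambda>b. cls (pres.nmon b)) bs"
  have P: "pres.nmon b \<in> P" if "b \<in> basis j" for b using that nmon_in_P by (auto simp: basis_def)
  have Us: "set ?Us \<subseteq> carrier A" using bs P by (auto simp: cls_in)
  have comb: "A.combine (map (\<lambda>b. cls (mconst (f b))) bs) ?Us = cls (\<Sum>b\<in>basis j. mconst (f b) * pres.nmon b)" for f
    unfolding bs(1)[symmetric] sum.distinct_set_conv_list[OF bs(2)]
    by (rule combine_cls[of bs j]) (simp only: bs(1) order_refl)
  have CP: "(\<Sum>b\<in>basis j. mconst (f b) * pres.nmon b) \<in> P" for f
    by (intro P_sum P_mult P_mconst P)
  have coeffs: "\<exists>f. Ks = map (\<lambda>b. cls (mconst (f b))) bs" if "set Ks \<subseteq> K" "length Ks = length bs" for Ks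
  proof -
    define f where "f b = (SOME c. the (map_of (zip bs Ks) b) = cls (mconst c))" for b
    have "Ks ! i = cls (mconst (f (bs ! i)))" if i: "i < length bs" for i
    proof -
      have m: "the (map_of (zip bs Ks) (bs ! i)) = Ks ! i"
        using bs i \<open>length Ks = length bs\<close> by (simp add: map_of_zip_nth)
      have "Ks ! i \<in> K" using i that \<open>length Ks = length bs\<close> \<open>set Ks \<subseteq> K\<close> by (metis nth_mem subsetD)
      then have "\<exists>c. the (map_of (zip bs Ks) (bs ! i)) = cls (mconst c)" by (auto simp: m K_def)
      from someI_ex[OF this] show ?thesis by (simp add: f_def m)
    qed
    then show ?thesis using \<open>length Ks = length bs\<close> by (intro exI[of _ f] nth_equalityI) auto
  qed
  have KC: "K \<subseteq> carrier A" by (auto simp: K_def cls_in P_mconst)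
  have indep: "A.independent K ?Us"
  proof (rule A.trivial_combine_imp_independent[OF K_subfield Us])
    fix Ks assume Ks: "set Ks \<subseteq> K" "A.combine Ks ?Us = \<zero>\<^bsub>A\<^esub>"
    have KsC: "set Ks \<subseteq> carrier A" using Ks KC by auto
    have zK: "\<zero>\<^bsub>A\<^esub> \<in> K" using cls_zero by (metis K_def mconst_simps(4) rangeI)
    obtain Ks' where Ks': "set (take (length ?Us) Ks) \<subseteq> set Ks'"
      "set Ks' \<subseteq> set (take (length ?Us) Ks) \<union> {\<zero>\<^bsub>A\<^esub>}" "length Ks' = length ?Us" "A.combine Ks' ?Us = \<zero>\<^bsub>A\<^esub>"
      using A.combine_normalize[OF KsC Us Ks(2)] by blast
    have "set Ks' \<subseteq> K" using Ks' Ks zK set_take_subset[of "length ?Us" Ks] by auto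
    then obtain f where f: "Ks' = map (\<lambda>b. cls (mconst (f b))) bs" using coeffs Ks'(3) by auto
    have "cls (\<Sum>b\<in>basis j. mconst (f b) * pres.nmon b) = cls 0"
      using Ks'(4) comb[of f] by (simp add: f cls_zero)
    then have "(\<Sum>b\<in>basis j. mconst (f b) * pres.nmon b) \<in> J"
      using cls_eq_iff[OF CP P_zero] by simp
    then have "f b = 0" if "b \<in> basis j" for b using nmon_independent that by blast
    then show "set (take (length ?Us) Ks) \<subseteq> {\<zero>\<^bsub>A\<^esub>}"
      using Ks'(1) bs by (auto simp: f mconst_simps cls_zero)
  qed
  have span: "A.Span K ?Us = augmented_chow_piece E L j"
    unfolding A.Span_eq_combine_set_length_version[OF K_subfield Us]
  proof (intro subset_antisym subsetI)
    fix u assume "u \<in> {A.combine Ks ?Us |Ks. length Ks = length ?Us \<and> set Ks \<subseteq> K}"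
    then obtain Ks where Ks: "u = A.combine Ks ?Us" "length Ks = length bs" "set Ks \<subseteq> K" by auto
    then obtain f where "Ks = map (\<lambda>b. cls (mconst (f b))) bs" using coeffs by blast
    then have "u = cls (\<Sum>b\<in>basis j. mconst (f b) * pres.nmon b)" using Ks(1) comb by simp
    moreover have "homogeneous j (\<Sum>b\<in>basis j. mconst (f b) * pres.nmon b)"
    proof (rule homogeneous_sum)
      fix b assume "b \<in> basis j"
      then have "homogeneous j (pres.nmon b)" using nmon_homogeneous by (auto simp: basis_def)
      then show "homogeneous j (mconst (f b) * pres.nmon b)"
        using homogeneous_mult[OF homogeneous_mconst] by force
    qed
    ultimately show "u \<in> augmented_chow_piece E L j"
      using CP[of f] by (auto simp: augmented_chow_piece_def P_def V_def)
  next
    fix u assume "u \<in> augmented_chow_piece E L j"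
    then obtain p where p: "u = cls p" "p \<in> P" "homogeneous j p"
      by (auto simp: augmented_chow_piece_def P_def V_def)
    obtain f where "p - (\<Sum>b\<in>basis j. mconst (f b) * pres.nmon b) \<in> J"
      using homogeneous_combination p by blast
    then have "u = cls (\<Sum>b\<in>basis j. mconst (f b) * pres.nmon b)"
      using cls_eq_iff[OF p(2) CP] p by auto
    then have "u = A.combine (map (\<lambda>b. cls (mconst (f b))) bs) ?Us" by (simp add: comb)
    moreover have "set (map (\<lambda>b. cls (mconst (f b))) bs) \<subseteq> K" by (auto simp: K_def)
    ultimately show "u \<in> {A.combine Ks ?Us |Ks. length Ks = length ?Us \<and> set Ks \<subseteq> K}"
      by (intro CollectI exI[of _ "map (\<lambda>b. cls (mconst (f b))) bs"]) simp
  qed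
  have "A.dimension (length ?Us) K (A.Span K ?Us)" using indep by (rule A.dimension_independent)
  then have "A.dimension (length ?Us) K (augmented_chow_piece E L j)" unfolding span .
  from A.dimI[OF K_subfield this] have "A.dim K (augmented_chow_piece E L j) = length bs"
    by (simp add: over_def)
  then show ?thesis using distinct_card[OF bs(2)] bs(1) by simp
qed

theorem augmented_chow_Hilb_eq:
  "augmented_chow_Hilb E L = Abs_fps (\<lambda>j. of_nat (card (basis j)))"
  unfolding augmented_chow_Hilb_def Hilb_def dim_piece ..

end

section \<open>Gaussian binomial coefficients\<close>

lemma q_int_Suc: "q_int q (Suc m) = q_int q m + q ^ m"
  by (simp add: q_int_def)

lemma q_int_eq: "(q - 1) * q_int q m = q ^ m - 1"
  by (induction m) (simp_all add: q_int_Suc algebra_simps, simp add: q_int_def)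

lemma q_int_add: "q_int q (m + k) = q_int q m + q ^ m * q_int q k"
  by (induction k) (simp_all add: q_int_Suc algebra_simps power_add, simp add: q_int_def)

lemma q_fact_0 [simp]: "q_fact q 0 = 1" by (simp add: q_fact_def)

lemma q_fact_Suc: "q_fact q (Suc m) = q_int q (Suc m) * q_fact q m"
  by (simp add: q_fact_def mult.commute)

text \<open>The Gaussian binomial coefficient, set to zero outside the triangle \<open>k \<le> n\<close> so that Pascal's
  rule holds without side conditions.\<close>

definition qbin :: "rat \<Rightarrow> nat \<Rightarrow> nat \<Rightarrow> rat" where
  "qbin q n k = (if k \<le> n then q_binomial q n k else 0)"

text \<open>For \<open>q > 1\<close> all \<open>q\<close>-integers are invertible, and the powers of \<open>q\<close> are infinitely many points at
  which polynomial identities may be tested.\<close>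

locale base_q =
  fixes q :: rat
  assumes q_gt_1: "q > 1"
begin

lemma q_int_pos: "m > 0 \<Longrightarrow> q_int q m > 0"
  using q_gt_1 by (cases m) (auto simp: q_int_Suc q_int_def intro!: add_nonneg_pos sum_nonneg)

lemma q_fact_pos: "q_fact q m > 0"
  by (induction m) (auto simp: q_fact_Suc q_int_pos)

lemma q_fact_nonzero [simp]: "q_fact q m \<noteq> 0"
  using q_fact_pos[of m] by simp

lemma qbin_0 [simp]: "qbin q n 0 = 1" and qbin_self [simp]: "qbin q n n = 1"
  and qbin_eq_0: "n < k \<Longrightarrow> qbin q n k = 0"
  by (simp_all add: qbin_def q_binomial_def)

lemma qbin_Suc_Suc: "qbin q (Suc n) (Suc k) = qbin q n k + q ^ Suc k * qbin q n (Suc k)"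
proof -
  consider "n < k" | "n = k" | "k < n" by linarith
  then show ?thesis
  proof cases
    case 3
    then obtain d where d: "n = Suc (k + d)" by (metis less_imp_Suc_add)
    have "q_int q (Suc (Suc (k + d))) = q_int q (Suc k) + q ^ Suc k * q_int q (Suc d)"
      using q_int_add[of q "Suc k" "Suc d"] by simp
    moreover have "q_int q (Suc k) \<noteq> 0" "q_int q (Suc d) \<noteq> 0"
      using q_int_pos[of "Suc k"] q_int_pos[of "Suc d"] by auto
    ultimately show ?thesis
      by (simp add: d qbin_def q_binomial_def q_fact_Suc Suc_diff_le field_simps)
  qed (auto simp: qbin_eq_0)
qed

lemma qbin_Suc_Suc': "k \<le> n \<Longrightarrow> qbin q (Suc n) (Suc k) = q ^ (n - k) * qbin q n k + qbin q n (Suc k)"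
proof -
  assume "k \<le> n"
  then consider "n = k" | "k < n" by linarith
  then show ?thesis
  proof cases
    case 2
    then obtain d where d: "n = Suc (k + d)" by (metis less_imp_Suc_add)
    have "q_int q (Suc (Suc (k + d))) = q_int q (Suc d) + q ^ Suc d * q_int q (Suc k)"
      using q_int_add[of q "Suc d" "Suc k"] by (simp add: add.commute)
    moreover have "q_int q (Suc k) \<noteq> 0" "q_int q (Suc d) \<noteq> 0"
      using q_int_pos[of "Suc k"] q_int_pos[of "Suc d"] by auto
    ultimately show ?thesis
      by (simp add: d qbin_def q_binomial_def q_fact_Suc Suc_diff_le field_simps)
  qed (auto simp: qbin_eq_0)
qed

lemma qbin_hockey_stick: "(\<Sum>b<M. q ^ b * qbin q (b + n) n) = qbin q (M + n) (Suc n)"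
proof (induction M)
  case 0
  show ?case by (simp add: qbin_eq_0)
next
  case (Suc M)
  then show ?case using qbin_Suc_Suc'[of n "M + n"] by simp
qed

end

subsection \<open>Bounded decreasing sequences\<close>

text \<open>Position \<open>i\<close> of \<open>D\<close> asks for a strict descent between the entries \<open>i\<close> and \<open>i + 1\<close>, counted from \<open>1\<close>.\<close>

definition dec_seqs :: "nat \<Rightarrow> nat \<Rightarrow> nat set \<Rightarrow> nat list set" where
  "dec_seqs n N D = {cs. length cs = n \<and> sorted_wrt (\<ge>) cs \<and> set cs \<subseteq> {..N} \<and>
     (\<forall>i. Suc i < n \<longrightarrow> Suc i \<in> D \<longrightarrow> cs ! Suc i < cs ! i)}"

lemma finite_dec_seqs: "finite (dec_seqs n N D)"
  by (rule finite_subset[OF _ finite_lists_length_eq[of "{..N}" n]]) (auto simp: dec_seqs_def)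

lemma dec_seqs_Suc:
  "dec_seqs (Suc (Suc n)) N D =
    (\<Union>a\<in>{a. a \<le> N \<and> (1 \<in> D \<longrightarrow> 1 \<le> a)}. (#) a ` dec_seqs (Suc n) (a - of_bool (1 \<in> D)) {i. Suc i \<in> D})"
    (is "?L = ?R")
proof
  show "?L \<subseteq> ?R"
  proof
    fix cs assume cs: "cs \<in> ?L"
    then obtain a b bs where c: "cs = a # b # bs"
      by (auto simp: dec_seqs_def length_Suc_conv)
    have strict: "\<And>i. Suc i < Suc (Suc n) \<Longrightarrow> Suc i \<in> D \<Longrightarrow> cs ! Suc i < cs ! i" using cs by (auto simp: dec_seqs_def)
    have 1: "1 \<in> D \<Longrightarrow> b < a" using strict[of 0] c by simp
    have "b # bs \<in> dec_seqs (Suc n) (a - of_bool (1 \<in> D)) {i. Suc i \<in> D}"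
      unfolding dec_seqs_def
    proof (intro CollectI conjI allI impI)
      show "set (b # bs) \<subseteq> {..a - of_bool (1 \<in> D)}" using cs 1 c by (fastforce simp: dec_seqs_def)
      fix i assume "Suc i < Suc n" "Suc i \<in> {i. Suc i \<in> D}"
      then show "(b # bs) ! Suc i < (b # bs) ! i" using strict[of "Suc i"] c by simp
    qed (use cs c in \<open>auto simp: dec_seqs_def\<close>)
    moreover have "a \<le> N" "1 \<in> D \<longrightarrow> 1 \<le> a" using cs c 1 by (auto simp: dec_seqs_def)
    ultimately show "cs \<in> ?R" using c by blast
  qed
  show "?R \<subseteq> ?L"
  proof
    fix cs assume "cs \<in> ?R"
    then obtain a bs where a: "cs = a # bs" "a \<le> N" "1 \<in> D \<longrightarrow> 1 \<le> a"
      and bs: "bs \<in> dec_seqs (Suc n) (a - of_bool (1 \<in> D)) {i. Suc i \<in> D}" by blast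
    show "cs \<in> ?L"
      unfolding dec_seqs_def
    proof (intro CollectI conjI allI impI)
      fix i assume i: "Suc i < Suc (Suc n)" "Suc i \<in> D"
      show "cs ! Suc i < cs ! i"
      proof (cases i)
        case 0
        have "bs ! 0 \<in> set bs" using bs by (auto simp: dec_seqs_def intro!: nth_mem)
        moreover have "set bs \<subseteq> {..a - 1}" using bs 0 i by (auto simp: dec_seqs_def)
        ultimately have "bs ! 0 \<le> a - 1" by blast
        then show ?thesis using a 0 i by simp
      next
        case (Suc k)
        then show ?thesis using bs i a by (auto simp: dec_seqs_def)
      qed
    qed (use a bs in \<open>fastforce simp: dec_seqs_def\<close>)+
  qed
qed

context base_q begin

text \<open>A strict descent at \<open>i\<close> costs one unit in each of the first \<open>i\<close> entries; subtracting these units leaves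
  an unrestricted decreasing sequence bounded by \<open>N - card D\<close>.\<close>

lemma sum_dec_seqs:
  "D \<subseteq> {1..<n} \<Longrightarrow> n \<ge> 1 \<Longrightarrow>
    (\<Sum>cs\<in>dec_seqs n N D. q ^ sum_list cs) = q ^ (\<Sum>D) * qbin q (N + n - card D) n"
proof (induction n arbitrary: N D)
  case (Suc n)
  show ?case
  proof (cases n)
    case 0
    have "dec_seqs 1 N D = (\<lambda>a. [a]) ` {..N}"
      by (auto simp: dec_seqs_def length_Suc_conv image_def)
    then have "(\<Sum>cs\<in>dec_seqs 1 N D. q ^ sum_list cs) = (\<Sum>a<Suc N. q ^ a)"
      by (simp add: sum.reindex inj_on_def lessThan_Suc_atMost)
    also have "\<dots> = qbin q (N + 1) 1" using qbin_hockey_stick[where n = 0 and M = "Suc N"] by simp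
    finally show ?thesis using 0 Suc.prems by simp
  next
    case (Suc n')
    define e where "e = (of_bool (1 \<in> D) :: nat)"
    define D' where "D' = {i. Suc i \<in> D}"
    have finD: "finite D" using Suc.prems finite_subset by blast
    have D': "D' \<subseteq> {0..<n}" "finite D'" 
    proof -
      show "D' \<subseteq> {0..<n}" using Suc.prems by (auto simp: D'_def)
      then show "finite D'" using finite_subset by blast
    qed
    let ?D = "D' - {0}"
    have ih: "(\<Sum>cs\<in>dec_seqs n M D'. q ^ sum_list cs) = q ^ (\<Sum>?D) * qbin q (M + n - card ?D) n" for M
    proof -
      have "dec_seqs n M D' = dec_seqs n M ?D" by (auto simp: dec_seqs_def)
      moreover have "?D \<subseteq> {1..<n}" using D' by (auto simp: Suc_le_eq)
      ultimately show ?thesis using Suc.IH[of ?D M] Suc by simp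
    qed
    have DD: "D = Suc ` ?D \<union> (if 1 \<in> D then {1} else {})"
    proof -
      have "i \<in> Suc ` ?D" if "i \<in> D" "i \<noteq> 1" for i
        using that Suc.prems by (cases i) (auto simp: D'_def image_iff)
      then show ?thesis by (auto simp: D'_def)
    qed
    have disj: "Suc ` ?D \<inter> (if 1 \<in> D then {1} else {}) = {}" by auto
    have cD: "card D = card ?D + e"
      by (subst DD, subst card_Un_disjoint[OF _ _ disj]) (use D' in \<open>auto simp: card_image e_def\<close>)
    have sD: "\<Sum>D = \<Sum>?D + card ?D + e"
    proof -
      have "\<Sum>D = \<Sum>(Suc ` ?D) + \<Sum>(if 1 \<in> D then {1} else {})"
        by (subst DD, subst sum.union_disjoint[OF _ _ disj]) (use D' in auto)
      also have "\<Sum>(Suc ` ?D) = \<Sum>?D + card ?D" by (simp add: sum.reindex sum.distrib sum_Suc)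
      finally show ?thesis by (simp add: e_def)
    qed
    let ?A = "{a. a \<le> N \<and> (1 \<in> D \<longrightarrow> 1 \<le> a)}"
    have A: "?A = {e..N}" by (auto simp: e_def)
    have "(\<Sum>cs\<in>dec_seqs (Suc n) N D. q ^ sum_list cs)
       = (\<Sum>a\<in>{e..N}. \<Sum>cs\<in>(#) a ` dec_seqs n (a - e) D'. q ^ sum_list cs)"
      unfolding Suc dec_seqs_Suc A[symmetric] unfolding Suc[symmetric]
      by (subst sum.UNION_disjoint) (auto simp: finite_dec_seqs e_def D'_def)
    also have "\<dots> = (\<Sum>a\<in>{e..N}. q ^ a * (q ^ (\<Sum>?D) * qbin q (a - e + n - card ?D) n))"
      by (rule sum.cong) (simp_all add: sum.reindex power_add sum_distrib_left[symmetric] ih)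
    also have "\<dots> = (\<Sum>a\<in>{e + card ?D..N}. q ^ a * (q ^ (\<Sum>?D) * qbin q (a - e + n - card ?D) n))"
    proof (rule sum.mono_neutral_right)
      show "\<forall>a\<in>{e..N} - {e + card ?D..N}. q ^ a * (q ^ (\<Sum>?D) * qbin q (a - e + n - card ?D) n) = 0"
      proof
        fix a assume "a \<in> {e..N} - {e + card ?D..N}"
        then have "a - e + n - card ?D < n" using Suc by auto
        then show "q ^ a * (q ^ (\<Sum>?D) * qbin q (a - e + n - card ?D) n) = 0" by (simp add: qbin_eq_0)
      qed
    qed auto
    also have "\<dots> = (\<Sum>b<Suc N - (e + card ?D). q ^ (b + (e + card ?D)) * (q ^ (\<Sum>?D) * qbin q (b + n) n))"
      by (rule sum.reindex_bij_witness[of _ "\<lambda>b. b + (e + card ?D)" "\<lambda>a. a - (e + card ?D)"])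
         (auto simp: algebra_simps)
    also have "\<dots> = q ^ (\<Sum>D) * (\<Sum>b<Suc N - (e + card ?D). q ^ b * qbin q (b + n) n)"
      by (simp add: sD sum_distrib_left power_add ac_simps)
    also have "(\<Sum>b<Suc N - (e + card ?D). q ^ b * qbin q (b + n) n) = qbin q (N + Suc n - card D) (Suc n)"
    proof (cases "e + card ?D \<le> Suc N")
      case True
      then show ?thesis unfolding qbin_hockey_stick cD by (simp add: algebra_simps)
    next
      case False
      then show ?thesis by (simp add: cD qbin_eq_0)
    qed
    finally show ?thesis .
  qed
qed simp

end

section \<open>Words and their contents\<close>

lemma lookup_single_mult:
  "Poly_Mapping.lookup (Poly_Mapping.single e c * p) (e + d) = c * Poly_Mapping.lookup p d"
  for p :: "('v \<Rightarrow>\<^sub>0 nat) \<Rightarrow>\<^sub>0 'k::comm_ring_1"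
proof -
  have "Poly_Mapping.single e c * p
      = (\<Sum>m\<in>Poly_Mapping.keys p. Poly_Mapping.single (e + m) (c * Poly_Mapping.lookup p m))"
    by (subst (1) sum_singles) (simp add: sum_distrib_left mult_single)
  then have "Poly_Mapping.lookup (Poly_Mapping.single e c * p) (e + d)
      = (\<Sum>m\<in>Poly_Mapping.keys p. if m = d then c * Poly_Mapping.lookup p m else 0)"
    by (simp add: lookup_sum lookup_single when_def)
  also have "\<dots> = c * Poly_Mapping.lookup p d" by (simp add: in_keys_iff)
  finally show ?thesis .
qed

text \<open>A content records how often each letter \<open>0, \<dots>, N\<close> occurs. Contents are extensional functions so that
  finite products of intervals enumerate them.\<close>

definition contents :: "nat \<Rightarrow> nat \<Rightarrow> (nat \<Rightarrow> nat) set" where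
  "contents N n = {m \<in> PiE {..N} (\<lambda>_. {..n}). (\<Sum>v\<le>N. m v) = n}"

definition expo :: "nat \<Rightarrow> (nat \<Rightarrow> nat) \<Rightarrow> nat \<Rightarrow>\<^sub>0 nat" where
  "expo N m = (\<Sum>v\<le>N. Poly_Mapping.single v (m v))"

definition below :: "nat \<Rightarrow> (nat \<Rightarrow> nat) \<Rightarrow> (nat \<Rightarrow> nat) set" where
  "below N m = PiE {..N} (\<lambda>v. {..m v})"

definition minus_content :: "nat \<Rightarrow> (nat \<Rightarrow> nat) \<Rightarrow> (nat \<Rightarrow> nat) \<Rightarrow> nat \<Rightarrow> nat" where
  "minus_content N m k = (\<lambda>v\<in>{..N}. m v - k v)"

definition wt :: "nat \<Rightarrow> (nat \<Rightarrow> nat) \<Rightarrow> nat" where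
  "wt N m = (\<Sum>v\<le>N. v * m v)"

text \<open>The diagonal coefficient: the coefficient of the monomial with exponent \<open>m\<close> in a product
  whose factors themselves depend on \<open>m\<close>.\<close>

definition diag_coeff :: "nat \<Rightarrow> (nat \<Rightarrow> nat \<Rightarrow> (nat \<Rightarrow>\<^sub>0 nat) \<Rightarrow>\<^sub>0 'k::comm_ring_1) \<Rightarrow> (nat \<Rightarrow> nat) \<Rightarrow> 'k" where
  "diag_coeff N B m = Poly_Mapping.lookup (\<Prod>v\<le>N. B v (m v)) (expo N m)"

definition content_series :: "'k::comm_ring_1 \<Rightarrow> nat \<Rightarrow> ((nat \<Rightarrow> nat) \<Rightarrow> 'k) \<Rightarrow> 'k fps" where
  "content_series Q N f = Abs_fps (\<lambda>n. \<Sum>m\<in>contents N n. Q ^ wt N m * f m)"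

abbreviation cst :: "'k::comm_ring_1 \<Rightarrow> (nat \<Rightarrow>\<^sub>0 nat) \<Rightarrow>\<^sub>0 'k" where
  "cst c \<equiv> Poly_Mapping.single 0 c"

abbreviation var :: "nat \<Rightarrow> (nat \<Rightarrow>\<^sub>0 nat) \<Rightarrow>\<^sub>0 'k::comm_ring_1" where
  "var v \<equiv> Poly_Mapping.single (Poly_Mapping.single v (Suc 0)) 1"

lemma cst_mult: "cst (a * b) = cst a * cst b" by (simp add: mult_single)
lemma cst_prod: "cst (\<Prod>v\<in>A. f v) = (\<Prod>v\<in>A. cst (f v))"
  by (induction A rule: infinite_finite_induct) (simp_all add: cst_mult)
lemma var_power: "var v ^ a = Poly_Mapping.single (Poly_Mapping.single v a) 1"
  by (induction a) (simp_all add: mult_single single_add[symmetric])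

lemma prod_var: "(\<Prod>v\<le>N. var v ^ k v) = Poly_Mapping.single (expo N k) (1::'k::comm_ring_1)"
proof -
  have "(\<Prod>v\<in>A. var v ^ k v) = Poly_Mapping.single (\<Sum>v\<in>A. Poly_Mapping.single v (k v)) (1::'k)" if "finite A" for A
    using that by (induction A) (simp_all add: var_power mult_single)
  then show ?thesis by (simp add: expo_def)
qed

lemma expo_split: "k \<in> below N m \<Longrightarrow> expo N m = expo N k + expo N (minus_content N m k)"
proof -
  assume k: "k \<in> below N m"
  then have "m v = k v + minus_content N m k v" if "v \<le> N" for v
    using that by (auto simp: below_def minus_content_def PiE_iff)
  then show ?thesis
    unfolding expo_def sum.distrib[symmetric] by (intro sum.cong) (simp_all add: single_add[symmetric])
qed

lemma finite_contents: "finite (contents N n)" and finite_below: "finite (below N m)"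
  by (auto simp: contents_def below_def intro!: finite_PiE)

text \<open>Although the factors depend on the exponent extracted, convolving with a product of functions of the
  single multiplicities can be carried out inside each factor.\<close>

lemma diag_coeff_convolution:
  "(\<Sum>k\<in>below N m. (\<Prod>v\<le>N. g (k v)) * diag_coeff N B (minus_content N m k))
    = Poly_Mapping.lookup (\<Prod>v\<le>N. \<Sum>a\<le>m v. cst (g a) * var v ^ a * B v (m v - a)) (expo N m)"
proof -
  have 1: "(\<Prod>v\<le>N. \<Sum>a\<le>m v. cst (g a) * var v ^ a * B v (m v - a))
    = (\<Sum>k\<in>below N m. \<Prod>v\<le>N. cst (g (k v)) * var v ^ k v * B v (m v - k v))"
    unfolding below_def by (rule prod_sum_PiE) auto
  have 2: "(\<Sum>k\<in>below N m. \<Prod>v\<le>N. cst (g (k v)) * var v ^ k v * B v (m v - k v))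
    = (\<Sum>k\<in>below N m. Poly_Mapping.single (expo N k) (\<Prod>v\<le>N. g (k v)) *
      (\<Prod>v\<le>N. B v (minus_content N m k v)))"
  proof (rule sum.cong)
    fix k assume "k \<in> below N m"
    have "(\<Prod>v\<le>N. cst (g (k v)) * var v ^ k v) = Poly_Mapping.single (expo N k) (\<Prod>v\<le>N. g (k v))"
      by (simp add: prod.distrib cst_prod[symmetric] prod_var mult_single)
    then show "(\<Prod>v\<le>N. cst (g (k v)) * var v ^ k v * B v (m v - k v))
      = Poly_Mapping.single (expo N k) (\<Prod>v\<le>N. g (k v)) * (\<Prod>v\<le>N. B v (minus_content N m k v))"
      by (simp add: prod.distrib minus_content_def)
  qed simp
  show ?thesis
    unfolding 1 2 lookup_sum
  proof (rule sum.cong)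
    fix k assume k: "k \<in> below N m"
    show "(\<Prod>v\<le>N. g (k v)) * diag_coeff N B (minus_content N m k)
      = Poly_Mapping.lookup (Poly_Mapping.single (expo N k) (\<Prod>v\<le>N. g (k v)) *
        (\<Prod>v\<le>N. B v (minus_content N m k v))) (expo N m)"
      unfolding expo_split[OF k] lookup_single_mult diag_coeff_def ..
  qed simp
qed

lemma content_series_convolution:
  "content_series Q N (\<lambda>m. \<Sum>k\<in>below N m. f k * h (minus_content N m k))
     = content_series Q N f * content_series Q N h"
proof (rule fps_ext)
  fix n
  let ?F = "\<lambda>k l. Q ^ wt N k * f k * (Q ^ wt N l * h l)"
  let ?add = "\<lambda>k l. (\<lambda>v\<in>{..N}. k v + l v)"
  have "fps_nth (content_series Q N (\<lambda>m. \<Sum>k\<in>below N m. f k * h (minus_content N m k))) n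
     = (\<Sum>(m, k)\<in>(SIGMA m:contents N n. below N m). ?F k (minus_content N m k))"
  proof -
    have "Q ^ wt N m * (f k * h (minus_content N m k)) = ?F k (minus_content N m k)" if "k \<in> below N m" for m k
    proof -
      have "m v = k v + minus_content N m k v" if "v \<le> N" for v
        using that \<open>k \<in> below N m\<close> by (auto simp: below_def minus_content_def PiE_iff)
      then have "wt N m = wt N k + wt N (minus_content N m k)"
        unfolding wt_def sum.distrib[symmetric] by (intro sum.cong) (simp_all add: distrib_left)
      then show ?thesis by (simp add: power_add ac_simps)
    qed
    then show ?thesis
      by (simp add: content_series_def sum_distrib_left sum.Sigma finite_contents finite_below)
  qed
  also have "\<dots> = (\<Sum>(i, k, l)\<in>(SIGMA i:{0..n}. contents N i \<times> contents N (n - i)). ?F k l)"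
  proof (rule sum.reindex_bij_witness[of _ "\<lambda>(i, k, l). (?add k l, k)"
        "\<lambda>(m, k). ((\<Sum>v\<le>N. k v), k, minus_content N m k)"], goal_cases)
    case (1 a)
    obtain m k where a: "a = (m, k)" "m \<in> contents N n" "k \<in> below N m" using 1 by auto
    have "(\<lambda>v\<in>{..N}. k v + minus_content N m k v) = m"
      using a by (auto simp: contents_def below_def minus_content_def PiE_iff fun_eq_iff extensional_def)
    then show ?case using a by simp
  next
    case (2 a)
    obtain m k where a: "a = (m, k)" "m \<in> contents N n" "k \<in> below N m" using 2 by auto
    have km: "k v \<le> m v" if "v \<le> N" for v using a that by (auto simp: below_def PiE_iff)
    have le: "(\<Sum>v\<le>N. k v) \<le> n" using a km by (auto simp: contents_def intro!: sum_mono)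
    have "(\<Sum>v\<le>N. m v - k v) = n - (\<Sum>v\<le>N. k v)"
      using a km by (subst sum_subtractf_nat) (auto simp: contents_def)
    then have s: "(\<Sum>v\<le>N. minus_content N m k v) = n - (\<Sum>v\<le>N. k v)" by (simp add: minus_content_def)
    have "k \<in> contents N (\<Sum>v\<le>N. k v)"
      using a member_le_sum[of _ "{..N}" k] by (auto simp: contents_def below_def PiE_iff)
    moreover have "minus_content N m k v \<le> n - (\<Sum>v\<le>N. k v)" if "v \<le> N" for v
      using member_le_sum[of v "{..N}" "minus_content N m k"] that s by simp
    then have "minus_content N m k \<in> contents N (n - (\<Sum>v\<le>N. k v))"
      using s by (auto simp: contents_def PiE_iff minus_content_def)
    ultimately show ?case using a le by auto
  next
    case (3 b)
    obtain i k l where b: "b = (i, k, l)" "i \<le> n" "k \<in> contents N i" "l \<in> contents N (n - i)" using 3 by auto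
    have "minus_content N (?add k l) k = l"
      using b by (auto simp: contents_def minus_content_def PiE_iff fun_eq_iff extensional_def)
    then show ?case using b by (auto simp: contents_def)
  next
    case (4 b)
    obtain i k l where b: "b = (i, k, l)" "i \<le> n" "k \<in> contents N i" "l \<in> contents N (n - i)" using 4 by auto
    have s: "(\<Sum>v\<le>N. k v + l v) = n" using b by (simp add: contents_def sum.distrib)
    then have "k v + l v \<le> n" if "v \<le> N" for v
      using member_le_sum[of v "{..N}" "\<lambda>v. k v + l v"] that by simp
    then have "?add k l \<in> contents N n" using s by (auto simp: contents_def PiE_iff)
    moreover have "k \<in> below N (?add k l)" using b by (auto simp: contents_def below_def PiE_iff)
    ultimately show ?case using b by auto
  qed auto
  also have "\<dots> = (\<Sum>i\<in>{0..n}. \<Sum>(k, l)\<in>contents N i \<times> contents N (n - i). ?F k l)"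
    by (rule sum.Sigma[symmetric]) (auto simp: finite_contents)
  also have "\<dots> = fps_nth (content_series Q N f * content_series Q N h) n"
    by (simp add: fps_mult_nth content_series_def sum_product sum.cartesian_product)
  finally show "fps_nth (content_series Q N (\<lambda>m. \<Sum>k\<in>below N m. f k * h (minus_content N m k))) n
    = fps_nth (content_series Q N f * content_series Q N h) n" .
qed

lemma contents_0: "contents N 0 = {\<lambda>v\<in>{..N}. 0}"
  by (auto simp: contents_def PiE_iff extensional_def fun_eq_iff)

lemma content_series_delta: "content_series Q N (\<lambda>m. if \<forall>v\<le>N. m v = 0 then c else 0) = fps_const c"
proof (rule fps_ext)
  fix n
  show "fps_nth (content_series Q N (\<lambda>m. if \<forall>v\<le>N. m v = 0 then c else 0)) n = fps_nth (fps_const c) n"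
  proof (cases n)
    case 0
    then show ?thesis by (simp add: content_series_def contents_0 wt_def)
  next
    case (Suc n')
    have "\<not> (\<forall>v\<le>N. m v = 0)" if "m \<in> contents N n" for m
    proof
      assume "\<forall>v\<le>N. m v = 0"
      then show False using that Suc by (simp add: contents_def)
    qed
    then have "(\<Sum>m\<in>contents N n. Q ^ wt N m * (if \<forall>v\<le>N. m v = 0 then c else 0)) = 0"
      by (intro sum.neutral ballI) (simp only: if_False mult_zero_right)
    then show ?thesis using Suc by (simp add: content_series_def)
  qed
qed

section \<open>The generating function of words by weak excedances\<close>

locale letter_sums =
  fixes t :: "'k::comm_ring_1" and N :: nat
begin

text \<open>A word in the letters \<open>0..N\<close> is written below its decreasing rearrangement; a letter \<open>u\<close> below
  \<open>v\<close> has weight \<open>1\<close> if \<open>u < v\<close>, weight \<open>t\<close> if \<open>u > v\<close>, and weight \<open>1 + t\<close> if \<open>u = v\<close>.\<close>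

definition Lsum :: "nat \<Rightarrow> (nat \<Rightarrow>\<^sub>0 nat) \<Rightarrow>\<^sub>0 'k" where
  "Lsum v = (\<Sum>u\<le>N. cst (of_bool (u \<le> v) + t * of_bool (v \<le> u)) * var u)"

text \<open>The letters below a block of \<open>a\<close> equal letters \<open>v\<close>: at the first position of the block the barred
  letter \<open>v\<close> is excluded.\<close>

definition first_block :: "nat \<Rightarrow> nat \<Rightarrow> (nat \<Rightarrow>\<^sub>0 nat) \<Rightarrow>\<^sub>0 'k" where
  "first_block v a = (case a of 0 \<Rightarrow> 1 | Suc b \<Rightarrow> (Lsum v - cst t * var v) * Lsum v ^ b)"

definition elem_coeff :: "'k \<Rightarrow> nat \<Rightarrow> 'k" where
  "elem_coeff s a = (if a = 0 then 1 else if a = 1 then - s else 0)"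

text \<open>In the alphabet where the letter \<open>v\<close> has weight \<open>Q ^ v\<close>, \<open>H\<close> and \<open>P\<close> are the generating series of
  complete and (signed) elementary symmetric functions. The series \<open>\<Omega>\<close> collects all words over
  decreasing sequences, and \<open>Z\<close> those whose bars mark the excedances of a
  permutation.\<close>

definition H :: "'k \<Rightarrow> 'k \<Rightarrow> 'k fps" where
  "H Q s = content_series Q N (\<lambda>m. \<Prod>v\<le>N. s ^ m v)"

definition P :: "'k \<Rightarrow> 'k \<Rightarrow> 'k fps" where
  "P Q s = content_series Q N (\<lambda>m. \<Prod>v\<le>N. elem_coeff s (m v))"

definition \<Omega> :: "'k \<Rightarrow> 'k fps" where
  "\<Omega> Q = content_series Q N (diag_coeff N (\<lambda>v a. Lsum v ^ a))"

definition Z :: "'k \<Rightarrow> 'k fps" where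
  "Z Q = content_series Q N (diag_coeff N first_block)"

lemma H_nth: "fps_nth (H Q s) n = s ^ n * fps_nth (H Q 1) n"
  by (auto simp: H_def content_series_def sum_distrib_left contents_def power_sum[symmetric] mult.left_commute
      intro!: sum.cong)

lemma elem_coeff_sum:
  "(\<Sum>a\<le>k. cst (elem_coeff s a) * var v ^ a * B (k - a)) = (if k = 0 then B 0 else B k - cst s * var v * B (k - 1))"
proof (cases k)
  case 0
  then show ?thesis by (simp add: elem_coeff_def)
next
  case (Suc l)
  have "(\<Sum>a\<le>k. cst (elem_coeff s a) * var v ^ a * B (k - a))
      = (\<Sum>a\<in>{0, 1}. cst (elem_coeff s a) * var v ^ a * B (k - a))"
    using Suc by (intro sum.mono_neutral_right) (auto simp: elem_coeff_def)
  also have "\<dots> = B k - cst s * var v * B (k - 1)"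
    by (simp add: elem_coeff_def single_uminus)
  finally show ?thesis using Suc by simp
qed

lemma P_H: "P Q s * H Q s = 1"
proof -
  define B where "B = (\<lambda>v a. cst (s ^ a) * var v ^ a)"
  have B: "diag_coeff N B m = (\<Prod>v\<le>N. s ^ m v)" for m
  proof -
    have "(\<Prod>v\<le>N. B v (m v)) = Poly_Mapping.single (expo N m) (\<Prod>v\<le>N. s ^ m v)"
      by (simp add: B_def prod.distrib cst_prod[symmetric] prod_var mult_single)
    then show ?thesis by (simp add: diag_coeff_def)
  qed
  have "(\<Sum>a\<le>k. cst (elem_coeff s a) * var v ^ a * B v (k - a)) = (if k = 0 then 1 else 0)" for k v
    unfolding elem_coeff_sum by (cases k) (simp_all add: B_def cst_mult ac_simps)
  moreover have "(\<Prod>v\<le>N. if m v = 0 then 1 else 0)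
      = (if \<forall>v\<le>N. m v = 0 then 1 else (0 :: (nat \<Rightarrow>\<^sub>0 nat) \<Rightarrow>\<^sub>0 'k))" for m :: "nat \<Rightarrow> nat"
  proof (cases "\<forall>v\<le>N. m v = 0")
    case False
    then have "\<exists>v\<in>{..N}. (if m v = 0 then 1 else (0 :: (nat \<Rightarrow>\<^sub>0 nat) \<Rightarrow>\<^sub>0 'k)) = 0" by auto
    then show ?thesis using False prod_zero[OF finite_atMost] by simp
  qed simp
  ultimately have "(\<Sum>k\<in>below N m. (\<Prod>v\<le>N. elem_coeff s (k v)) * diag_coeff N B (minus_content N m k))
      = (if \<forall>v\<le>N. m v = 0 then 1 else 0)" for m
    unfolding diag_coeff_convolution by (simp add: expo_def)
  then have "P Q s * content_series Q N (diag_coeff N B) = content_series Q N (\<lambda>m. if \<forall>v\<le>N. m v = 0 then 1 else 0)"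
    unfolding P_def content_series_convolution[symmetric] by simp
  moreover have "diag_coeff N B = (\<lambda>m. \<Prod>v\<le>N. s ^ m v)" by (rule ext) (rule B)
  ultimately show ?thesis by (simp add: H_def content_series_delta)
qed

text \<open>The power \<open>Lsum v ^ k\<close> is recovered from \<open>first_block\<close> by splitting off an initial run of barred
  letters \<open>v\<close> of length \<open>a\<close>, of weight \<open>t ^ a\<close>.\<close>

lemma H_Z: "H Q t * Z Q = \<Omega> Q"
proof -
  have "(\<Sum>a\<le>k. cst (t ^ a) * var v ^ a * first_block v (k - a)) = Lsum v ^ k" for k v
  proof (induction k)
    case (Suc k)
    have "(\<Sum>a\<le>Suc k. cst (t ^ a) * var v ^ a * first_block v (Suc k - a))
      = first_block v (Suc k) + cst t * var v * (\<Sum>a\<le>k. cst (t ^ a) * var v ^ a * first_block v (k - a))"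
      by (subst sum.atMost_Suc_shift) (simp add: sum_distrib_left cst_mult ac_simps)
    also have "\<dots> = Lsum v ^ Suc k" unfolding Suc by (simp add: first_block_def algebra_simps)
    finally show ?case .
  qed (simp add: first_block_def)
  then show ?thesis
    unfolding H_def Z_def \<Omega>_def content_series_convolution[symmetric] diag_coeff_convolution
    by (simp add: diag_coeff_def[abs_def])
qed

text \<open>Polynomials with no monomial supported on \<open>S\<close> form an ideal; modulo it, letters outside \<open>S\<close>
  vanish.\<close>

definition off :: "nat set \<Rightarrow> ((nat \<Rightarrow>\<^sub>0 nat) \<Rightarrow>\<^sub>0 'k) set" where
  "off S = {p. \<forall>e. Poly_Mapping.keys e \<subseteq> S \<longrightarrow> Poly_Mapping.lookup p e = 0}"

sublocale off: ring_ideal "off S" for S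
proof
  fix p c assume p: "p \<in> off S"
  have "Poly_Mapping.lookup (c * p) e = 0" if e: "Poly_Mapping.keys e \<subseteq> S" for e
  proof (rule ccontr)
    assume "Poly_Mapping.lookup (c * p) e \<noteq> 0"
    then have "e \<in> Poly_Mapping.keys (c * p)" by (simp add: in_keys_iff)
    then obtain a b where ab: "e = a + b" "b \<in> Poly_Mapping.keys p"
      using Poly_Mapping.keys_mult[of c p] by blast
    have "Poly_Mapping.keys b \<subseteq> Poly_Mapping.keys e" by (auto simp: ab in_keys_iff lookup_add)
    then show False using ab e p by (auto simp: off_def in_keys_iff)
  qed
  then show "c * p \<in> off S" by (auto simp: off_def)
qed (auto simp: off_def lookup_add)

lemma off_prod_cong:
  "(\<And>v. v \<in> A \<Longrightarrow> f v - g v \<in> off S) \<Longrightarrow> prod f A - prod g A \<in> off S"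
proof (induction A rule: infinite_finite_induct)
  case (insert v A)
  have "prod f (insert v A) - prod g (insert v A) = (f v - g v) * prod f A + g v * (prod f A - prod g A)"
    using insert by (simp add: algebra_simps)
  moreover have "f v - g v \<in> off S" "prod f A - prod g A \<in> off S" using insert by auto
  ultimately show ?case using off.I_add[OF off.I_mult2 off.I_mult] by simp
qed (auto simp: off.I_zero)

text \<open>Consecutive factors of the two products agree, so they differ only by one boundary factor each.\<close>

lemma telescoping_products:
  fixes x :: "nat \<Rightarrow> 'r::comm_ring_1"
  assumes "finite S" "S \<noteq> {}"
  shows "\<exists>R. (\<Prod>v\<in>S. \<alpha> + (\<Sum>u\<in>{u \<in> S. u < v}. x u) + s * (\<Sum>u\<in>{u \<in> S. v \<le> u}. x u)) = (\<alpha> + s * sum x S) * R \<and>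
    (\<Prod>v\<in>S. \<alpha> + (\<Sum>u\<in>{u \<in> S. u \<le> v}. x u) + s * (\<Sum>u\<in>{u \<in> S. v < u}. x u)) = (\<alpha> + sum x S) * R"
  using assms
proof (induction S arbitrary: \<alpha> rule: finite_linorder_max_induct)
  case (insert w S)
  show ?case
  proof (cases "S = {}")
    case True
    have "{u \<in> {w}. u \<le> w} = {w}" "{u \<in> {w}. w \<le> u} = {w}" by auto
    moreover have "sum x {u \<in> {w}. u < w} = 0" "sum x {u \<in> {w}. w < u} = 0" by (rule sum.neutral, auto)+
    ultimately show ?thesis unfolding True by (intro exI[of _ 1]) (simp del: singleton_iff insert_iff)
  next
    case False
    let ?\<beta> = "\<alpha> + s * x w"
    obtain R where R: "(\<Prod>v\<in>S. ?\<beta> + (\<Sum>u\<in>{u \<in> S. u < v}. x u) + s * (\<Sum>u\<in>{u \<in> S. v \<le> u}. x u)) = (?\<beta> + s * sum x S) * R"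
       "(\<Prod>v\<in>S. ?\<beta> + (\<Sum>u\<in>{u \<in> S. u \<le> v}. x u) + s * (\<Sum>u\<in>{u \<in> S. v < u}. x u)) = (?\<beta> + sum x S) * R"
      using insert.IH[OF False, of ?\<beta>] by blast
    have w: "w \<notin> S" using insert by auto
    have a: "\<alpha> + (\<Sum>u\<in>{u \<in> insert w S. u < v}. x u) + s * (\<Sum>u\<in>{u \<in> insert w S. v \<le> u}. x u)
       = ?\<beta> + (\<Sum>u\<in>{u \<in> S. u < v}. x u) + s * (\<Sum>u\<in>{u \<in> S. v \<le> u}. x u)" if "v \<in> S" for v
    proof -
      have "v < w" using insert that by auto
      then have "{u \<in> insert w S. u < v} = {u \<in> S. u < v}" "{u \<in> insert w S. v \<le> u} = insert w {u \<in> S. v \<le> u}" by auto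
      then show ?thesis using insert w by (simp add: algebra_simps)
    qed
    have b: "\<alpha> + (\<Sum>u\<in>{u \<in> insert w S. u \<le> v}. x u) + s * (\<Sum>u\<in>{u \<in> insert w S. v < u}. x u)
       = ?\<beta> + (\<Sum>u\<in>{u \<in> S. u \<le> v}. x u) + s * (\<Sum>u\<in>{u \<in> S. v < u}. x u)" if "v \<in> S" for v
    proof -
      have "v < w" using insert that by auto
      then have "{u \<in> insert w S. u \<le> v} = {u \<in> S. u \<le> v}" "{u \<in> insert w S. v < u} = insert w {u \<in> S. v < u}" by auto
      then show ?thesis using insert w by (simp add: algebra_simps)
    qed
    have c: "{u \<in> insert w S. u < w} = S" "{u \<in> insert w S. w \<le> u} = {w}"
      "{u \<in> insert w S. u \<le> w} = insert w S" "{u \<in> insert w S. w < u} = {}"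
      using insert by (auto simp: less_imp_le)
    have "(\<Prod>v\<in>insert w S. \<alpha> + (\<Sum>u\<in>{u \<in> insert w S. u < v}. x u) + s * (\<Sum>u\<in>{u \<in> insert w S. v \<le> u}. x u))
      = (\<alpha> + sum x S + s * x w) * ((?\<beta> + s * sum x S) * R)"
    proof -
      have "(\<Prod>v\<in>S. \<alpha> + (\<Sum>u\<in>{u \<in> insert w S. u < v}. x u) + s * (\<Sum>u\<in>{u \<in> insert w S. v \<le> u}. x u))
        = (?\<beta> + s * sum x S) * R" unfolding R(1)[symmetric] by (rule prod.cong[OF refl a])
      then show ?thesis unfolding prod.insert[OF insert.hyps(1) w] c by simp
    qed
    moreover have "(\<Prod>v\<in>insert w S. \<alpha> + (\<Sum>u\<in>{u \<in> insert w S. u \<le> v}. x u) + s * (\<Sum>u\<in>{u \<in> insert w S. v < u}. x u))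
      = (\<alpha> + (x w + sum x S)) * ((?\<beta> + sum x S) * R)"
    proof -
      have "(\<Prod>v\<in>S. \<alpha> + (\<Sum>u\<in>{u \<in> insert w S. u \<le> v}. x u) + s * (\<Sum>u\<in>{u \<in> insert w S. v < u}. x u))
        = (?\<beta> + sum x S) * R" unfolding R(2)[symmetric] by (rule prod.cong[OF refl b])
      then show ?thesis unfolding prod.insert[OF insert.hyps(1) w] c
        using insert.hyps(1) w by simp
    qed
    ultimately show ?thesis using insert w
      by (intro exI[of _ "(?\<beta> + sum x S) * R"]) (simp add: algebra_simps)
  qed
qed simp

lemma Lsum_restrict:
  assumes S: "S \<subseteq> {..N}" "v \<in> S"
  shows "Lsum v - var v - ((\<Sum>u\<in>{u \<in> S. u < v}. var u) + cst t * (\<Sum>u\<in>{u \<in> S. v \<le> u}. var u)) \<in> off S"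
    and "Lsum v - cst t * var v - ((\<Sum>u\<in>{u \<in> S. u \<le> v}. var u) + cst t * (\<Sum>u\<in>{u \<in> S. v < u}. var u)) \<in> off S"
proof -
  let ?c = "\<lambda>u. cst (of_bool (u \<le> v) + t * of_bool (v \<le> u)) * var u"
  have fin: "finite S" using S finite_subset by blast
  have "var u \<in> off S" if "u \<notin> S" for u
    using that by (auto simp: off_def lookup_single when_def)
  then have "(\<Sum>u\<in>{..N} - S. ?c u) \<in> off S" by (intro off.I_sum off.I_mult) auto
  moreover have "Lsum v = (\<Sum>u\<in>S. ?c u) + (\<Sum>u\<in>{..N} - S. ?c u)"
    unfolding Lsum_def using S by (subst sum.subset_diff[of S]) auto
  ultimately have L: "Lsum v - (\<Sum>u\<in>S. ?c u) \<in> off S" by simp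
  have split: "S = {u \<in> S. u < v} \<union> ({v} \<union> {u \<in> S. v < u})" using S by auto
  have e: "(\<Sum>u\<in>S. ?c u) = (\<Sum>u\<in>{u \<in> S. u < v}. var u) + (cst (1 + t) * var v + cst t * (\<Sum>u\<in>{u \<in> S. v < u}. var u))"
  proof -
    have "(\<Sum>u\<in>S. ?c u) = (\<Sum>u\<in>{u \<in> S. u < v}. ?c u) + ((\<Sum>u\<in>{v}. ?c u) + (\<Sum>u\<in>{u \<in> S. v < u}. ?c u))"
      using fin by (subst split, subst sum.union_disjoint, simp, simp, force, subst sum.union_disjoint) auto
    then show ?thesis by (simp add: sum_distrib_left)
  qed
  have s1: "(\<Sum>u\<in>{u \<in> S. v \<le> u}. var u) = var v + (\<Sum>u\<in>{u \<in> S. v < u}. (var u :: (nat \<Rightarrow>\<^sub>0 nat) \<Rightarrow>\<^sub>0 'k))"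
  proof -
    have "{u \<in> S. v \<le> u} = insert v {u \<in> S. v < u}" using S by auto
    then show ?thesis using fin by simp
  qed
  have s2: "(\<Sum>u\<in>{u \<in> S. u \<le> v}. var u) = var v + (\<Sum>u\<in>{u \<in> S. u < v}. (var u :: (nat \<Rightarrow>\<^sub>0 nat) \<Rightarrow>\<^sub>0 'k))"
  proof -
    have "{u \<in> S. u \<le> v} = insert v {u \<in> S. u < v}" using S by auto
    then show ?thesis using fin by simp
  qed
  have c1: "cst (1 + t) * var v = var v + cst t * var v"
    by (simp add: single_add distrib_right)
  show "Lsum v - var v - ((\<Sum>u\<in>{u \<in> S. u < v}. var u) + cst t * (\<Sum>u\<in>{u \<in> S. v \<le> u}. var u)) \<in> off S"
    using L unfolding e s1 c1 by (simp add: algebra_simps)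
  show "Lsum v - cst t * var v - ((\<Sum>u\<in>{u \<in> S. u \<le> v}. var u) + cst t * (\<Sum>u\<in>{u \<in> S. v < u}. var u)) \<in> off S"
    using L unfolding e s2 c1 by (simp add: algebra_simps)
qed

text \<open>A form of MacMahon's Master theorem for this weight. The products that arise from \<open>P Q 1\<close> and \<open>P Q t\<close> telescope:
  in the letters that occur, each factor \<open>Lsum v - t x\<^sub>v\<close> equals \<open>Lsum v' - x\<^sub>v'\<close> for the next
  letter \<open>v'\<close>.\<close>

theorem master_identity: "(P Q 1 - fps_const t * P Q t) * \<Omega> Q = fps_const (1 - t)"
proof -
  let ?F = "\<lambda>s m. \<Prod>v\<le>N. if m v = 0 then 1 else Lsum v ^ m v - cst s * var v * Lsum v ^ (m v - 1)"
  have PO: "P Q s * \<Omega> Q = content_series Q N (\<lambda>m. Poly_Mapping.lookup (?F s m) (expo N m))" for s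
    unfolding P_def \<Omega>_def content_series_convolution[symmetric] diag_coeff_convolution elem_coeff_sum power_0 ..
  have lin: "content_series Q N f - fps_const t * content_series Q N g = content_series Q N (\<lambda>m. f m - t * g m)" for f g
    by (rule fps_ext) (simp add: content_series_def sum_subtractf sum_distrib_left algebra_simps)
  have key: "Poly_Mapping.lookup (?F 1 m) (expo N m) - t * Poly_Mapping.lookup (?F t m) (expo N m)
      = (if \<forall>v\<le>N. m v = 0 then 1 - t else 0)" for m
  proof (cases "\<forall>v\<le>N. m v = 0")
    case True
    then show ?thesis by (simp add: expo_def)
  next
    case False
    define S where "S = {v. v \<le> N \<and> m v \<noteq> 0}"
    have S: "S \<subseteq> {..N}" "finite S" "S \<noteq> {}" using False by (auto simp: S_def)
    define G where "G = (\<Prod>v\<in>S. Lsum v ^ (m v - 1))"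
    have F: "?F s m = G * (\<Prod>v\<in>S. Lsum v - cst s * var v)" for s
    proof -
      have "?F s m = (\<Prod>v\<in>S. Lsum v ^ m v - cst s * var v * Lsum v ^ (m v - 1))"
        using S by (intro prod.mono_neutral_cong_right) (auto simp: S_def)
      also have "\<dots> = (\<Prod>v\<in>S. Lsum v ^ (m v - 1) * (Lsum v - cst s * var v))"
      proof (rule prod.cong)
        fix v assume "v \<in> S"
        then obtain a where "m v = Suc a" by (auto simp: S_def gr0_conv_Suc)
        then show "Lsum v ^ m v - cst s * var v * Lsum v ^ (m v - 1) = Lsum v ^ (m v - 1) * (Lsum v - cst s * var v)"
          by (simp add: algebra_simps)
      qed simp
      finally show ?thesis by (simp add: G_def prod.distrib)
    qed
    define M where "M v = (\<Sum>u\<in>{u \<in> S. u < v}. var u) + cst t * (\<Sum>u\<in>{u \<in> S. v \<le> u}. var u)" for v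
    define M' where "M' v = (\<Sum>u\<in>{u \<in> S. u \<le> v}. var u) + cst t * (\<Sum>u\<in>{u \<in> S. v < u}. var u)" for v
    obtain R where "prod M S = cst t * sum var S * R" "prod M' S = sum var S * R"
      using telescoping_products[OF S(2,3), of 0 var "cst t"] by (auto simp: M_def M'_def)
    then have MM: "prod M S - cst t * prod M' S = 0" by (simp add: mult.assoc)
    have 1: "(\<Prod>v\<in>S. Lsum v - cst 1 * var v) - prod M S \<in> off S"
      using Lsum_restrict(1)[OF S(1)] by (intro off_prod_cong) (simp add: M_def)
    have 2: "(\<Prod>v\<in>S. Lsum v - cst t * var v) - prod M' S \<in> off S"
      using Lsum_restrict(2)[OF S(1)] by (intro off_prod_cong) (simp add: M'_def)
    have "?F 1 m - cst t * ?F t m = G * (((\<Prod>v\<in>S. Lsum v - cst 1 * var v) - prod M S)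
       - cst t * ((\<Prod>v\<in>S. Lsum v - cst t * var v) - prod M' S)) + G * (prod M S - cst t * prod M' S)"
      unfolding F by (simp add: algebra_simps)
    also have "\<dots> \<in> off S" unfolding MM using 1 2 by (auto intro!: off.I_add off.I_mult off.I_diff off.I_zero)
    finally have "?F 1 m - cst t * ?F t m \<in> off S" .
    moreover have "Poly_Mapping.keys (expo N m) \<subseteq> S"
      by (auto simp: expo_def S_def in_keys_iff lookup_sum lookup_single when_def split: if_splits)
    ultimately have "Poly_Mapping.lookup (?F 1 m - cst t * ?F t m) (expo N m) = 0" by (auto simp: off_def)
    moreover have "Poly_Mapping.lookup (cst t * ?F t m) (expo N m) = t * Poly_Mapping.lookup (?F t m) (expo N m)"
      using lookup_single_mult[of 0 t "?F t m" "expo N m"] by (simp only: add_0)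
    ultimately show ?thesis by (simp only: lookup_minus False if_False)
  qed
  have "(P Q 1 - fps_const t * P Q t) * \<Omega> Q = P Q 1 * \<Omega> Q - fps_const t * (P Q t * \<Omega> Q)"
    by (simp only: left_diff_distrib mult.assoc)
  then show ?thesis unfolding PO lin key content_series_delta .
qed

theorem Z_equation: "(H Q t - fps_const t * H Q 1) * Z Q = fps_const (1 - t) * H Q 1"
proof -
  have "H Q t * ((H Q t - fps_const t * H Q 1) * Z Q)
      = (H Q t - fps_const t * H Q 1) * \<Omega> Q" by (simp add: H_Z[symmetric] ac_simps)
  also have "\<dots> = (P Q 1 * H Q 1) * H Q t * \<Omega> Q - fps_const t * (P Q t * H Q t) * H Q 1 * \<Omega> Q"
    unfolding P_H by (simp add: left_diff_distrib mult.assoc)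
  also have "\<dots> = ((P Q 1 - fps_const t * P Q t) * \<Omega> Q) * (H Q 1 * H Q t)"
    by (simp add: algebra_simps)
  also have "\<dots> = H Q t * (fps_const (1 - t) * H Q 1)" unfolding master_identity by (simp only: ac_simps)
  finally have "P Q t * H Q t * ((H Q t - fps_const t * H Q 1) * Z Q) = P Q t * H Q t * (fps_const (1 - t) * H Q 1)"
    by (simp add: mult.assoc)
  then show ?thesis by (simp add: P_H)
qed

end

section \<open>Permutations as words\<close>

text \<open>A variant of the descent set after Shareshian and Wachs: descents from an excedance to a
  non-excedance are dropped, and all steps from a non-excedance to an excedance are added.\<close>

definition dex :: "nat \<Rightarrow> (nat \<Rightarrow> nat) \<Rightarrow> nat set" where
  "dex n \<sigma> = {i \<in> {1..<n}. \<sigma> i > \<sigma> (Suc i) \<and> \<not> (i < \<sigma> i \<and> \<not> Suc i < \<sigma> (Suc i)) \<or>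
     \<not> i < \<sigma> i \<and> Suc i < \<sigma> (Suc i)}"

lemma permutes_in_interval: "\<sigma> permutes {1..n} \<Longrightarrow> i \<in> {1..n} \<Longrightarrow> \<sigma> i \<in> {1..n::nat}"
  using permutes_in_image by metis

lemma permutes_neq_Suc: "\<sigma> permutes A \<Longrightarrow> \<sigma> i \<noteq> \<sigma> (Suc i)"
  using permutes_inj by (metis injD n_not_Suc_n)

text \<open>Passing from the descents to \<open>dex\<close> moves each descent at the end of a run of excedances to
  the position before the run, so the sum drops by the length of the run.\<close>

lemma sum_dex:
  assumes \<sigma>: "\<sigma> permutes {1..n}"
  shows "\<Sum>(dex n \<sigma>) + exc n \<sigma> = maj n \<sigma>"
proof (cases "n = 0")
  case True
  then show ?thesis by (simp add: dex_def exc_def maj_def)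
next
  case False
  let ?e = "\<lambda>i. of_bool (i < \<sigma> i) :: int" and ?d = "\<lambda>i. of_bool (\<sigma> i > \<sigma> (Suc i)) :: int"
  have b: "of_bool (i \<in> dex n \<sigma>) = ?d i - ?e i + ?e (Suc i)" if "i \<in> {1..<n}" for i
    using that permutes_neq_Suc[OF \<sigma>, of i] by (auto simp: dex_def)
  have "m \<le> n \<Longrightarrow> (\<Sum>i\<in>{1..<m}. int i * of_bool (i \<in> dex n \<sigma>))
      = (\<Sum>i\<in>{1..<m}. int i * ?d i) - (\<Sum>i\<in>{1..<m}. ?e i) + (int m - 1) * ?e m" if "m \<ge> 1" for m
    using that
  proof (induction m rule: dec_induct)
    case (step m)
    then have "(\<Sum>i\<in>{1..<Suc m}. int i * of_bool (i \<in> dex n \<sigma>))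
      = (\<Sum>i\<in>{1..<m}. int i * ?d i) - (\<Sum>i\<in>{1..<m}. ?e i) + (int m - 1) * ?e m + int m * (?d m - ?e m + ?e (Suc m))"
      using b[of m] by simp
    also have "\<dots> = (\<Sum>i\<in>{1..<Suc m}. int i * ?d i) - (\<Sum>i\<in>{1..<Suc m}. ?e i) + (int (Suc m) - 1) * ?e (Suc m)"
      using step by (simp add: algebra_simps)
    finally show ?case .
  qed simp
  from this[of n] have "(\<Sum>i\<in>{1..<n}. int i * of_bool (i \<in> dex n \<sigma>))
      = (\<Sum>i\<in>{1..<n}. int i * ?d i) - (\<Sum>i\<in>{1..<n}. ?e i) + (int n - 1) * ?e n" using False by simp
  moreover have en: "?e n = 0" using permutes_in_interval[OF \<sigma>, of n] False by auto
  moreover have "(int n - 1) * ?e n = 0" unfolding en by simp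
  moreover have "(\<Sum>i\<in>{1..<n}. int i * of_bool (i \<in> dex n \<sigma>)) = int (\<Sum>(dex n \<sigma>))"
  proof -
    have "(\<Sum>i\<in>{1..<n}. int i * of_bool (i \<in> dex n \<sigma>)) = (\<Sum>i\<in>dex n \<sigma>. int i)"
      by (rule sum.mono_neutral_cong_right) (auto simp: dex_def)
    then show ?thesis by simp
  qed
  moreover have "(\<Sum>i\<in>{1..<n}. int i * ?d i) = int (maj n \<sigma>)"
  proof -
    have "(\<Sum>i\<in>{1..<n}. int i * ?d i) = (\<Sum>i\<in>{i \<in> {1..<n}. \<sigma> i > \<sigma> (Suc i)}. int i)"
      by (rule sum.mono_neutral_cong_right) auto
    then show ?thesis by (simp add: maj_def)
  qed
  moreover have "(\<Sum>i\<in>{1..<n}. ?e i) = int (exc n \<sigma>)"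
  proof -
    have "(\<Sum>i\<in>{1..<n}. ?e i) = (\<Sum>i\<in>{1..n}. ?e i)"
      using en by (intro sum.mono_neutral_left) auto
    also have "\<dots> = (\<Sum>i\<in>{i \<in> {1..n}. i < \<sigma> i}. 1)"
      by (rule sum.mono_neutral_cong_right) auto
    finally show ?thesis by (simp add: exc_def)
  qed
  ultimately have "int (\<Sum>(dex n \<sigma>)) = int (maj n \<sigma>) - int (exc n \<sigma>)" by linarith
  then show ?thesis by linarith
qed

lemma lookup_sum_singles:
  "finite A \<Longrightarrow> Poly_Mapping.lookup (\<Sum>j\<in>A. Poly_Mapping.single (f j) (Suc 0)) v
    = count (image_mset f (mset_set A)) v"
  by (induction A rule: finite_induct) (auto simp: lookup_add lookup_single)

lemma sum_singles_eq_iff: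
  assumes "finite A" "finite B"
  shows "(\<Sum>j\<in>A. Poly_Mapping.single (f j) (Suc 0)) = (\<Sum>j\<in>B. Poly_Mapping.single (g j) (Suc 0))
    \<longleftrightarrow> image_mset f (mset_set A) = image_mset g (mset_set B)"
  using lookup_sum_singles[OF assms(1), of f] lookup_sum_singles[OF assms(2), of g]
  by (metis multiset_eqI poly_mapping_eqI)

locale dec_function =
  fixes n N :: nat and c :: "nat \<Rightarrow> nat"
  assumes c_dec: "i \<in> {1..<n} \<Longrightarrow> c (Suc i) \<le> c i" and c_le: "i \<in> {1..n} \<Longrightarrow> c i \<le> N"
begin

lemma c_antimono:
  assumes "1 \<le> i" "i \<le> j" "j \<le> n"
  shows "c j \<le> c i"
  using assms(2,3)
proof (induction j rule: dec_induct)
  case (step j)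
  then show ?case using c_dec[of j] assms(1) by auto
qed simp

lemma set_upt1: "set [1..<Suc n] = {1..n}"
  by auto

text \<open>The sequences \<open>c\<close> compatible with \<open>\<sigma>\<close> are those counted by \<open>dec_seqs\<close> with strict descents at
  \<open>dex n \<sigma>\<close>.\<close>

definition compat :: "(nat \<Rightarrow> nat) \<Rightarrow> bool" where
  "compat \<sigma> \<longleftrightarrow> (\<forall>i\<in>{1..<n}. i \<in> dex n \<sigma> \<longrightarrow> c (Suc i) < c i)"

definition first :: "nat \<Rightarrow> bool" where
  "first j \<longleftrightarrow> j = 1 \<or> c (j - 1) \<noteq> c j"

text \<open>The letters that may stand at position \<open>j\<close>, below \<open>c j\<close>; the boolean marks a bar. A barred letter stems
  from an excedance, that is, from an earlier position and thus a larger or equal entry of \<open>c\<close>; at the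
  first position of a block it is strictly larger.\<close>

definition letters :: "nat \<Rightarrow> (nat \<times> bool) set" where
  "letters j = {(u, b). u \<le> N \<and> (if b then c j \<le> u \<and> \<not> (u = c j \<and> first j) else u \<le> c j)}"

definition base :: "nat \<Rightarrow>\<^sub>0 nat" where
  "base = (\<Sum>j\<in>{1..n}. Poly_Mapping.single (c j) (Suc 0))"

definition good_words :: "(nat \<Rightarrow> nat \<times> bool) set" where
  "good_words = {w \<in> PiE {1..n} letters. (\<Sum>j\<in>{1..n}. Poly_Mapping.single (fst (w j)) (Suc 0)) = base}"

text \<open>The \<open>j\<close>-th letter is the entry of \<open>c\<close> at the place where \<open>\<sigma>\<close> takes the value \<open>j\<close>, barred if that place is an
  excedance.\<close>

definition to_word :: "(nat \<Rightarrow> nat) \<Rightarrow> nat \<Rightarrow> nat \<times> bool" where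
  "to_word \<sigma> = (\<lambda>j\<in>{1..n}. (c ((inv_into UNIV \<sigma>) j), (inv_into UNIV \<sigma>) j < j))"

text \<open>An injective key: larger letters come first, barred before unbarred, ties by position.\<close>

definition key :: "(nat \<Rightarrow> nat \<times> bool) \<Rightarrow> nat \<Rightarrow> int" where
  "key w j = int j - int (Suc n) * int (2 * fst (w j) + of_bool (snd (w j)))"

lemma letter_code_eq: "2 * fst a + of_bool (snd a) = 2 * fst b + (of_bool (snd b) :: nat) \<longleftrightarrow> a = b"
  by (cases a; cases b) (auto simp: of_bool_def split: if_splits; presburger)

lemma key_less_iff:
  assumes "j \<in> {1..n}" "k \<in> {1..n}"
  shows "key w j < key w k \<longleftrightarrow> 2 * fst (w k) + of_bool (snd (w k)) < 2 * fst (w j) + (of_bool (snd (w j)) :: nat) \<or>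
    (w j = w k \<and> j < k)"
proof -
  define A where "A = 2 * fst (w j) + (of_bool (snd (w j)) :: nat)"
  define B where "B = 2 * fst (w k) + (of_bool (snd (w k)) :: nat)"
  have AB: "A = B \<longleftrightarrow> w j = w k"
    unfolding A_def B_def by (rule letter_code_eq)
  have key: "key w j = int j - int (Suc n) * int A" "key w k = int k - int (Suc n) * int B"
    by (simp_all add: key_def A_def B_def)
  have mono: "int (Suc n) * int a + int (Suc n) \<le> int (Suc n) * int b" if "a < b" for a b
  proof -
    have "int (Suc n) * (int a + 1) \<le> int (Suc n) * int b" using that by (intro mult_left_mono) auto
    then show ?thesis by (simp add: algebra_simps)
  qed
  consider "A = B" | "A < B" | "B < A" by linarith
  then show ?thesis
    unfolding A_def[symmetric] B_def[symmetric] AB[symmetric] key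
  proof cases
    case 2
    then show "int j - int (Suc n) * int A < int k - int (Suc n) * int B \<longleftrightarrow> B < A \<or> A = B \<and> j < k"
      using mono[OF 2] assms by auto
  next
    case 3
    then show "int j - int (Suc n) * int A < int k - int (Suc n) * int B \<longleftrightarrow> B < A \<or> A = B \<and> j < k"
      using mono[OF 3] assms by auto
  qed auto
qed

lemma key_inj: "inj_on (key w) {1..n}"
proof (rule inj_onI)
  fix j k assume "j \<in> {1..n}" "k \<in> {1..n}" "key w j = key w k"
  then show "j = k"
    using key_less_iff[of j k w] key_less_iff[of k j w] letter_code_eq[of "w j" "w k"]
    by (metis linorder_neqE_nat order_less_irrefl)
qed

lemma to_word_at: "\<sigma> permutes {1..n} \<Longrightarrow> i \<in> {1..n} \<Longrightarrow> to_word \<sigma> (\<sigma> i) = (c i, i < \<sigma> i)"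
  using permutes_in_interval[of \<sigma> n i] by (simp add: to_word_def permutes_inverses(2))

text \<open>Within a block of equal entries of \<open>c\<close>, compatibility forbids steps in \<open>dex\<close>; this says that the
  excedances come first and that values increase among the excedances and among the others, which is the
  order of the keys.\<close>

lemma compat_iff_key:
  assumes \<sigma>: "\<sigma> permutes {1..n}"
  shows "compat \<sigma> \<longleftrightarrow> (\<forall>i\<in>{1..<n}. key (to_word \<sigma>) (\<sigma> i) < key (to_word \<sigma>) (\<sigma> (Suc i)))"
  unfolding compat_def
proof (rule ball_cong[OF refl])
  fix i assume i: "i \<in> {1..<n}"
  have si: "\<sigma> i \<in> {1..n}" "\<sigma> (Suc i) \<in> {1..n}" using permutes_in_interval[OF \<sigma>] i by auto
  have w: "to_word \<sigma> (\<sigma> i) = (c i, i < \<sigma> i)" "to_word \<sigma> (\<sigma> (Suc i)) = (c (Suc i), Suc i < \<sigma> (Suc i))"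
    using to_word_at[OF \<sigma>] i by auto
  have cd: "c (Suc i) \<le> c i" using c_dec i by auto
  show "(i \<in> dex n \<sigma> \<longrightarrow> c (Suc i) < c i) \<longleftrightarrow> key (to_word \<sigma>) (\<sigma> i) < key (to_word \<sigma>) (\<sigma> (Suc i))"
  proof (cases "c (Suc i) = c i")
    case True
    then show ?thesis unfolding key_less_iff[OF si] w
      using i permutes_neq_Suc[OF \<sigma>, of i] by (auto simp: dex_def)
  next
    case False
    then have "2 * c (Suc i) + of_bool (Suc i < \<sigma> (Suc i)) < 2 * c i + (of_bool (i < \<sigma> i) :: nat)"
      using cd by (auto simp: of_bool_def)
    then show ?thesis unfolding key_less_iff[OF si] w using False cd by auto
  qed
qed

lemma mset_map_permutes: "\<sigma> permutes {1..n} \<Longrightarrow> mset (map \<sigma> [1..<Suc n]) = mset [1..<Suc n]"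
proof -
  assume \<sigma>: "\<sigma> permutes {1..n}"
  have "distinct (map \<sigma> [1..<Suc n])"
    using permutes_inj_on[OF \<sigma>] by (simp add: distinct_map)
  moreover have "set (map \<sigma> [1..<Suc n]) = set [1..<Suc n]"
    unfolding set_map set_upt1 by (rule permutes_image[OF \<sigma>])
  ultimately show ?thesis by (metis distinct_upt set_eq_iff_mset_eq_distinct)
qed

lemma compat_sort:
  assumes \<sigma>: "\<sigma> permutes {1..n}" and "compat \<sigma>"
  shows "sort_key (key (to_word \<sigma>)) [1..<Suc n] = map \<sigma> [1..<Suc n]"
proof (rule sort_key_inj_key_eq)
  show "mset [1..<Suc n] = mset (map \<sigma> [1..<Suc n])" using mset_map_permutes[OF \<sigma>] by simp
  show "inj_on (key (to_word \<sigma>)) (set [1..<Suc n])"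
    unfolding set_upt1 by (rule key_inj)
  show "sorted (map (key (to_word \<sigma>)) (map \<sigma> [1..<Suc n]))"
    using assms unfolding compat_iff_key[OF \<sigma>] sorted_iff_nth_Suc by (auto simp: less_imp_le simp del: upt_Suc)
qed

lemma to_word_good:
  assumes \<sigma>: "\<sigma> permutes {1..n}" and "compat \<sigma>"
  shows "to_word \<sigma> \<in> good_words"
  unfolding good_words_def
proof (intro CollectI conjI)
  show "to_word \<sigma> \<in> PiE {1..n} letters"
  proof (rule PiE_I)
    fix j assume j: "j \<in> {1..n}"
    define i where "i = (inv_into UNIV \<sigma>) j"
    have i: "i \<in> {1..n}" "\<sigma> i = j"
      using permutes_in_interval[OF permutes_inv[OF \<sigma>] j] permutes_inverses(1)[OF \<sigma>] by (auto simp: i_def)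
    have w: "to_word \<sigma> j = (c i, i < j)" using to_word_at[OF \<sigma> i(1)] i by simp
    show "to_word \<sigma> j \<in> letters j"
    proof (cases "i < j")
      case True
      then have cj: "c j \<le> c (j - 1)" "c (j - 1) \<le> c i" using i j by (auto intro!: c_antimono)
      then have "\<not> (c i = c j \<and> first j)" using True i by (auto simp: first_def)
      then show ?thesis using True cj i c_le by (auto simp: w letters_def)
    next
      case False
      then have "c i \<le> c j" using i j by (intro c_antimono) auto
      then show ?thesis using False i c_le by (auto simp: w letters_def)
    qed
  qed (auto simp: to_word_def)
  have "(\<Sum>j\<in>{1..n}. Poly_Mapping.single (fst (to_word \<sigma> j)) (Suc 0))
      = (\<Sum>i\<in>{1..n}. Poly_Mapping.single (fst (to_word \<sigma> (\<sigma> i))) (Suc 0))"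
    by (rule sum.permute[OF \<sigma>, unfolded comp_def])
  also have "\<dots> = base" unfolding base_def by (rule sum.cong) (simp_all add: to_word_at[OF \<sigma>])
  finally show "(\<Sum>j\<in>{1..n}. Poly_Mapping.single (fst (to_word \<sigma> j)) (Suc 0)) = base" .
qed

lemma to_word_inj: "inj_on to_word {\<sigma>. \<sigma> permutes {1..n} \<and> compat \<sigma>}"
proof (rule inj_onI)
  fix \<sigma> \<tau> assume *: "\<sigma> \<in> {\<sigma>. \<sigma> permutes {1..n} \<and> compat \<sigma>}" "\<tau> \<in> {\<sigma>. \<sigma> permutes {1..n} \<and> compat \<sigma>}"
    and eq: "to_word \<sigma> = to_word \<tau>"
  have m: "map \<sigma> [1..<Suc n] = map \<tau> [1..<Suc n]"
    using compat_sort[of \<sigma>] compat_sort[of \<tau>] * eq by auto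
  have "\<sigma> i = \<tau> i" if "i \<in> {1..n}" for i
    using arg_cong[OF m, of "\<lambda>l. l ! (i - 1)"] that by (auto simp del: upt_Suc)
  moreover have "\<sigma> i = \<tau> i" if "i \<notin> {1..n}" for i
    using * permutes_not_in[of \<sigma> "{1..n}" i] permutes_not_in[of \<tau> "{1..n}" i] that by auto
  ultimately show "\<sigma> = \<tau>" by blast
qed

text \<open>Conversely, reading the positions of a good word in the order of their keys gives a
  permutation; the restriction at the first position of each block makes exactly the barred letters
  excedances.\<close>

lemma to_word_surj:
  assumes w: "w \<in> good_words"
  obtains \<sigma> where "\<sigma> permutes {1..n}" "compat \<sigma>" "to_word \<sigma> = w"
proof -
  define ys where "ys = sort_key (key w) [1..<Suc n]"
  have ys: "set ys = {1..n}" "distinct ys" "length ys = n"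
    by (auto simp: ys_def)
  have srt: "sorted (map (key w) ys)" by (simp add: ys_def)
  define \<sigma> where "\<sigma> = (\<lambda>i. if i \<in> {1..n} then ys ! (i - 1) else i)"
  have "bij_betw \<sigma> {1..n} {1..n}"
  proof (rule bij_betwI')
    fix i k assume "i \<in> {1..n}" "k \<in> {1..n}"
    then show "(\<sigma> i = \<sigma> k) = (i = k)" using ys by (auto simp: \<sigma>_def nth_eq_iff_index_eq)
  next
    fix i assume "i \<in> {1..n}"
    then have "ys ! (i - 1) \<in> set ys" using ys by (intro nth_mem) auto
    then show "\<sigma> i \<in> {1..n}" using \<open>i \<in> {1..n}\<close> ys by (simp add: \<sigma>_def)
  next
    fix j assume "j \<in> {1..n}"
    then obtain k where "k < n" "ys ! k = j" using ys by (metis in_set_conv_nth)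
    then show "\<exists>i\<in>{1..n}. j = \<sigma> i" by (intro bexI[of _ "Suc k"]) (auto simp: \<sigma>_def)
  qed
  then have \<sigma>: "\<sigma> permutes {1..n}" by (rule bij_imp_permutes) (simp only: \<sigma>_def if_False)
  have step: "key w (\<sigma> i) < key w (\<sigma> (Suc i))" if i: "i \<in> {1..<n}" for i
  proof -
    have "map (key w) ys ! (i - 1) \<le> map (key w) ys ! i"
      using srt i ys unfolding sorted_iff_nth_mono by auto
    then have "key w (\<sigma> i) \<le> key w (\<sigma> (Suc i))" using i ys by (auto simp: \<sigma>_def)
    moreover have "key w (\<sigma> i) \<noteq> key w (\<sigma> (Suc i))"
      using inj_onD[OF key_inj, of w "\<sigma> i" "\<sigma> (Suc i)"] permutes_in_interval[OF \<sigma>] permutes_neq_Suc[OF \<sigma>, of i] i by auto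
    ultimately show ?thesis by simp
  qed
  have s: "\<sigma> i \<in> {1..n}" if "i \<in> {1..n}" for i using permutes_in_interval[OF \<sigma> that] .
  have step': "fst (w (\<sigma> (Suc i))) \<le> fst (w (\<sigma> i)) \<and>
     (fst (w (\<sigma> (Suc i))) = fst (w (\<sigma> i)) \<longrightarrow> (snd (w (\<sigma> (Suc i))) \<longrightarrow> snd (w (\<sigma> i)))) \<and>
     (w (\<sigma> (Suc i)) = w (\<sigma> i) \<longrightarrow> \<sigma> i < \<sigma> (Suc i))" if i: "i \<in> {1..<n}" for i
  proof -
    have si: "\<sigma> i \<in> {1..n}" "\<sigma> (Suc i) \<in> {1..n}" using s i by auto
    show ?thesis using step[OF i] unfolding key_less_iff[OF si]
      by (cases "snd (w (\<sigma> i))"; cases "snd (w (\<sigma> (Suc i)))") (auto simp: prod_eq_iff)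
  qed
  have wL: "w j \<in> letters j" if "j \<in> {1..n}" for j using w that by (auto simp: good_words_def)
  \<comment> \<open>Both \<open>c\<close> and the letters read in key order are weakly decreasing with the same multiset.\<close>
  have cw: "fst (w (\<sigma> i)) = c i" if "i \<in> {1..n}" for i
  proof -
    have ms: "image_mset (\<lambda>j. fst (w j)) (mset_set {1..n}) = image_mset c (mset_set {1..n})"
      using w by (simp add: good_words_def base_def sum_singles_eq_iff)
    have m1: "mset [1..<Suc n] = mset_set {1..n}"
      by (metis atLeastLessThanSuc_atLeastAtMost mset_upt)
    have "mset (map (\<lambda>i. fst (w (\<sigma> i))) [1..<Suc n]) = image_mset (\<lambda>j. fst (w j)) (mset (map \<sigma> [1..<Suc n]))"
      by (simp add: image_mset.compositionality comp_def)
    also have "\<dots> = image_mset (\<lambda>j. fst (w j)) (mset_set {1..n})"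
      by (simp only: mset_map_permutes[OF \<sigma>] m1)
    also have "\<dots> = mset (map c [1..<Suc n])" by (simp only: mset_map m1 ms)
    finally have "mset (rev (map (\<lambda>i. fst (w (\<sigma> i))) [1..<Suc n])) = mset (rev (map c [1..<Suc n]))" by simp
    moreover have "sorted (rev (map (\<lambda>i. fst (w (\<sigma> i))) [1..<Suc n]))"
      unfolding sorted_rev_iff_nth_Suc using step' by (auto simp del: upt_Suc)
    moreover have "sorted (rev (map c [1..<Suc n]))"
      unfolding sorted_rev_iff_nth_Suc using c_dec by (auto simp del: upt_Suc)
    ultimately have "rev (map (\<lambda>i. fst (w (\<sigma> i))) [1..<Suc n]) = rev (map c [1..<Suc n])"
      by (metis properties_for_sort)
    then have "map (\<lambda>i. fst (w (\<sigma> i))) [1..<Suc n] = map c [1..<Suc n]" by simp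
    from arg_cong[OF this, of "\<lambda>l. l ! (i - 1)"] show ?thesis
      using that by (auto simp del: upt_Suc map_eq_conv)
  qed
  have barred: "snd (w (\<sigma> i)) \<Longrightarrow> i < \<sigma> i" if "i \<ge> 1" "i \<le> n" for i
    using that
  proof (induction i rule: dec_induct)
    case base
    have l: "w (\<sigma> 1) \<in> letters (\<sigma> 1)" "fst (w (\<sigma> 1)) = c 1" using wL s cw base by auto
    show ?case
    proof (rule ccontr)
      assume "\<not> 1 < \<sigma> 1"
      then have "\<sigma> 1 = 1" using s[of 1] base by auto
      then show False using l base by (cases "w 1") (auto simp: letters_def first_def)
    qed
  next
    case (step i)
    let ?j = "\<sigma> (Suc i)"
    have j: "?j \<in> {1..n}" using s step by auto
    have l: "w ?j \<in> letters ?j" "fst (w ?j) = c (Suc i)" using wL[OF j] cw step by auto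
    show ?case
    proof (cases "c i = c (Suc i)")
      case True
      then have "snd (w (\<sigma> i))" "w ?j = w (\<sigma> i)"
        using step'[of i] cw[of i] cw[of "Suc i"] step by (auto simp: prod_eq_iff)
      then have "i < \<sigma> i" "\<sigma> i < ?j" using step step'[of i] by auto
      then show ?thesis by simp
    next
      case False
      have "c ?j \<le> c (Suc i)" "\<not> (c (Suc i) = c ?j \<and> first ?j)"
        using l step by (cases "w ?j"; auto simp: letters_def)+
      show ?thesis
      proof (rule ccontr)
        assume "\<not> Suc i < ?j"
        then consider "?j = Suc i" | "?j \<le> i" by linarith
        then show False
        proof cases
          case 1
          then show False using False \<open>\<not> (c (Suc i) = c ?j \<and> first ?j)\<close> by (auto simp: first_def)
        next
          case 2
          then have "c i \<le> c ?j" using j step by (intro c_antimono) auto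
          moreover have "c (Suc i) < c i" using False c_dec[of i] step by auto
          ultimately show False using \<open>c ?j \<le> c (Suc i)\<close> by simp
        qed
      qed
    qed
  qed
  have unbarred: "\<not> snd (w (\<sigma> i)) \<Longrightarrow> \<sigma> i \<le> i" if "i \<le> n" "i \<ge> 1" for i
    using that
  proof (induction i rule: inc_induct)
    case base
    then show ?case using s[of n] by auto
  next
    case (step i)
    have i: "i \<in> {1..<n}" using step by auto
    have j: "\<sigma> i \<in> {1..n}" using s i by auto
    have "c i \<le> c (\<sigma> i)" using wL[OF j] cw[of i] step i by (cases "w (\<sigma> i)") (auto simp: letters_def)
    show ?case
    proof (cases "c (Suc i) = c i")
      case True
      then have a: "\<not> snd (w (\<sigma> (Suc i)))" "w (\<sigma> (Suc i)) = w (\<sigma> i)"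
        using step'[OF i] cw[of i] cw[of "Suc i"] step.prems i by (auto simp: prod_eq_iff)
      have "\<sigma> (Suc i) \<le> Suc i" using step.IH a(1) by simp
      moreover have "\<sigma> i < \<sigma> (Suc i)" using step'[OF i] a(2) by blast
      ultimately show ?thesis by simp
    next
      case False
      show ?thesis
      proof (rule ccontr)
        assume "\<not> \<sigma> i \<le> i"
        then have "c (\<sigma> i) \<le> c (Suc i)" using j by (intro c_antimono) auto
        then show False using \<open>c i \<le> c (\<sigma> i)\<close> False c_dec[OF i] by simp
      qed
    qed
  qed
  have tw: "to_word \<sigma> = w"
  proof (rule ext)
    fix j
    show "to_word \<sigma> j = w j"
    proof (cases "j \<in> {1..n}")
      case True
      define i where "i = (inv_into UNIV \<sigma>) j"
      have i: "i \<in> {1..n}" "\<sigma> i = j"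
        using permutes_in_interval[OF permutes_inv[OF \<sigma>] True] permutes_inverses(1)[OF \<sigma>] by (auto simp: i_def)
      have "snd (w (\<sigma> i)) \<longleftrightarrow> i < \<sigma> i" using barred[of i] unbarred[of i] i by force
      then show ?thesis using to_word_at[OF \<sigma> i(1)] cw[OF i(1)] i by (simp add: prod_eq_iff)
    next
      case False
      have "w j = undefined" using w PiE_arb[OF _ False] by (auto simp: good_words_def)
      then show ?thesis using False by (simp only: to_word_def restrict_def if_False)
    qed
  qed
  have "compat \<sigma>" unfolding compat_iff_key[OF \<sigma>] tw using step by blast
  then show ?thesis using that \<sigma> tw by blast
qed

lemma exc_to_word:
  assumes \<sigma>: "\<sigma> permutes {1..n}"
  shows "exc n \<sigma> = card {j \<in> {1..n}. snd (to_word \<sigma> j)}"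
proof -
  have "bij_betw \<sigma> {i \<in> {1..n}. i < \<sigma> i} {j \<in> {1..n}. snd (to_word \<sigma> j)}"
  proof (rule bij_betw_byWitness[where f' = "inv_into UNIV \<sigma>"])
    show "\<sigma> ` {i \<in> {1..n}. i < \<sigma> i} \<subseteq> {j \<in> {1..n}. snd (to_word \<sigma> j)}"
      using to_word_at[OF \<sigma>] permutes_in_interval[OF \<sigma>] by auto
    show "(inv_into UNIV \<sigma>) ` {j \<in> {1..n}. snd (to_word \<sigma> j)} \<subseteq> {i \<in> {1..n}. i < \<sigma> i}"
    proof (intro image_subsetI)
      fix j assume j: "j \<in> {j \<in> {1..n}. snd (to_word \<sigma> j)}"
      define i where "i = inv_into UNIV \<sigma> j"
      have i: "i \<in> {1..n}" "\<sigma> i = j"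
        using permutes_in_interval[OF permutes_inv[OF \<sigma>], of j] j permutes_inverses(1)[OF \<sigma>] by (auto simp: i_def)
      then have "i < \<sigma> i" using to_word_at[OF \<sigma> i(1)] j by simp
      then show "inv_into UNIV \<sigma> j \<in> {i \<in> {1..n}. i < \<sigma> i}" using i(1) unfolding i_def by blast
    qed
  qed (simp_all add: permutes_inverses[OF \<sigma>])
  then show ?thesis unfolding exc_def by (rule bij_betw_same_card)
qed

theorem sum_compat_words:
  "(\<Sum>\<sigma> | \<sigma> permutes {1..n} \<and> compat \<sigma>. t ^ exc n \<sigma>)
    = (\<Sum>w\<in>good_words. t ^ card {j \<in> {1..n}. snd (w j)})"
proof (rule sum.reindex_cong[symmetric])
  show "inj_on to_word {\<sigma>. \<sigma> permutes {1..n} \<and> compat \<sigma>}" by (rule to_word_inj)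
  show "good_words = to_word ` {\<sigma>. \<sigma> permutes {1..n} \<and> compat \<sigma>}"
  proof (intro subset_antisym subsetI)
    fix w assume "w \<in> good_words"
    then obtain \<sigma> where "\<sigma> permutes {1..n}" "compat \<sigma>" "to_word \<sigma> = w" by (rule to_word_surj)
    then show "w \<in> to_word ` {\<sigma>. \<sigma> permutes {1..n} \<and> compat \<sigma>}" by blast
  qed (use to_word_good in auto)
qed (simp add: exc_to_word)

end

locale dec_letters = dec_function n N c + letter_sums t N
  for n N c and t :: "'k::comm_ring_1"
begin

definition block :: "nat \<Rightarrow> nat set" where "block v = {j \<in> {1..n}. c j = v}"

definition content :: "nat \<Rightarrow> nat" where "content = (\<lambda>v\<in>{..N}. card (block v))"

definition factor :: "nat \<Rightarrow> (nat \<Rightarrow>\<^sub>0 nat) \<Rightarrow>\<^sub>0 'k" where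
  "factor j = (if first j then Lsum (c j) - cst t * var (c j) else Lsum (c j))"

lemma c_image: "c ` {1..n} \<subseteq> {..N}" using c_le by auto

lemma expo_content: "expo N content = base"
proof -
  have s: "(\<Sum>j\<in>A. Poly_Mapping.single v (Suc 0)) = Poly_Mapping.single v (card A)" if "finite A" for A :: "nat set" and v :: nat
    using that by (induction A) (simp_all add: single_add[symmetric] del: sum_constant)
  have "base = (\<Sum>v\<le>N. \<Sum>j\<in>{j \<in> {1..n}. c j = v}. Poly_Mapping.single (c j) (Suc 0))"
    unfolding base_def by (rule sum.group[symmetric]) (use c_image in auto)
  also have "\<dots> = (\<Sum>v\<le>N. \<Sum>j\<in>block v. Poly_Mapping.single v (Suc 0))"
    unfolding block_def by (intro sum.cong) auto
  also have "\<dots> = expo N content"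
    unfolding expo_def by (rule sum.cong) (simp_all add: s block_def content_def del: sum_constant)
  finally show ?thesis ..
qed

lemma block_prod: "(\<Prod>j\<in>block v. factor j) = first_block v (card (block v))"
proof (cases "block v = {}")
  case True
  then show ?thesis by (simp add: first_block_def)
next
  case False
  have fin: "finite (block v)" by (simp add: block_def)
  define j0 where "j0 = Min (block v)"
  have j0: "j0 \<in> block v" "\<And>j. j \<in> block v \<Longrightarrow> j0 \<le> j" using False fin by (auto simp: j0_def)
  have f0: "first j0"
  proof (rule ccontr)
    assume "\<not> first j0"
    then have "j0 - 1 \<in> block v" using j0 by (auto simp: first_def block_def)
    then show False using j0(2)[of "j0 - 1"] j0(1) by (auto simp: block_def)
  qed
  have nf: "\<not> first j" if "j \<in> block v - {j0}" for j
  proof -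
    have "j0 < j" using j0(2)[of j] that by auto
    moreover have "1 \<le> j0" "j \<le> n" using j0(1) that by (auto simp: block_def)
    ultimately have "c j \<le> c (j - 1)" "c (j - 1) \<le> c j0" by (intro c_antimono; simp)+
    then show ?thesis using \<open>j0 < j\<close> j0(1) that by (auto simp: first_def block_def)
  qed
  have "(\<Prod>j\<in>block v. factor j) = factor j0 * (\<Prod>j\<in>block v - {j0}. factor j)"
    using fin j0 by (intro prod.remove)
  also have "(\<Prod>j\<in>block v - {j0}. factor j) = (\<Prod>j\<in>block v - {j0}. Lsum v)"
    using nf by (intro prod.cong) (auto simp: factor_def block_def)
  also have "\<dots> = Lsum v ^ (card (block v) - 1)" using fin j0 by simp
  also have "factor j0 = Lsum v - cst t * var v" using f0 j0 by (simp add: factor_def block_def)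
  finally show ?thesis using False fin by (cases "card (block v)") (auto simp: first_block_def)
qed

lemma prod_factor: "(\<Prod>j\<in>{1..n}. factor j) = (\<Prod>v\<le>N. first_block v (content v))"
proof -
  have "(\<Prod>j\<in>{1..n}. factor j) = (\<Prod>v\<le>N. \<Prod>j\<in>{j \<in> {1..n}. c j = v}. factor j)"
    by (rule prod.group[symmetric]) (use c_image in auto)
  also have "\<dots> = (\<Prod>v\<le>N. first_block v (content v))"
    by (rule prod.cong) (simp_all only: block_def[symmetric] block_prod content_def restrict_apply if_True)
  finally show ?thesis .
qed

lemma factor_eq_sum:
  assumes "j \<in> {1..n}"
  shows "factor j = (\<Sum>l\<in>letters j. cst (if snd l then t else 1) * var (fst l))"
proof -
  let ?U = "{u. u \<le> N \<and> u \<le> c j}" and ?B = "{u. u \<le> N \<and> c j \<le> u}" and ?F = "{u. u = c j \<and> first j}"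
  have l: "letters j = (\<lambda>u. (u, False)) ` ?U \<union> (\<lambda>u. (u, True)) ` (?B - ?F)"
    by (auto simp: letters_def split: if_splits)
  have "(\<Sum>l\<in>letters j. cst (if snd l then t else 1) * var (fst l))
      = (\<Sum>u\<in>?U. var u) + (\<Sum>u\<in>?B - ?F. cst t * var u)"
    unfolding l by (subst sum.union_disjoint) (auto simp: sum.reindex inj_on_def)
  also have "(\<Sum>u\<in>?B - ?F. cst t * var u) = (\<Sum>u\<in>?B. cst t * var u) - (\<Sum>u\<in>?F. cst t * var u)"
    using assms c_le by (intro sum_diff) auto
  also have "(\<Sum>u\<in>?F. cst t * var u) = (if first j then cst t * var (c j) else 0)" by simp
  also have "Lsum (c j) = (\<Sum>u\<in>?U. var u) + (\<Sum>u\<in>?B. cst t * var u)"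
  proof -
    have "Lsum (c j) = (\<Sum>u\<le>N. of_bool (u \<le> c j) * var u) + (\<Sum>u\<le>N. of_bool (c j \<le> u) * (cst t * var u))"
      unfolding Lsum_def sum.distrib[symmetric]
      by (rule sum.cong) (auto simp: single_add distrib_right)
    also have "(\<Sum>u\<le>N. of_bool (u \<le> c j) * var u) = (\<Sum>u\<in>?U. (var u :: (nat \<Rightarrow>\<^sub>0 nat) \<Rightarrow>\<^sub>0 'k))"
      by (rule sum.mono_neutral_cong_right) auto
    also have "(\<Sum>u\<le>N. of_bool (c j \<le> u) * (cst t * var u)) = (\<Sum>u\<in>?B. cst t * var u)"
      by (rule sum.mono_neutral_cong_right) auto
    finally show ?thesis .
  qed
  then show ?thesis by (simp add: factor_def calculation)
qed

lemma finite_letters: "finite (letters j)"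
  by (rule finite_subset[of _ "{..N} \<times> UNIV"]) (auto simp: letters_def)

text \<open>The letters at the positions of a word are chosen independently, except that their total content is
  prescribed; this is the coefficient of a product.\<close>

theorem compat_sum_eq_diag_coeff:
  "(\<Sum>\<sigma> | \<sigma> permutes {1..n} \<and> compat \<sigma>. t ^ exc n \<sigma>) = diag_coeff N first_block content"
proof -
  let ?e = "\<lambda>w. \<Sum>j\<in>{1..n}. Poly_Mapping.single (fst (w j :: nat \<times> bool)) (Suc 0)"
  let ?W = "PiE {1..n} letters"
  have trm: "(\<Prod>j\<in>{1..n}. cst (if snd (w j) then t else 1) * var (fst (w j)))
      = Poly_Mapping.single (?e w) (t ^ card {j \<in> {1..n}. snd (w j)})" for w :: "nat \<Rightarrow> nat \<times> bool"
  proof -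
    have "(\<Prod>j\<in>A. cst (g j) * var (fst (w j)))
        = Poly_Mapping.single (\<Sum>j\<in>A. Poly_Mapping.single (fst (w j)) (Suc 0)) (\<Prod>j\<in>A. g j)"
      if "finite A" for A and g :: "nat \<Rightarrow> 'k"
      using that by (induction A) (simp_all add: mult_single)
    moreover have "(\<Prod>j\<in>{1..n}. if snd (w j) then t else 1) = t ^ card {j \<in> {1..n}. snd (w j)}"
    proof -
      have "(\<Prod>j\<in>{1..n}. if snd (w j) then t else 1) = (\<Prod>j\<in>{j \<in> {1..n}. snd (w j)}. t)"
        by (rule prod.mono_neutral_cong_right) auto
      then show ?thesis by simp
    qed
    ultimately show ?thesis by (simp only: finite_atLeastAtMost)
  qed
  have "diag_coeff N first_block content = Poly_Mapping.lookup (\<Prod>j\<in>{1..n}. factor j) base"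
    by (simp only: diag_coeff_def expo_content prod_factor)
  also have "(\<Prod>j\<in>{1..n}. factor j) = (\<Prod>j\<in>{1..n}. \<Sum>l\<in>letters j. cst (if snd l then t else 1) * var (fst l))"
    by (rule prod.cong[OF refl factor_eq_sum])
  also have "\<dots> = (\<Sum>w\<in>?W. Poly_Mapping.single (?e w) (t ^ card {j \<in> {1..n}. snd (w j)}))"
    unfolding trm[symmetric] by (rule prod_sum_PiE) (auto simp: finite_letters)
  also have "Poly_Mapping.lookup \<dots> base = (\<Sum>w\<in>?W. (t ^ card {j \<in> {1..n}. snd (w j)} when ?e w = base))"
    by (simp only: lookup_sum lookup_single)
  also have "\<dots> = (\<Sum>w\<in>good_words. t ^ card {j \<in> {1..n}. snd (w j)})"
    unfolding good_words_def
    by (rule sum.mono_neutral_cong_right) (auto simp: when_def finite_letters intro!: finite_PiE)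
  finally show ?thesis unfolding sum_compat_words ..
qed

end

section \<open>The bounded generating function of permutations\<close>

lemma fps_const_sum: "fps_const (sum f A) = (\<Sum>i\<in>A. fps_const (f i :: 'a::comm_ring_1))"
  by (induction A rule: infinite_finite_induct) (simp_all add: fps_const_add[symmetric] del: fps_const_add)

lemma card_positions: "card {j \<in> {1..length cs}. cs ! (j - 1) = v} = count_list cs v"
proof -
  have "card {j \<in> {1..length cs}. cs ! (j - 1) = v} = card {i. i < length cs \<and> cs ! i = v}"
    by (rule bij_betw_same_card[of "\<lambda>j. j - 1"], rule bij_betw_byWitness[where f' = Suc]) auto
  also have "{i. i < length cs \<and> cs ! i = v} = {i. i < length cs \<and> v = cs ! i}" by blast
  finally show ?thesis unfolding count_list_eq_length_filter length_filter_conv_card .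
qed

lemma dec_seqs_contents:
  "bij_betw (\<lambda>cs. \<lambda>v\<in>{..N}. count_list cs v) (dec_seqs n N {}) (contents N n)"
proof (rule bij_betwI')
  fix cs ds assume cs: "cs \<in> dec_seqs n N {}" "ds \<in> dec_seqs n N {}"
  show "((\<lambda>v\<in>{..N}. count_list cs v) = (\<lambda>v\<in>{..N}. count_list ds v)) = (cs = ds)"
  proof
    assume eq: "(\<lambda>v\<in>{..N}. count_list cs v) = (\<lambda>v\<in>{..N}. count_list ds v)"
    have "count_list cs v = count_list ds v" for v
    proof (cases "v \<le> N")
      case True
      then show ?thesis using fun_cong[OF eq, of v] by simp
    next
      case False
      then have "v \<notin> set cs" "v \<notin> set ds" using cs by (auto simp: dec_seqs_def)
      then show ?thesis by (simp add: count_notin)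
    qed
    then have "mset (rev cs) = mset (rev ds)"
      by (intro multiset_eqI) (simp add: count_mset count_list_eq_length_filter)
    moreover have "sorted (rev cs)" "sorted (rev ds)"
      using cs by (auto simp: dec_seqs_def sorted_wrt_rev)
    ultimately have "rev cs = rev ds" by (metis properties_for_sort)
    then show "cs = ds" by simp
  qed simp
next
  fix cs assume cs: "cs \<in> dec_seqs n N {}"
  then have s: "set cs \<subseteq> {..N}" "length cs = n" by (auto simp: dec_seqs_def)
  have "(\<Sum>v\<le>N. count_list cs v) = n" using sum_count_set[OF s(1)] s by simp
  moreover have "count_list cs v \<le> n" for v using count_le_length[of cs v] s by simp
  ultimately show "(\<lambda>v\<in>{..N}. count_list cs v) \<in> contents N n" by (auto simp: contents_def)
next
  fix m assume m: "m \<in> contents N n"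
  define M where "M = (\<Sum>v\<le>N. replicate_mset (m v) v)"
  have cM: "count M v = (if v \<le> N then m v else 0)" for v
    by (simp add: M_def count_sum)
  define cs where "cs = rev (sorted_list_of_multiset M)"
  have "size M = n" using m by (simp add: M_def contents_def size_multiset_sum)
  then have "length cs = n" by (metis cs_def length_rev mset_sorted_list_of_multiset size_mset)
  moreover have "set cs \<subseteq> {..N}"
    using cM by (auto simp: cs_def count_greater_zero_iff[symmetric] split: if_splits simp del: count_greater_zero_iff)
  moreover have "sorted_wrt (\<ge>) cs" by (simp add: cs_def sorted_wrt_rev)
  ultimately have "cs \<in> dec_seqs n N {}" by (simp add: dec_seqs_def)
  moreover have "count_list cs v = count M v" for v
    by (metis cs_def count_mset count_list_eq_length_filter mset_rev mset_sorted_list_of_multiset)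
  then have "(\<lambda>v\<in>{..N}. count_list cs v) = m"
    using m cM by (auto simp: contents_def fun_eq_iff PiE_iff extensional_def)
  ultimately show "\<exists>cs\<in>dec_seqs n N {}. m = (\<lambda>v\<in>{..N}. count_list cs v)" by blast
qed

lemma content_series_nth:
  "fps_nth (content_series Q N f) n = (\<Sum>cs\<in>dec_seqs n N {}. Q ^ sum_list cs * f (\<lambda>v\<in>{..N}. count_list cs v))"
proof -
  have "wt N (\<lambda>v\<in>{..N}. count_list cs v) = sum_list cs" if "cs \<in> dec_seqs n N {}" for cs
    using sum_list_map_eq_sum_count2[of cs "{..N}" "\<lambda>x. x"] that by (simp add: dec_seqs_def wt_def mult.commute)
  then show ?thesis
    unfolding content_series_def fps_nth_Abs_fps
    by (subst sum.reindex_bij_betw[OF dec_seqs_contents, symmetric]) (auto intro!: sum.cong)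
qed

context base_q begin

lemma sum_dec_seqs_all:
  "D \<subseteq> {1..<n} \<Longrightarrow> (\<Sum>cs\<in>dec_seqs n N D. q ^ sum_list cs) = q ^ (\<Sum>D) * qbin q (N + n - card D) n"
proof (cases n)
  case 0
  assume "D \<subseteq> {1..<n}"
  moreover have "dec_seqs 0 N D = {[]}" by (auto simp: dec_seqs_def)
  ultimately show ?thesis using 0 by simp
qed (use sum_dec_seqs[of D n N] in simp)

theorem H_nth_qbin: "fps_nth (letter_sums.H N (fps_const q) 1) n = (fps_const (qbin q (N + n) n) :: rat fps)"
proof -
  have "fps_nth (letter_sums.H N (fps_const q) 1) n = (\<Sum>cs\<in>dec_seqs n N {}. fps_const q ^ sum_list cs :: rat fps)"
    by (simp add: letter_sums.H_def content_series_nth)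
  also have "\<dots> = fps_const (\<Sum>cs\<in>dec_seqs n N {}. q ^ sum_list cs)"
    by (simp add: fps_const_power fps_const_sum[symmetric])
  also have "(\<Sum>cs\<in>dec_seqs n N {}. q ^ sum_list cs) = qbin q (N + n) n"
    using sum_dec_seqs_all[of "{}" n N] by simp
  finally show ?thesis .
qed

text \<open>Summing over the sequences first, for each permutation.\<close>

theorem Z_nth:
  "fps_nth (letter_sums.Z fps_X N (fps_const q)) n
    = (\<Sum>\<sigma> | \<sigma> permutes {1..n}. fps_X ^ exc n \<sigma> * fps_const (q ^ \<Sum>(dex n \<sigma>) * qbin q (N + n - card (dex n \<sigma>)) n))"
proof -
  let ?P = "{\<sigma>. \<sigma> permutes {1..n}}"
  let ?ok = "\<lambda>cs \<sigma>. \<forall>i\<in>{1..<n}. i \<in> dex n \<sigma> \<longrightarrow> cs ! (Suc i - 1) < cs ! (i - 1)"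
  have ok: "cs \<in> dec_seqs n N (dex n \<sigma>) \<longleftrightarrow> cs \<in> dec_seqs n N {} \<and> ?ok cs \<sigma>" for cs \<sigma>
  proof -
    have "(\<forall>i. Suc i < n \<longrightarrow> Suc i \<in> dex n \<sigma> \<longrightarrow> cs ! Suc i < cs ! i) \<longleftrightarrow> ?ok cs \<sigma>"
    proof (intro iffI allI ballI impI)
      fix i assume *: "\<forall>i. Suc i < n \<longrightarrow> Suc i \<in> dex n \<sigma> \<longrightarrow> cs ! Suc i < cs ! i" "i \<in> {1..<n}" "i \<in> dex n \<sigma>"
      then show "cs ! (Suc i - 1) < cs ! (i - 1)" by (cases i) auto
    next
      fix i assume *: "?ok cs \<sigma>" "Suc i < n" "Suc i \<in> dex n \<sigma>"
      then show "cs ! Suc i < cs ! i" using bspec[OF *(1), of "Suc i"] by auto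
    qed
    then show ?thesis by (auto simp: dec_seqs_def)
  qed
  have blk: "diag_coeff N (letter_sums.first_block fps_X N) (\<lambda>v\<in>{..N}. count_list cs v)
      = (\<Sum>\<sigma> | \<sigma> permutes {1..n} \<and> ?ok cs \<sigma>. fps_X ^ exc n \<sigma> :: rat fps)" if cs: "cs \<in> dec_seqs n N {}" for cs
  proof -
    have len: "length cs = n" "sorted_wrt (\<ge>) cs" "set cs \<subseteq> {..N}" using cs by (auto simp: dec_seqs_def)
    interpret dec_letters n N "\<lambda>i. cs ! (i - 1)" "fps_X :: rat fps"
    proof unfold_locales
      fix i
      show "cs ! (Suc i - 1) \<le> cs ! (i - 1)" if "i \<in> {1..<n}"
        using sorted_wrt_nth_less[OF len(2), of "i - 1" i] that len by auto
      show "cs ! (i - 1) \<le> N" if "i \<in> {1..n}"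
      proof -
        have "cs ! (i - 1) \<in> set cs" using that len by (intro nth_mem) auto
        then show ?thesis using len by auto
      qed
    qed
    have "content = (\<lambda>v\<in>{..N}. count_list cs v)"
      unfolding content_def block_def using card_positions[of cs] len by simp
    then show ?thesis using compat_sum_eq_diag_coeff unfolding compat_def by simp
  qed
  have "fps_nth (letter_sums.Z fps_X N (fps_const q)) n
     = (\<Sum>cs\<in>dec_seqs n N {}. \<Sum>\<sigma> | \<sigma> \<in> ?P \<and> ?ok cs \<sigma>. fps_const q ^ sum_list cs * fps_X ^ exc n \<sigma>)"
    unfolding letter_sums.Z_def content_series_nth by (intro sum.cong) (auto simp: blk sum_distrib_left)
  also have "\<dots> = (\<Sum>\<sigma>\<in>?P. \<Sum>cs | cs \<in> dec_seqs n N {} \<and> ?ok cs \<sigma>. fps_const q ^ sum_list cs * fps_X ^ exc n \<sigma>)"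
    by (rule sum.swap_restrict) (auto simp: finite_dec_seqs finite_permutations)
  also have "\<dots> = (\<Sum>\<sigma>\<in>?P. fps_X ^ exc n \<sigma> * fps_const (q ^ \<Sum>(dex n \<sigma>) * qbin q (N + n - card (dex n \<sigma>)) n))"
  proof (rule sum.cong)
    fix \<sigma> assume "\<sigma> \<in> ?P"
    have D: "dex n \<sigma> \<subseteq> {1..<n}" by (auto simp: dex_def)
    have "(\<Sum>cs | cs \<in> dec_seqs n N {} \<and> ?ok cs \<sigma>. fps_const q ^ sum_list cs * fps_X ^ exc n \<sigma>)
        = (\<Sum>cs\<in>dec_seqs n N (dex n \<sigma>). fps_const (q ^ sum_list cs)) * fps_X ^ exc n \<sigma>"
      unfolding sum_distrib_right using ok by (intro sum.cong) (auto simp: fps_const_power)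
    also have "(\<Sum>cs\<in>dec_seqs n N (dex n \<sigma>). fps_const (q ^ sum_list cs))
        = fps_const (q ^ \<Sum>(dex n \<sigma>) * qbin q (N + n - card (dex n \<sigma>)) n)"
      using sum_dec_seqs_all[OF D, of N] by (simp add: fps_const_sum[symmetric])
    finally show "(\<Sum>cs | cs \<in> dec_seqs n N {} \<and> ?ok cs \<sigma>. fps_const q ^ sum_list cs * fps_X ^ exc n \<sigma>)
      = fps_X ^ exc n \<sigma> * fps_const (q ^ \<Sum>(dex n \<sigma>) * qbin q (N + n - card (dex n \<sigma>)) n)" by (simp add: mult.commute)
  qed simp
  finally show ?thesis by simp
qed

end

section \<open>The recursion for the q-Eulerian polynomials\<close>

context base_q begin

lemma qbin_prod: "qbin q (M + n) n = (\<Prod>i=1..n. (q ^ (M + i) - 1) / (q ^ i - 1))"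
proof (induction n)
  case (Suc n)
  have ne: "q_int q (Suc n) \<noteq> 0" using q_int_pos[of "Suc n"] by simp
  have "qbin q (M + Suc n) (Suc n) = q_int q (Suc (M + n)) / q_int q (Suc n) * qbin q (M + n) n"
    using ne by (simp add: qbin_def q_binomial_def q_fact_Suc field_simps)
  also have "q_int q (Suc (M + n)) / q_int q (Suc n) = (q ^ (M + Suc n) - 1) / (q ^ Suc n - 1)"
    unfolding q_int_eq[symmetric] using q_gt_1 by simp
  finally show ?case using Suc by (simp add: mult.commute)
qed simp

text \<open>The bounded Gaussian binomial coefficient as a polynomial in \<open>u = q ^ N\<close>, with the shift of the bound by
  \<open>d\<close> absorbed in the coefficients.\<close>

definition qbin_poly :: "nat \<Rightarrow> nat \<Rightarrow> rat fps poly" where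
  "qbin_poly n d = (\<Prod>i=1..n. [:fps_const (- 1 / (q ^ i - 1)), fps_const (q ^ i / q ^ d / (q ^ i - 1)):])"

lemma poly_qbin_poly:
  assumes "d \<le> N"
  shows "poly (qbin_poly n d) (fps_const (q ^ N)) = fps_const (qbin q (N + n - d) n)"
proof -
  obtain M where M: "N = M + d" using assms by (metis add.commute le_Suc_ex)
  have e: "- 1 / (q ^ i - 1) + q ^ N * (q ^ i / q ^ d / (q ^ i - 1)) = (q ^ (M + i) - 1) / (q ^ i - 1)" for i
  proof -
    have "q \<noteq> 0" using q_gt_1 by simp
    then have "q ^ N * (q ^ i / q ^ d / (q ^ i - 1)) = q ^ (M + i) / (q ^ i - 1)"
      by (simp add: M power_add)
    then show ?thesis by (simp add: diff_divide_distrib)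
  qed
  have "poly (qbin_poly n d) (fps_const (q ^ N)) = (\<Prod>i=1..n. fps_const ((q ^ (M + i) - 1) / (q ^ i - 1)))"
    unfolding qbin_poly_def poly_prod e[symmetric] by (intro prod.cong) auto
  also have "\<dots> = fps_const (qbin q (M + n) n)" unfolding qbin_prod
    by (induction n) auto
  finally show ?thesis by (simp add: M)
qed

text \<open>The value of all \<open>qbin_poly n d\<close> at \<open>u = 0\<close>; up to the factor \<open>(1 - q) ^ n\<close> it is the reciprocal of
  the \<open>q\<close>-factorial, which turns products into Gaussian binomial coefficients.\<close>

definition residue :: "nat \<Rightarrow> rat" where
  "residue n = (\<Prod>i=1..n. - 1 / (q ^ i - 1))"

lemma poly_qbin_poly_0: "poly (qbin_poly n d) 0 = fps_const (residue n)"
  unfolding qbin_poly_def poly_prod residue_def by (induction n) auto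

lemma residue_eq: "residue n = 1 / ((1 - q) ^ n * q_fact q n)"
proof (induction n)
  case (Suc n)
  have "residue (Suc n) = residue n * (1 / ((1 - q) * q_int q (Suc n)))"
  proof -
    have "(1 - q) * q_int q (Suc n) = - (q ^ Suc n - 1)" unfolding q_int_eq[symmetric] by (simp add: algebra_simps)
    then have "- 1 / (q ^ Suc n - 1) = 1 / ((1 - q) * q_int q (Suc n))"
      by (metis minus_divide_left minus_divide_right)
    then show ?thesis by (simp add: residue_def)
  qed
  then show ?case using Suc by (simp add: q_fact_Suc)
qed (simp add: residue_def)

lemma residue_product: "i \<le> n \<Longrightarrow> residue i * residue (n - i) = residue n * q_binomial q n i"
proof -
  assume i: "i \<le> n"
  have "(1 - q) ^ n = (1 - q) ^ i * (1 - q) ^ (n - i)" using i by (simp add: power_add[symmetric])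
  moreover have "1 - q \<noteq> 0" using q_gt_1 by simp
  ultimately show ?thesis by (simp add: residue_eq q_binomial_def)
qed

definition perm_poly :: "nat \<Rightarrow> rat fps poly" where
  "perm_poly n = (\<Sum>\<sigma> | \<sigma> permutes {1..n}. [:fps_X ^ exc n \<sigma> * fps_const (q ^ \<Sum>(dex n \<sigma>)):] * qbin_poly n (card (dex n \<sigma>)))"

lemma q_Eulerian_dex:
  "q_Eulerian n q = (\<Sum>\<sigma> | \<sigma> permutes {1..n}. fps_X ^ exc n \<sigma> * fps_const (q ^ \<Sum>(dex n \<sigma>)))"
  unfolding q_Eulerian_def
proof (rule sum.cong)
  fix \<sigma> assume "\<sigma> \<in> {\<sigma>. \<sigma> permutes {1..n}}"
  then have "int (maj n \<sigma>) - int (exc n \<sigma>) = int (\<Sum>(dex n \<sigma>))" using sum_dex[of \<sigma> n] by (simp del: of_nat_sum)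
  then have "q powi (int (maj n \<sigma>) - int (exc n \<sigma>)) = q ^ \<Sum>(dex n \<sigma>)" by (simp only: power_int_of_nat)
  then show "fps_const (q powi (int (maj n \<sigma>) - int (exc n \<sigma>))) * fps_X ^ exc n \<sigma>
      = fps_X ^ exc n \<sigma> * fps_const (q ^ \<Sum>(dex n \<sigma>))" by (simp only: mult.commute)
qed simp

lemma perm_poly_0: "poly (perm_poly n) 0 = fps_const (residue n) * q_Eulerian n q"
  by (simp add: perm_poly_def poly_sum poly_qbin_poly_0 q_Eulerian_dex sum_distrib_left ac_simps)

lemma poly_perm_poly:
  assumes "n \<le> N"
  shows "poly (perm_poly n) (fps_const (q ^ N)) = fps_nth (letter_sums.Z fps_X N (fps_const q)) n"
proof -
  have "card (dex n \<sigma>) \<le> N" for \<sigma>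
  proof -
    have "card (dex n \<sigma>) \<le> card {1..<n}" by (rule card_mono) (auto simp: dex_def)
    then show ?thesis using assms by simp
  qed
  then show ?thesis
    by (simp add: perm_poly_def poly_sum poly_qbin_poly Z_nth mult.assoc)
qed

text \<open>The bounded identity is polynomial in \<open>u = q ^ N\<close>; it holds for infinitely many values of \<open>u\<close>,
  hence also at \<open>u = 0\<close>, where the bounded counts turn into the values for unbounded sequences.\<close>

theorem q_Eulerian_recursion:
  "(\<Sum>i\<le>n. fps_const (q_binomial q n i) * (fps_X ^ i - fps_X) * q_Eulerian (n - i) q) = 1 - fps_X"
proof -
  define D where "D = (\<Sum>i\<le>n. [:fps_X ^ i - fps_X:] * qbin_poly i 0 * perm_poly (n - i)) - [:1 - fps_X:] * qbin_poly n 0"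
  have root: "poly D (fps_const (q ^ N)) = 0" if N: "n \<le> N" for N
  proof -
    interpret letter_sums "fps_X :: rat fps" N .
    let ?Q = "fps_const q"
    have "(\<Sum>i=0..n. fps_nth (H ?Q fps_X - fps_const fps_X * H ?Q 1) i * fps_nth (Z ?Q) (n - i))
        = (1 - fps_X) * fps_nth (H ?Q 1) n"
      using arg_cong[OF Z_equation[of ?Q], of "\<lambda>f. fps_nth f n"]
      unfolding fps_mult_nth[of "H ?Q fps_X - fps_const fps_X * H ?Q 1"] fps_mult_left_const_nth .
    moreover have "fps_nth (H ?Q fps_X - fps_const fps_X * H ?Q 1) i = (fps_X ^ i - fps_X) * fps_const (qbin q (N + i) i)" for i
      using H_nth[of ?Q fps_X i] by (simp add: H_nth_qbin left_diff_distrib)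
    ultimately have "(\<Sum>i\<le>n. (fps_X ^ i - fps_X) * fps_const (qbin q (N + i) i) * fps_nth (Z ?Q) (n - i))
        = (1 - fps_X) * fps_const (qbin q (N + n) n)"
      by (simp add: H_nth_qbin atLeast0AtMost)
    then show ?thesis
      using N by (simp add: D_def poly_sum poly_qbin_poly poly_perm_poly mult.assoc)
  qed
  have "infinite ((\<lambda>N. fps_const (q ^ N)) ` {n..})"
  proof -
    have "inj_on (\<lambda>N. fps_const (q ^ N)) {n..}"
      using q_gt_1 by (auto simp: inj_on_def power_inject_exp dest!: arg_cong[of "fps_const _" _ "\<lambda>f. fps_nth f 0"])
    then show ?thesis using finite_imageD infinite_Ici by blast
  qed
  moreover have "(\<lambda>N. fps_const (q ^ N)) ` {n..} \<subseteq> {x. poly D x = 0}" using root by auto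
  ultimately have "D = 0" using poly_roots_finite finite_subset by blast
  then have "poly D 0 = 0" by simp
  then have "(\<Sum>i\<le>n. (fps_X ^ i - fps_X) * fps_const (residue i) * (fps_const (residue (n - i)) * q_Eulerian (n - i) q))
      = (1 - fps_X) * fps_const (residue n)"
    by (simp add: D_def poly_sum poly_qbin_poly_0 perm_poly_0 mult.assoc)
  moreover have "(fps_X ^ i - fps_X) * fps_const (residue i) * (fps_const (residue (n - i)) * q_Eulerian (n - i) q)
      = fps_const (residue n) * (fps_const (q_binomial q n i) * (fps_X ^ i - fps_X) * q_Eulerian (n - i) q)"
    if "i \<le> n" for i
  proof -
    have "fps_const (residue i) * fps_const (residue (n - i)) = fps_const (residue n) * fps_const (q_binomial q n i)"
      using residue_product[OF that] by simp
    moreover have "x * a * (b * y) = c * (d * x * y)" if "a * b = c * d" for x a b c d y :: "rat fps"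
    proof -
      have "x * a * (b * y) = a * b * (x * y)" by (simp only: ac_simps)
      then show ?thesis unfolding that by (simp only: ac_simps)
    qed
    ultimately show ?thesis by blast
  qed
  ultimately have "(\<Sum>i\<le>n. fps_const (residue n) * (fps_const (q_binomial q n i) * (fps_X ^ i - fps_X) * q_Eulerian (n - i) q))
      = (1 - fps_X) * fps_const (residue n)"
    by (metis (no_types, lifting) atMost_iff sum.cong)
  then have "fps_const (residue n) * (\<Sum>i\<le>n. fps_const (q_binomial q n i) * (fps_X ^ i - fps_X) * q_Eulerian (n - i) q)
      = fps_const (residue n) * (1 - fps_X)"
    unfolding sum_distrib_left by (simp only: mult.commute)
  moreover have "fps_const (residue n) \<noteq> 0" using q_gt_1 by (simp add: residue_eq)
  ultimately show ?thesis by (simp only: mult_left_cancel simp_thms)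
qed

end

section \<open>Decorated permutations\<close>

text \<open>The word obtained from the letters \<open>u 1, u 2, \<dots>\<close> by placing them at the positions in \<open>S\<close> and
  zeros elsewhere.\<close>

definition spread :: "nat set \<Rightarrow> (nat \<Rightarrow> nat) \<Rightarrow> nat \<Rightarrow> nat" where
  "spread S u i = (if i \<in> S then u (card (S \<inter> {1..i})) else 0)"

definition subsets :: "nat \<Rightarrow> nat \<Rightarrow> nat set set" where
  "subsets n k = {S. S \<subseteq> {1..n} \<and> card S = k}"

lemma finite_subsets: "finite (subsets n k)"
  by (rule finite_subset[of _ "Pow {1..n}"]) (auto simp: subsets_def)

lemma maj_Suc: "maj (Suc n) w = maj n w + (if n \<ge> 1 \<and> w n > w (Suc n) then n else 0)"
proof -
  have "{i \<in> {1..<Suc n}. w i > w (Suc i)} = {i \<in> {1..<n}. w i > w (Suc i)} \<union> (if n \<ge> 1 \<and> w n > w (Suc n) then {n} else {})"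
    by (auto simp: less_Suc_eq)
  then show ?thesis by (simp add: maj_def)
qed

lemma maj_cong: "(\<And>i. 1 \<le> i \<Longrightarrow> i \<le> n \<Longrightarrow> w i = w' i) \<Longrightarrow> maj n w = maj n w'"
  unfolding maj_def by (rule sum.cong) auto

context base_q begin

text \<open>The two sums follow the shuffles of a word with zeros according to whether the last letter
  is a zero.\<close>

lemma sum_spread_last:
  assumes pos: "\<And>i. i \<ge> 1 \<Longrightarrow> u i > 0"
  shows "n \<ge> 1 \<Longrightarrow> (\<Sum>S\<in>{S \<in> subsets n k. n \<notin> S}. q ^ maj n (spread S u)) = q ^ (maj k u + k) * qbin q (n - 1) k \<and>
    (\<Sum>S\<in>{S \<in> subsets n (Suc k). n \<in> S}. q ^ maj n (spread S u)) = q ^ maj (Suc k) u * qbin q (n - 1) k"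
proof (induction n arbitrary: k rule: dec_induct)
  case base
  have "{S \<in> subsets 1 k. 1 \<notin> S} = (if k = 0 then {{}} else {})"
    by (auto simp: subsets_def subset_singleton_iff)
  moreover have "{S \<in> subsets 1 (Suc k). 1 \<in> S} = (if k = 0 then {{1}} else {})"
    by (auto simp: subsets_def subset_singleton_iff)
  moreover have "maj 1 w = 0" "maj 0 w = 0" for w unfolding maj_def by (rule sum.neutral, auto)+
  ultimately show ?case by (simp add: qbin_eq_0)
next
  case (step n)
  have n1: "n \<ge> 1" using step by simp
  let ?F0 = "\<lambda>k. \<Sum>S\<in>{S \<in> subsets n k. n \<notin> S}. q ^ maj n (spread S u)"
  let ?F1 = "\<lambda>k. \<Sum>S\<in>{S \<in> subsets n k. n \<in> S}. q ^ maj n (spread S u)"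
  have F0: "?F0 k = q ^ (maj k u + k) * qbin q (n - 1) k" for k using step.IH by blast
  have F1: "?F1 (Suc k) = q ^ maj (Suc k) u * qbin q (n - 1) k" for k using step.IH by blast
  have F10: "?F1 0 = 0"
    by (rule sum.neutral) (auto simp: subsets_def finite_subset[of _ "{1..n}"] card_eq_0_iff)
  have split: "(\<Sum>S\<in>subsets n k. f S) = (\<Sum>S\<in>{S \<in> subsets n k. n \<notin> S}. f S) + (\<Sum>S\<in>{S \<in> subsets n k. n \<in> S}. f S)"
    for f :: "nat set \<Rightarrow> rat" and k
  proof -
    have "subsets n k = {S \<in> subsets n k. n \<notin> S} \<union> {S \<in> subsets n k. n \<in> S}" by auto
    then show ?thesis using finite_subsets by (subst sum.union_disjoint[symmetric]) auto
  qed
  have sub: "S \<subseteq> {1..n}" if "S \<in> subsets n k" for S k using that by (auto simp: subsets_def)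
  have zero: "(\<Sum>S\<in>{S \<in> subsets (Suc n) k. Suc n \<notin> S}. q ^ maj (Suc n) (spread S u)) = ?F0 k + q ^ n * ?F1 k" for k
  proof -
    have "{S \<in> subsets (Suc n) k. Suc n \<notin> S} = subsets n k"
      by (auto simp: subsets_def subset_iff le_Suc_eq)
    moreover have "maj (Suc n) (spread S u) = maj n (spread S u) + (if n \<in> S then n else 0)" if "S \<in> subsets n k" for S
    proof -
      have "spread S u (Suc n) = 0" using sub[OF that] by (auto simp: spread_def)
      moreover have "spread S u n > 0 \<longleftrightarrow> n \<in> S"
      proof -
        have "n \<in> S \<Longrightarrow> card (S \<inter> {1..n}) \<ge> 1" using n1 by (auto simp: Suc_le_eq card_gt_0_iff)
        then show ?thesis using pos by (auto simp: spread_def)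
      qed
      ultimately show ?thesis using n1 by (simp add: maj_Suc)
    qed
    ultimately show ?thesis
      by (simp add: split sum_distrib_left power_add mult.commute)
  qed
  have one: "(\<Sum>S\<in>{S \<in> subsets (Suc n) (Suc k). Suc n \<in> S}. q ^ maj (Suc n) (spread S u))
      = ?F0 k + (if u k > u (Suc k) then q ^ n else 1) * ?F1 k" for k
  proof -
    have inj: "inj_on (insert (Suc n)) (subsets n k)"
    proof (rule inj_onI)
      fix S T assume ST: "S \<in> subsets n k" "T \<in> subsets n k" "insert (Suc n) S = insert (Suc n) T"
      have "Suc n \<notin> S" "Suc n \<notin> T" using ST(1,2) by (auto simp: subsets_def)
      then show "S = T" using ST(3) by (simp add: insert_ident)
    qed
    have im: "{S \<in> subsets (Suc n) (Suc k). Suc n \<in> S} = insert (Suc n) ` subsets n k"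
    proof (intro subset_antisym subsetI)
      fix S assume S: "S \<in> {S \<in> subsets (Suc n) (Suc k). Suc n \<in> S}"
      then have "finite S" by (auto simp: subsets_def intro: finite_subset)
      then have "S - {Suc n} \<in> subsets n k" using S by (auto simp: subsets_def subset_iff le_Suc_eq)
      moreover have "S = insert (Suc n) (S - {Suc n})" using S by auto
      ultimately show "S \<in> insert (Suc n) ` subsets n k" by blast
    next
      fix S assume "S \<in> insert (Suc n) ` subsets n k"
      then obtain T where T: "S = insert (Suc n) T" "T \<in> subsets n k" by blast
      then have "finite T" "Suc n \<notin> T" using sub[OF T(2)] finite_subset by (auto intro: finite_subset)
      then show "S \<in> {S \<in> subsets (Suc n) (Suc k). Suc n \<in> S}" using T by (auto simp: subsets_def)
    qed
    have m: "maj (Suc n) (spread (insert (Suc n) S) u)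
        = maj n (spread S u) + (if n \<in> S \<and> u k > u (Suc k) then n else 0)" if S: "S \<in> subsets n k" for S
    proof -
      have fin: "finite S" "Suc n \<notin> S" "card S = k" using sub[OF S] S finite_subset by (auto simp: subsets_def intro: finite_subset)
      have same: "spread (insert (Suc n) S) u i = spread S u i" if "i \<le> n" for i
      proof -
        have "insert (Suc n) S \<inter> {1..i} = S \<inter> {1..i}" using that by auto
        then show ?thesis using that by (simp add: spread_def)
      qed
      have "insert (Suc n) S \<inter> {1..Suc n} = insert (Suc n) S" "S \<inter> {1..n} = S" using sub[OF S] by auto
      then have "spread (insert (Suc n) S) u (Suc n) = u (Suc k)" "spread S u n = (if n \<in> S then u k else 0)"
        using fin by (simp_all add: spread_def)
      moreover have "u (Suc k) > 0" using pos by simp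
      moreover have "maj n (spread (insert (Suc n) S) u) = maj n (spread S u)"
        by (rule maj_cong) (simp add: same)
      ultimately show ?thesis unfolding maj_Suc using n1 same[of n] by (simp split: if_split)
    qed
    have "(\<Sum>S\<in>{S \<in> subsets (Suc n) (Suc k). Suc n \<in> S}. q ^ maj (Suc n) (spread S u))
      = (\<Sum>S\<in>subsets n k. q ^ (maj n (spread S u) + (if n \<in> S \<and> u k > u (Suc k) then n else 0)))"
      unfolding im sum.reindex[OF inj] comp_def by (rule sum.cong) (simp_all only: m)
    then show ?thesis by (simp add: split sum_distrib_left power_add mult.commute)
  qed
  obtain n' where n': "n = Suc n'" using n1 by (cases n) auto
  have A: "?F0 k + q ^ n * ?F1 k = q ^ (maj k u + k) * qbin q n k"
  proof (cases k)
    case 0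
    then show ?thesis using F10 F0[of 0] by simp
  next
    case (Suc j)
    show ?thesis
    proof (cases "j \<le> n'")
      case True
      have "q ^ n' = q ^ j * q ^ (n' - j)" using True by (simp add: power_add[symmetric])
      then show ?thesis using F0[of k] F1[of j] qbin_Suc_Suc'[OF True]
        by (simp add: n' Suc power_add algebra_simps)
    next
      case False
      then show ?thesis using F0[of k] F1[of j] by (simp add: n' Suc qbin_eq_0)
    qed
  qed
  have B: "?F0 k + (if u k > u (Suc k) then q ^ n else 1) * ?F1 k = q ^ maj (Suc k) u * qbin q n k"
  proof (cases k)
    case 0
    then show ?thesis using F10 F0[of 0] by (simp add: maj_def)
  next
    case (Suc j)
    have mS: "maj (Suc k) u = maj k u + (if u k > u (Suc k) then k else 0)" using Suc by (simp add: maj_Suc)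
    show ?thesis
    proof (cases "u k > u (Suc k)")
      case True
      show ?thesis
      proof (cases "j \<le> n'")
        case le: True
        have "q ^ n' = q ^ j * q ^ (n' - j)" using le by (simp add: power_add[symmetric])
        then show ?thesis using F0[of k] F1[of j] qbin_Suc_Suc'[OF le] True mS
          by (simp add: n' Suc power_add algebra_simps)
      next
        case False
        then show ?thesis using F0[of k] F1[of j] by (simp add: n' Suc qbin_eq_0)
      qed
    next
      case False
      then show ?thesis using F0[of k] F1[of j] qbin_Suc_Suc[of n' j] mS
        by (simp add: n' Suc power_add algebra_simps)
    qed
  qed
  show ?case using zero[of k] one[of k] A B by simp
qed

theorem sum_spread:
  assumes "\<And>i. i \<ge> 1 \<Longrightarrow> u i > 0"
  shows "(\<Sum>S\<in>subsets n k. q ^ maj n (spread S u)) = q ^ maj k u * qbin q n k"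
proof (cases "n = 0")
  case True
  have "subsets 0 k = (if k = 0 then {{}} else {})" by (auto simp: subsets_def)
  then show ?thesis using True by (simp add: maj_def qbin_eq_0)
next
  case False
  then obtain n' where n': "n = Suc n'" by (cases n) auto
  have "subsets n k = {S \<in> subsets n k. n \<notin> S} \<union> {S \<in> subsets n k. n \<in> S}" by auto
  then have s: "(\<Sum>S\<in>subsets n k. q ^ maj n (spread S u)) =
      (\<Sum>S\<in>{S \<in> subsets n k. n \<notin> S}. q ^ maj n (spread S u)) + (\<Sum>S\<in>{S \<in> subsets n k. n \<in> S}. q ^ maj n (spread S u))"
    using finite_subsets by (subst sum.union_disjoint[symmetric]) auto
  show ?thesis
  proof (cases k)
    case 0
    then have e: "{S \<in> subsets n k. n \<in> S} = {}"
      by (auto simp: subsets_def finite_subset[of _ "{1..n}"] card_eq_0_iff)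
    then show ?thesis unfolding s e using sum_spread_last[of u n k, OF assms] False 0 by simp
  next
    case (Suc j)
    then show ?thesis unfolding s
      using sum_spread_last[of u n k, OF assms] sum_spread_last[of u n j, OF assms] False qbin_Suc_Suc[of n' j]
      by (simp add: n' power_add algebra_simps)
  qed
qed

end

subsection \<open>Standardization\<close>

definition rank_in :: "nat set \<Rightarrow> nat \<Rightarrow> nat" where
  "rank_in S i = card (S \<inter> {1..i})"

lemma rank_in_less:
  assumes "finite S" "j \<in> S" "i < j"
  shows "rank_in S i < rank_in S j"
proof -
  have "j \<in> S \<inter> {1..j}" "j \<notin> S \<inter> {1..i}" "S \<inter> {1..i} \<subseteq> S \<inter> {1..j}" using assms by auto
  then have "S \<inter> {1..i} \<subset> S \<inter> {1..j}" by blast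
  then show ?thesis unfolding rank_in_def using assms by (intro psubset_card_mono) auto
qed

lemma rank_in_less_iff: "finite S \<Longrightarrow> i \<in> S \<Longrightarrow> j \<in> S \<Longrightarrow> rank_in S i < rank_in S j \<longleftrightarrow> i < j"
  using rank_in_less by (metis linorder_neqE_nat order_less_imp_not_less)

lemma rank_in_bij:
  assumes S: "S \<in> subsets n k"
  shows "bij_betw (rank_in S) S {1..k}"
proof -
  have fin: "finite S" using S by (auto simp: subsets_def intro: finite_subset)
  have "rank_in S i \<in> {1..k}" if "i \<in> S" for i
  proof -
    have "i \<in> S \<inter> {1..i}" using that S by (auto simp: subsets_def)
    then have "card (S \<inter> {1..i}) \<ge> 1" using fin by (metis One_nat_def Suc_leI card_gt_0_iff empty_iff finite_Int)
    moreover have "card (S \<inter> {1..i}) \<le> k" using card_mono[OF fin, of "S \<inter> {1..i}"] S by (auto simp: subsets_def)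
    ultimately show ?thesis by (simp add: rank_in_def)
  qed
  moreover have "inj_on (rank_in S) S"
    using rank_in_less_iff[OF fin] by (metis inj_onI linorder_neqE_nat order_less_irrefl)
  moreover have "card S = card {1..k}" using S by (simp add: subsets_def)
  ultimately have "rank_in S ` S \<subseteq> {1..k}" "card (rank_in S ` S) = card {1..k}" "inj_on (rank_in S) S"
    by (blast, simp only: card_image, blast)
  then show ?thesis by (intro bij_betw_imageI card_subset_eq) simp_all
qed

text \<open>Standardization: the permutation of \<open>{1..k}\<close> with the same relative order as \<open>\<pi>\<close>.\<close>

definition transport :: "nat set \<Rightarrow> nat \<Rightarrow> (nat \<Rightarrow> nat) \<Rightarrow> nat \<Rightarrow> nat" where
  "transport S k \<pi> = (\<lambda>x. if x \<in> {1..k} then rank_in S (\<pi> (inv_into S (rank_in S) x)) else x)"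

lemma transport_bij:
  "S \<in> subsets n k \<Longrightarrow> bij_betw (transport S k) {\<pi>. \<pi> permutes S} {\<tau>. \<tau> permutes {1..k}}"
  unfolding transport_def by (rule bij_betw_permutations[OF rank_in_bij])

lemma transport_at:
  assumes "S \<in> subsets n k" "i \<in> S"
  shows "transport S k \<pi> (rank_in S i) = rank_in S (\<pi> i)"
proof -
  have "inv_into S (rank_in S) (rank_in S i) = i"
    using rank_in_bij[OF assms(1)] assms(2) by (simp add: bij_betw_def inv_into_f_f)
  moreover have "rank_in S i \<in> {1..k}" using rank_in_bij[OF assms(1)] assms(2) bij_betwE by blast
  ultimately show ?thesis by (simp add: transport_def)
qed

definition decorate :: "nat set \<Rightarrow> (nat \<Rightarrow> nat) \<Rightarrow> nat \<Rightarrow> nat" where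
  "decorate S \<pi> = (\<lambda>i. if i \<in> S then \<pi> i else 0)"

lemma maj_decorate:
  assumes S: "S \<in> subsets n k" and \<pi>: "\<pi> permutes S"
  shows "maj n (decorate S \<pi>) = maj n (spread S (transport S k \<pi>))"
proof -
  have fin: "finite S" "S \<subseteq> {1..n}" using S by (auto simp: subsets_def intro: finite_subset)
  have \<pi>S: "\<pi> i \<in> S" if "i \<in> S" for i using permutes_in_image[OF \<pi>] that by simp
  have r: "spread S (transport S k \<pi>) i = (if i \<in> S then rank_in S (\<pi> i) else 0)" for i
    using transport_at[OF S, of i \<pi>] by (simp add: spread_def rank_in_def)
  have p: "rank_in S i > 0" "i > 0" if "i \<in> S" for i
  proof -
    have "rank_in S i \<in> {1..k}" using bij_betwE[OF rank_in_bij[OF S]] that by blast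
    then show "rank_in S i > 0" by simp
  qed (use that fin in auto)
  have "decorate S \<pi> i > decorate S \<pi> (Suc i) \<longleftrightarrow> spread S (transport S k \<pi>) i > spread S (transport S k \<pi>) (Suc i)" for i
    unfolding r decorate_def using rank_in_less_iff[OF fin(1)] \<pi>S p by auto
  then show ?thesis by (simp add: maj_def)
qed

lemma exc_decorate:
  assumes S: "S \<in> subsets n k" and \<pi>: "\<pi> permutes S"
  shows "exc n (decorate S \<pi>) = exc k (transport S k \<pi>)"
proof -
  have fin: "finite S" "S \<subseteq> {1..n}" using S by (auto simp: subsets_def intro: finite_subset)
  have \<pi>S: "\<pi> i \<in> S" if "i \<in> S" for i using permutes_in_image[OF \<pi>] that by simp
  have b: "bij_betw (rank_in S) S {1..k}" by (rule rank_in_bij[OF S])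
  have "{i \<in> {1..n}. i < decorate S \<pi> i} = {i \<in> S. i < \<pi> i}"
    using fin by (auto simp: decorate_def split: if_splits)
  moreover have "{r \<in> {1..k}. r < transport S k \<pi> r} = rank_in S ` {i \<in> S. i < \<pi> i}"
  proof (intro subset_antisym subsetI)
    fix r assume r: "r \<in> {r \<in> {1..k}. r < transport S k \<pi> r}"
    then have "r \<in> {1..k}" by blast
    then have "r \<in> rank_in S ` S" using b unfolding bij_betw_def by blast
    then obtain i where i: "i \<in> S" "r = rank_in S i" by blast
    then have "i < \<pi> i" using r transport_at[OF S i(1), of \<pi>] rank_in_less_iff[OF fin(1) i(1) \<pi>S[OF i(1)]] by auto
    then show "r \<in> rank_in S ` {i \<in> S. i < \<pi> i}" using i by auto
  next
    fix r assume "r \<in> rank_in S ` {i \<in> S. i < \<pi> i}"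
    then obtain i where i: "i \<in> S" "i < \<pi> i" "r = rank_in S i" by auto
    then show "r \<in> {r \<in> {1..k}. r < transport S k \<pi> r}"
      using transport_at[OF S i(1), of \<pi>] rank_in_less_iff[OF fin(1) i(1) \<pi>S[OF i(1)]] bij_betwE[OF b] by auto
  qed
  moreover have "inj_on (rank_in S) {i \<in> S. i < \<pi> i}" using b by (auto simp: bij_betw_def inj_on_def)
  ultimately show ?thesis by (simp add: exc_def card_image)
qed

context base_q begin

text \<open>A decorated permutation is determined by its support and the standardization of its nonzero part,
  which has the same excedances. Summing over the supports of size \<open>k\<close> gives a Gaussian binomial
  coefficient. The empty permutation contributes the summand \<open>1\<close>, by the convention for its statistics.\<close>

theorem decorated_sum:
  "(\<Sum>\<sigma>\<in>decorated_permutations n.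
      fps_const (q powi (dmaj n \<sigma> - dexc n \<sigma>)) * fps_X ^ nat (dexc n \<sigma> + 1)) = binomial_q_Eulerian n q"
proof -
  let ?t = "\<lambda>\<sigma>. fps_const (q powi (dmaj n \<sigma> - dexc n \<sigma>)) * fps_X ^ nat (dexc n \<sigma> + 1)"
  let ?D = "SIGMA S:Pow {1..n}. {\<pi>. \<pi> permutes S}"
  have S0: "decorate S \<pi> i \<noteq> 0 \<longleftrightarrow> i \<in> S" if "S \<subseteq> {1..n}" "\<pi> permutes S" for S \<pi> i
    using permutes_in_image[OF that(2), of i] that(1) by (auto simp: decorate_def)
  have inj: "inj_on (\<lambda>(S, \<pi>). decorate S \<pi>) ?D"
  proof (rule inj_onI, clarify)
    fix S \<pi> T \<rho> assume *: "S \<subseteq> {1..n}" "\<pi> permutes S" "T \<subseteq> {1..n}" "\<rho> permutes T" "decorate S \<pi> = decorate T \<rho>"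
    then have ST: "S = T" using S0[of S \<pi>] S0[of T \<rho>] by auto
    moreover have "\<pi> i = \<rho> i" for i
    proof (cases "i \<in> S")
      case True
      then show ?thesis using fun_cong[OF *(5), of i] ST by (simp add: decorate_def)
    next
      case False
      then show ?thesis using permutes_not_in[OF *(2)] permutes_not_in[OF *(4)] ST by simp
    qed
    ultimately show "S = T \<and> \<pi> = \<rho>" by blast
  qed
  have im: "decorated_permutations n = (\<lambda>(S, \<pi>). decorate S \<pi>) ` ?D"
    unfolding decorated_permutations_def decorate_def by auto
  have fin: "finite {\<pi>. \<pi> permutes S}" if "S \<in> Pow {1..n}" for S
    using that by (intro finite_permutations) (auto intro: finite_subset)
  have "(\<Sum>\<sigma>\<in>decorated_permutations n. ?t \<sigma>) = (\<Sum>S\<in>Pow {1..n}. \<Sum>\<pi> | \<pi> permutes S. ?t (decorate S \<pi>))"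
    unfolding im sum.reindex[OF inj] using fin by (subst sum.Sigma) (auto simp: case_prod_unfold comp_def)
  also have "\<dots> = (\<Sum>k\<in>{0..n}. \<Sum>S\<in>{S \<in> Pow {1..n}. card S = k}. \<Sum>\<pi> | \<pi> permutes S. ?t (decorate S \<pi>))"
    by (rule sum.group[symmetric]) (auto dest: card_mono[rotated])
  also have "\<dots> = (\<Sum>k\<in>{0..n}. \<Sum>S\<in>subsets n k. \<Sum>\<pi> | \<pi> permutes S. ?t (decorate S \<pi>))"
    by (intro sum.cong) (auto simp: subsets_def)
  also have "\<dots> = (\<Sum>S\<in>subsets n 0. \<Sum>\<pi> | \<pi> permutes S. ?t (decorate S \<pi>))
      + (\<Sum>k\<in>{1..n}. \<Sum>S\<in>subsets n k. \<Sum>\<pi> | \<pi> permutes S. ?t (decorate S \<pi>))"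
    by (simp add: sum.atLeast_Suc_atMost[of 0 n])
  also have "(\<Sum>S\<in>subsets n 0. \<Sum>\<pi> | \<pi> permutes S. ?t (decorate S \<pi>)) = 1"
  proof -
    have "subsets n 0 = {{}}" by (auto simp: subsets_def finite_subset[of _ "{1..n}"] card_eq_0_iff)
    moreover have "{\<pi>. \<pi> permutes ({} :: nat set)} = {id}" by (auto simp: permutes_empty)
    moreover have "dexc n (decorate {} id) = -1" "dmaj n (decorate {} id) = -1"
      by (simp_all add: dexc_def dmaj_def decorate_def)
    ultimately show ?thesis by simp
  qed
  also have "(\<Sum>k\<in>{1..n}. \<Sum>S\<in>subsets n k. \<Sum>\<pi> | \<pi> permutes S. ?t (decorate S \<pi>))
     = (\<Sum>k\<in>{1..n}. fps_X * (fps_const (q_binomial q n k) * q_Eulerian k q))"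
  proof (rule sum.cong)
    fix k assume k: "k \<in> {1..n}"
    have t: "?t (decorate S \<pi>) = fps_const (q ^ maj n (spread S \<tau>) * q powi (- int (exc k \<tau>))) * fps_X ^ Suc (exc k \<tau>)"
      if S: "S \<in> subsets n k" and \<pi>: "\<pi> permutes S" and \<tau>: "\<tau> = transport S k \<pi>" for S \<pi> \<tau>
    proof -
      have "S \<noteq> {}" using S k by (auto simp: subsets_def)
      then have "decorate S \<pi> \<noteq> (\<lambda>_. 0)" using S0[of S \<pi>] S \<pi> by (fastforce simp: subsets_def)
      then have e: "dexc n (decorate S \<pi>) = int (exc k \<tau>)" "dmaj n (decorate S \<pi>) = int (maj n (spread S \<tau>))"
        by (simp_all add: dexc_def dmaj_def maj_decorate[OF S \<pi>] exc_decorate[OF S \<pi>] \<tau>)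
      have "q powi (int (maj n (spread S \<tau>)) - int (exc k \<tau>)) = q ^ maj n (spread S \<tau>) * q powi (- int (exc k \<tau>))"
        using q_gt_1 power_int_add[of q "int (maj n (spread S \<tau>))" "- int (exc k \<tau>)"] by simp
      then show ?thesis by (simp add: e nat_add_distrib)
    qed
    have "(\<Sum>S\<in>subsets n k. \<Sum>\<pi> | \<pi> permutes S. ?t (decorate S \<pi>))
      = (\<Sum>S\<in>subsets n k. \<Sum>\<tau> | \<tau> permutes {1..k}.
          fps_const (q ^ maj n (spread S \<tau>) * q powi (- int (exc k \<tau>))) * fps_X ^ Suc (exc k \<tau>))"
    proof (rule sum.cong)
      fix S assume S: "S \<in> subsets n k"
      show "(\<Sum>\<pi> | \<pi> permutes S. ?t (decorate S \<pi>)) = (\<Sum>\<tau> | \<tau> permutes {1..k}.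
          fps_const (q ^ maj n (spread S \<tau>) * q powi (- int (exc k \<tau>))) * fps_X ^ Suc (exc k \<tau>))"
        unfolding sum.reindex_bij_betw[OF transport_bij[OF S], symmetric] by (rule sum.cong) (simp_all add: t[OF S _ refl])
    qed simp
    also have "\<dots> = (\<Sum>\<tau> | \<tau> permutes {1..k}. \<Sum>S\<in>subsets n k.
          fps_const (q ^ maj n (spread S \<tau>) * q powi (- int (exc k \<tau>))) * fps_X ^ Suc (exc k \<tau>))"
      by (rule sum.swap)
    also have "\<dots> = (\<Sum>\<tau> | \<tau> permutes {1..k}. fps_X * (fps_const (q_binomial q n k) *
          (fps_const (q powi (int (maj k \<tau>) - int (exc k \<tau>))) * fps_X ^ exc k \<tau>)))"
    proof (rule sum.cong)
      fix \<tau> assume "\<tau> \<in> {\<tau>. \<tau> permutes {1..k}}"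
      then have \<tau>: "\<tau> permutes {1..k}" by simp
      have pos: "\<tau> i > 0" if "i \<ge> 1" for i
      proof (cases "i \<in> {1..k}")
        case True
        then have "\<tau> i \<in> {1..k}" using permutes_in_image[OF \<tau>] by blast
        then show ?thesis by simp
      next
        case False
        then show ?thesis using permutes_not_in[OF \<tau>] that by simp
      qed
      have "(\<Sum>S\<in>subsets n k. fps_const (q ^ maj n (spread S \<tau>) * q powi (- int (exc k \<tau>))) * fps_X ^ Suc (exc k \<tau>))
         = fps_const ((\<Sum>S\<in>subsets n k. q ^ maj n (spread S \<tau>)) * q powi (- int (exc k \<tau>))) * fps_X ^ Suc (exc k \<tau>)"
        by (simp only: fps_const_sum sum_distrib_right)
      also have "(\<Sum>S\<in>subsets n k. q ^ maj n (spread S \<tau>)) * q powi (- int (exc k \<tau>))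
         = q_binomial q n k * q powi (int (maj k \<tau>) - int (exc k \<tau>))"
      proof -
        have "(\<Sum>S\<in>subsets n k. q ^ maj n (spread S \<tau>)) = q ^ maj k \<tau> * qbin q n k"
          by (rule sum_spread) (rule pos)
        then show ?thesis
          using k q_gt_1 power_int_add[of q "int (maj k \<tau>)" "- int (exc k \<tau>)"] by (simp add: qbin_def)
      qed
      finally show "(\<Sum>S\<in>subsets n k. fps_const (q ^ maj n (spread S \<tau>) * q powi (- int (exc k \<tau>))) * fps_X ^ Suc (exc k \<tau>))
        = fps_X * (fps_const (q_binomial q n k) * (fps_const (q powi (int (maj k \<tau>) - int (exc k \<tau>))) * fps_X ^ exc k \<tau>))"
        by (simp add: fps_const_mult[symmetric] ac_simps del: fps_const_mult)
    qed simp
    finally show "(\<Sum>S\<in>subsets n k. \<Sum>\<pi> | \<pi> permutes S. ?t (decorate S \<pi>))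
      = fps_X * (fps_const (q_binomial q n k) * q_Eulerian k q)"
      by (simp add: q_Eulerian_def sum_distrib_left)
  qed simp
  finally show ?thesis by (simp add: binomial_q_Eulerian_def sum_distrib_left)
qed

end

section \<open>Recursion for the Hilbert series\<close>

context chow_presentation begin

definition chain_series :: "'a set option \<Rightarrow> rat fps" where
  "chain_series p = Abs_fps (\<lambda>j. of_nat (card {xs. normal p xs \<and> deg xs = j}))"

lemma normal_None: "normal p xs \<Longrightarrow> normal None xs"
  by (cases xs; cases p) auto

lemma finite_normal: "finite {xs. normal p xs \<and> deg xs = j}"
  by (rule finite_subset[OF _ finite_basis[of j]]) (auto simp: basis_def intro: normal_None)

text \<open>A nonempty normal chain is its lowest entry \<open>(G, a)\<close> followed by a normal chain above \<open>G\<close>.\<close>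

theorem chain_series_recursion:
  "chain_series p = 1 + (\<Sum>G | G \<in> L \<and> above p G. (\<Sum>a=1..<gap p G. fps_X ^ a) * chain_series (Some G))"
proof (rule fps_ext)
  fix j
  let ?I = "Sigma {G. G \<in> L \<and> above p G} (\<lambda>G. {1..<gap p G})"
  let ?C = "\<lambda>z. {ys. normal (Some (fst z)) ys \<and> snd z + deg ys = j}"
  have finI: "finite ?I" using finite_L by auto
  have finC: "finite (?C z)" for z
    by (rule finite_subset[OF _ finite_normal[of "Some (fst z)" "j - snd z"]]) auto
  have cardC: "rat_of_nat (card (?C z)) = fps_nth (fps_X ^ snd z * chain_series (Some (fst z))) j" for z
  proof (cases "j < snd z")
    case True
    then have "?C z = {}" by auto
    then show ?thesis using True by (simp add: fps_X_power_mult_nth)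
  next
    case False
    then have "?C z = {ys. normal (Some (fst z)) ys \<and> deg ys = j - snd z}" by auto
    then show ?thesis using False by (simp add: fps_X_power_mult_nth chain_series_def)
  qed
  have split: "{xs. normal p xs \<and> deg xs = j} = {xs. xs = [] \<and> j = 0} \<union> (\<Union>z\<in>?I. Cons z ` ?C z)" (is "?A = ?B \<union> ?U")
  proof (rule Set.set_eqI)
    fix xs
    show "xs \<in> ?A \<longleftrightarrow> xs \<in> ?B \<union> ?U"
    proof (cases xs)
      case (Cons z ys)
      have "xs \<in> ?U \<longleftrightarrow> z \<in> ?I \<and> ys \<in> ?C z" unfolding Cons by blast
      then show ?thesis by (cases z) (auto simp: Cons)
    qed auto
  qed
  have "card ?A = card ?B + card ?U"
    unfolding split using finI finC by (intro card_Un_disjoint) (auto intro: finite_subset[of _ "{[]}"])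
  also have "card ?U = (\<Sum>z\<in>?I. card (Cons z ` ?C z))"
    by (rule card_UN_disjoint) (use finI finC in auto)
  also have "\<dots> = (\<Sum>z\<in>?I. card (?C z))"
    by (rule sum.cong) (auto intro: card_image)
  finally have "fps_nth (chain_series p) j = of_nat (card ?B) + (\<Sum>z\<in>?I. rat_of_nat (card (?C z)))"
    by (simp add: chain_series_def)
  also have "rat_of_nat (card ?B) = fps_nth 1 j" by (cases j) auto
  also have "(\<Sum>z\<in>?I. rat_of_nat (card (?C z)))
      = (\<Sum>G | G \<in> L \<and> above p G. \<Sum>a=1..<gap p G. fps_nth (fps_X ^ a * chain_series (Some G)) j)"
    unfolding cardC using finite_L by (subst sum.Sigma) (auto intro!: sum.cong)
  finally show "fps_nth (chain_series p) j = fps_nth (1 + (\<Sum>G | G \<in> L \<and> above p G.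
      (\<Sum>a=1..<gap p G. fps_X ^ a) * chain_series (Some G))) j"
    by (simp add: fps_sum_nth sum_distrib_right)
qed

lemma Hilb_eq_chain_series: "augmented_chow_Hilb E L = chain_series None"
  by (simp add: augmented_chow_Hilb_eq chain_series_def basis_def)

end

section \<open>Counting subspaces\<close>

text \<open>Every element of the larger span is uniquely a multiple of \<open>b\<close> plus an element of the smaller one.\<close>

lemma card_span_insert:
  fixes b :: "'k::{field,finite} ^ 'n"
  assumes "b \<notin> vec.span S"
  shows "card (vec.span (insert b S)) = CARD('k) * card (vec.span S)"
proof -
  let ?f = "\<lambda>(c, x). c *s b + x"
  have "inj_on ?f (UNIV \<times> vec.span S)"
  proof (rule inj_onI, clarify)
    fix c x d y assume xy: "x \<in> vec.span S" "y \<in> vec.span S" and e: "c *s b + x = d *s b + y"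
    have "(c - d) *s b = y - x" using e by (simp add: vec.scale_left_diff_distrib algebra_simps)
    then have m: "(c - d) *s b \<in> vec.span S" using xy by (simp add: vec.span_diff)
    have "c = d"
    proof (rule ccontr)
      assume "c \<noteq> d"
      then have "b = inverse (c - d) *s ((c - d) *s b)" by simp
      then show False using vec.span_scale[OF m, of "inverse (c - d)"] assms by metis
    qed
    then show "c = d \<and> x = y" using e by simp
  qed
  moreover have "?f ` (UNIV \<times> vec.span S) = vec.span (insert b S)"
  proof (intro subset_antisym subsetI)
    fix y assume "y \<in> vec.span (insert b S)"
    then obtain c where c: "y - c *s b \<in> vec.span S" by (auto simp: vec.span_insert)
    then show "y \<in> ?f ` (UNIV \<times> vec.span S)" by (intro image_eqI[of _ _ "(c, y - c *s b)"]) auto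
  next
    fix y assume "y \<in> ?f ` (UNIV \<times> vec.span S)"
    then obtain c x where "y = c *s b + x" "x \<in> vec.span S" by auto
    then show "y \<in> vec.span (insert b S)" by (auto simp: vec.span_insert intro!: exI[of _ c])
  qed
  ultimately show ?thesis by (metis card_image card_cartesian_product)
qed

lemma card_subspace:
  fixes V :: "('k::{field,finite} ^ 'n) set"
  assumes "vec.subspace V"
  shows "card V = CARD('k) ^ vec.dim V"
proof -
  have span: "card (vec.span B) = CARD('k) ^ card B" if "finite B" "vec.independent B" for B :: "('k ^ 'n) set"
    using that
  proof (induction B rule: finite_induct)
    case (insert b B)
    then show ?case by (simp add: vec.independent_insert card_span_insert)
  qed simp
  obtain B where "B \<subseteq> V" "vec.independent B" "V \<subseteq> vec.span B" "card B = vec.dim V"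
    using vec.basis_exists[of V] by blast
  moreover from this have "vec.span B = V" using assms vec.span_minimal by blast
  ultimately show ?thesis using span[of B] by (metis finite)
qed

definition extensions :: "('k::{field,finite} ^ 'n) set \<Rightarrow> nat \<Rightarrow> ('k ^ 'n) set set" where
  "extensions V k = {W. vec.subspace W \<and> V \<subseteq> W \<and> vec.dim W = vec.dim V + k}"

lemma base_q_card_field: "base_q (rat_of_nat CARD('k::{field,finite}))"
proof
  have "card {0, 1 :: 'k} \<le> CARD('k)" by (rule card_mono) auto
  then show "rat_of_nat CARD('k) > 1" by simp
qed

text \<open>Pairs \<open>(W, i)\<close> with \<open>i \<in> W - V\<close> are counted by first choosing \<open>W\<close>, or by first choosing \<open>i\<close>
  and then extending the span of \<open>V\<close> and \<open>i\<close>.\<close>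

theorem card_extensions:
  fixes V :: "('k::{field,finite} ^ 'n) set"
  assumes "vec.subspace V" "vec.dim V + k \<le> CARD('n)"
  shows "rat_of_nat (card (extensions V k)) = q_binomial (of_nat CARD('k)) (CARD('n) - vec.dim V) k"
  using assms
proof (induction k arbitrary: V)
  case 0
  interpret base_q "rat_of_nat CARD('k)" by (rule base_q_card_field)
    have "W = V" if "vec.subspace W" "V \<subseteq> W" "vec.dim W = vec.dim V" for W
      using vec.subspace_dim_equal[OF \<open>vec.subspace V\<close>, of W] that by auto
    then have ext0: "extensions V 0 = {V}" using 0 by (auto simp: extensions_def)
    show ?case using ext0 by (simp add: q_binomial_def)
  next
    case (Suc k)
    interpret base_q "rat_of_nat CARD('k)" by (rule base_q_card_field)
    let ?q = "rat_of_nat CARD('k)" and ?v = "vec.dim V" and ?n = "CARD('n)"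
    define s where "s i = vec.span (insert i V)" for i
    have VV: "vec.span V = V" using Suc.prems(1) by (simp add: vec.span_eq_iff)
    have ds: "vec.dim (s i) = Suc ?v" if "i \<notin> V" for i
      using that by (simp add: s_def vec.dim_insert VV)
    have e: "{W \<in> extensions V (Suc k). i \<in> W} = extensions (s i) k" if i: "i \<notin> V" for i
    proof -
      have "s i \<subseteq> W \<longleftrightarrow> V \<subseteq> W \<and> i \<in> W" if "vec.subspace W" for W
        using vec.span_minimal[of "insert i V" W] that vec.span_superset[of "insert i V"] by (auto simp: s_def)
      then show ?thesis using ds[OF i] by (auto simp: extensions_def)
    qed
    have count: "(\<Sum>W\<in>extensions V (Suc k). card {i \<in> UNIV - V. i \<in> W}) = (\<Sum>i\<in>UNIV - V. card {W \<in> extensions V (Suc k). i \<in> W})"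
      by (rule sum_multicount_gen[symmetric]) auto
    have W: "rat_of_nat (card {i \<in> UNIV - V. i \<in> W}) = ?q ^ ?v * (?q ^ Suc k - 1)" if "W \<in> extensions V (Suc k)" for W
    proof -
      have "{i \<in> UNIV - V. i \<in> W} = W - V" by auto
      moreover have "card (W - V) = card W - card V" using that by (intro card_Diff_subset) (auto simp: extensions_def)
      moreover have "card W = CARD('k) ^ (?v + Suc k)" using that card_subspace[of W] by (simp add: extensions_def)
      moreover have "card V = CARD('k) ^ ?v" using card_subspace Suc.prems(1) by blast
      moreover have "CARD('k) ^ ?v \<le> CARD('k) ^ (?v + Suc k)" by (rule power_increasing) (auto simp: Suc_le_eq)
      ultimately show ?thesis by (simp add: of_nat_diff power_add algebra_simps)
    qed
    have I: "rat_of_nat (card {W \<in> extensions V (Suc k). i \<in> W}) = q_binomial ?q (?n - Suc ?v) k" if "i \<in> UNIV - V" for i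
      using that Suc.IH[of "s i"] Suc.prems ds[of i] e[of i] by (simp add: s_def)
    have U: "rat_of_nat (card (UNIV - V)) = ?q ^ ?v * (?q ^ (?n - ?v) - 1)"
    proof -
      have "card (UNIV - V) = card (UNIV :: ('k ^ 'n) set) - card V" by (intro card_Diff_subset) auto
      moreover have "card (UNIV :: ('k ^ 'n) set) = CARD('k) ^ ?n"
        using card_subspace[of "UNIV :: ('k ^ 'n) set"] by (simp add: vec.dim_UNIV card_cart_basis)
      moreover have "card V = CARD('k) ^ ?v" using card_subspace Suc.prems(1) by blast
      moreover have "CARD('k) ^ ?v \<le> CARD('k) ^ ?n" using Suc.prems by (intro power_increasing) (auto simp: Suc_le_eq)
      moreover have "?q ^ ?n = ?q ^ ?v * ?q ^ (?n - ?v)" using Suc.prems by (simp add: power_add[symmetric])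
      ultimately show ?thesis by (simp add: of_nat_diff algebra_simps)
    qed
    have "rat_of_nat (\<Sum>W\<in>extensions V (Suc k). card {i \<in> UNIV - V. i \<in> W})
        = (\<Sum>W\<in>extensions V (Suc k). ?q ^ ?v * (?q ^ Suc k - 1))"
      unfolding of_nat_sum by (rule sum.cong) (use W in auto)
    moreover have "rat_of_nat (\<Sum>i\<in>UNIV - V. card {W \<in> extensions V (Suc k). i \<in> W})
        = (\<Sum>i\<in>UNIV - V. q_binomial ?q (?n - Suc ?v) k)"
      unfolding of_nat_sum by (rule sum.cong) (use I in auto)
    ultimately have "rat_of_nat (card (extensions V (Suc k))) * (?q ^ ?v * (?q ^ Suc k - 1))
        = ?q ^ ?v * (?q ^ (?n - ?v) - 1) * q_binomial ?q (?n - Suc ?v) k"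
      unfolding count U[symmetric] by simp
    then have c: "rat_of_nat (card (extensions V (Suc k))) * (?q ^ Suc k - 1) = (?q ^ (?n - ?v) - 1) * q_binomial ?q (?n - Suc ?v) k"
      using q_gt_1 by simp
    obtain m where m: "?n - ?v = Suc m" "?n - Suc ?v = m" "k \<le> m"
      using Suc.prems by (intro that[of "?n - Suc ?v"]) auto
    have "rat_of_nat (card (extensions V (Suc k))) * q_int ?q (Suc k) = q_int ?q (Suc m) * q_binomial ?q m k"
      using c unfolding m q_int_eq[symmetric] using q_gt_1 by simp
    moreover have "q_binomial ?q (Suc m) (Suc k) * q_int ?q (Suc k) = q_int ?q (Suc m) * q_binomial ?q m k"
      using q_fact_pos[of k] q_fact_pos[of "m - k"] q_int_pos[of "Suc k"] by (simp add: q_binomial_def q_fact_Suc field_simps)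
    ultimately show ?case using q_int_pos[of "Suc k"] m by (metis mult_right_cancel less_irrefl zero_less_Suc)
qed

context base_q begin

section \<open>Chains of subspaces and Eulerian polynomials\<close>

abbreviation B :: "nat \<Rightarrow> nat \<Rightarrow> rat fps" where "B n k \<equiv> fps_const (q_binomial q n k)"

lemma B_0: "B n 0 = 1" and B_self: "B n n = 1"
  by (simp_all add: q_binomial_def)

lemma fps_X_neq_1: "(1 - fps_X :: rat fps) \<noteq> 0"
proof
  assume "(1 - fps_X :: rat fps) = 0"
  from arg_cong[OF this, of "\<lambda>f. fps_nth f 0"] show False by simp
qed

lemma geometric_from_1: "k \<ge> 1 \<Longrightarrow> (1 - fps_X) * (\<Sum>a=1..<k. fps_X ^ a) = (fps_X - fps_X ^ k :: rat fps)"
proof (induction k rule: nat_induct_at_least)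
  case (Suc k)
  have "{1..<Suc k} = insert k {1..<k}" using Suc by auto
  then have "(\<Sum>a=1..<Suc k. fps_X ^ a) = (\<Sum>a=1..<k. fps_X ^ a) + (fps_X ^ k :: rat fps)" by simp
  then have "(1 - fps_X) * (\<Sum>a=1..<Suc k. fps_X ^ a) = (1 - fps_X) * (\<Sum>a=1..<k. fps_X ^ a) + (1 - fps_X) * (fps_X ^ k :: rat fps)"
    by (simp only: distrib_left)
  then show ?case unfolding Suc.IH by (simp add: algebra_simps)
qed simp

lemma q_Eulerian_0: "q_Eulerian 0 q = 1"
  using q_Eulerian_recursion[of 0] fps_X_neq_1 by (simp add: q_binomial_def)

lemma q_Eulerian_chains:
  "q_Eulerian n q = 1 + (\<Sum>k=1..n. B n k * (\<Sum>a=1..<k. fps_X ^ a) * q_Eulerian (n - k) q)"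
proof -
  have "(\<Sum>i\<le>n. B n i * (fps_X ^ i - fps_X) * q_Eulerian (n - i) q)
      = (1 - fps_X) * q_Eulerian n q + (\<Sum>i=1..n. B n i * (fps_X ^ i - fps_X) * q_Eulerian (n - i) q)"
    unfolding atMost_atLeast0 by (subst sum.atLeast_Suc_atMost) (simp_all add: B_0)
  also have "(\<Sum>i=1..n. B n i * (fps_X ^ i - fps_X) * q_Eulerian (n - i) q)
      = - (1 - fps_X) * (\<Sum>k=1..n. B n k * (\<Sum>a=1..<k. fps_X ^ a) * q_Eulerian (n - k) q)"
    unfolding sum_distrib_left[of "- (1 - fps_X)"]
  proof (rule sum.cong)
    fix k assume "k \<in> {1..n}"
    then have "fps_X ^ k - fps_X = - (1 - fps_X) * (\<Sum>a=1..<k. fps_X ^ a :: rat fps)"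
      using geometric_from_1[of k] by (simp add: minus_mult_left[symmetric] del: minus_diff_eq)
    then show "B n k * (fps_X ^ k - fps_X) * q_Eulerian (n - k) q
        = - (1 - fps_X) * (B n k * (\<Sum>a=1..<k. fps_X ^ a) * q_Eulerian (n - k) q)"
      by (simp only: ac_simps)
  qed simp
  finally have "(1 - fps_X) * (q_Eulerian n q - (\<Sum>k=1..n. B n k * (\<Sum>a=1..<k. fps_X ^ a) * q_Eulerian (n - k) q))
      = (1 - fps_X) * 1"
    unfolding q_Eulerian_recursion by (simp only: right_diff_distrib mult_minus_left mult_1_right) simp
  then show ?thesis using fps_X_neq_1 unfolding mult_left_cancel[OF fps_X_neq_1] by (simp add: algebra_simps)
qed

text \<open>The sum over \<open>a\<close> has one more term than in \<open>q_Eulerian_chains\<close>, and these extra terms are evaluated by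
  the recursion once more.\<close>

lemma binomial_q_Eulerian_chains:
  "binomial_q_Eulerian n q = 1 + (\<Sum>k=1..n. B n k * (\<Sum>a=1..<Suc k. fps_X ^ a) * q_Eulerian (n - k) q)"
proof -
  have "(\<Sum>k=1..n. B n k * (\<Sum>a=1..<Suc k. fps_X ^ a) * q_Eulerian (n - k) q)
      = (\<Sum>k=1..n. B n k * (\<Sum>a=1..<k. fps_X ^ a) * q_Eulerian (n - k) q) + (\<Sum>k=1..n. B n k * fps_X ^ k * q_Eulerian (n - k) q)"
    unfolding sum.distrib[symmetric] by (rule sum.cong) (auto simp: algebra_simps)
  then have "1 + (\<Sum>k=1..n. B n k * (\<Sum>a=1..<Suc k. fps_X ^ a) * q_Eulerian (n - k) q)
      = q_Eulerian n q + (\<Sum>k=1..n. B n k * fps_X ^ k * q_Eulerian (n - k) q)"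
    by (subst q_Eulerian_chains) (simp only: add.assoc)
  also have "\<dots> = (\<Sum>k\<le>n. B n k * fps_X ^ k * q_Eulerian (n - k) q)"
    unfolding atMost_atLeast0 by (subst (2) sum.atLeast_Suc_atMost) (simp_all add: B_0)
  also have "\<dots> = 1 - fps_X + fps_X * (\<Sum>k\<le>n. B n k * q_Eulerian (n - k) q)"
    unfolding diff_eq_eq[symmetric] q_Eulerian_recursion[of n, symmetric]
    by (simp add: left_diff_distrib right_diff_distrib sum_subtractf sum_distrib_left ac_simps)
  also have "(\<Sum>k\<le>n. B n k * q_Eulerian (n - k) q) = (\<Sum>k\<le>n. B n k * q_Eulerian k q)"
    by (rule sum.reindex_bij_witness[of _ "\<lambda>k. n - k" "\<lambda>k. n - k"]) (auto simp: q_binomial_def mult.commute)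
  also have "\<dots> = 1 + (\<Sum>k=1..n. B n k * q_Eulerian k q)"
    unfolding atMost_atLeast0 by (subst sum.atLeast_Suc_atMost) (simp_all add: B_0 q_Eulerian_0)
  finally show ?thesis by (simp add: binomial_q_Eulerian_def algebra_simps)
qed

text \<open>For \<open>d \<ge> 2\<close> this is the chain series above a subspace of codimension \<open>d\<close> when the hyperplanes are
  not flats. The last sum stems from the whole space, whose rank is one less than its dimension.\<close>

fun truncated :: "nat \<Rightarrow> rat fps" where
  "truncated d = 1 + (\<Sum>k=1..<d-1. B d k * (\<Sum>a=1..<k. fps_X ^ a) * truncated (d - k)) + (\<Sum>a=1..<d-1. fps_X ^ a)"

declare truncated.simps [simp del]

text \<open>Shifting \<open>truncated\<close> by one power of \<open>t\<close> and supplying the values \<open>1\<close> and \<open>0\<close> for small \<open>d\<close> makes the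
  recursion homogeneous.\<close>

definition derangement :: "nat \<Rightarrow> rat fps" where
  "derangement d = (if d = 0 then 1 else if d = 1 then 0 else fps_X * truncated d)"

lemma derangement_recursion:
  "(\<Sum>i\<le>n. B n i * (fps_X ^ i - fps_X) * derangement (n - i)) = (if n = 0 then 1 - fps_X else 0)"
proof -
  consider "n = 0" | "n = 1" | m where "n = Suc (Suc m)" by (metis One_nat_def not0_implies_Suc)
  then show ?thesis
  proof cases
    case (3 m)
    let ?f = "\<lambda>i. B n i * (fps_X ^ i - fps_X) * derangement (n - i)"
    have f: "?f i = - fps_X * (1 - fps_X) * (B n i * (\<Sum>a=1..<i. fps_X ^ a) * truncated (n - i))" if "1 \<le> i" "i < n - 1" for i
    proof -
      have "fps_X ^ i - fps_X = - (1 - fps_X) * (\<Sum>a=1..<i. fps_X ^ a :: rat fps)"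
        using geometric_from_1[of i] that by (simp add: minus_mult_left[symmetric] del: minus_diff_eq)
      moreover have "derangement (n - i) = fps_X * truncated (n - i)"
        unfolding derangement_def using that by (auto simp: less_diff_conv)
      ultimately show ?thesis by (simp only: mult_minus_left mult_minus_right ac_simps)
    qed
    have "{..n} = insert 0 (insert (n - 1) (insert n {1..<n - 1}))" using 3 by auto
    then have "sum ?f {..n} = ?f 0 + ?f (n - 1) + ?f n + sum ?f {1..<n - 1}" using 3 by simp
    also have "?f 0 = fps_X * (1 - fps_X) * truncated n" using 3 by (simp add: B_0 derangement_def ac_simps)
    also have "?f (n - 1) = 0" using 3 by (simp add: derangement_def)
    also have "?f n = fps_X ^ n - fps_X" by (simp add: B_self derangement_def)
    also have "sum ?f {1..<n - 1} = - fps_X * (1 - fps_X) * (\<Sum>i=1..<n - 1. B n i * (\<Sum>a=1..<i. fps_X ^ a) * truncated (n - i))"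
      unfolding sum_distrib_left[of "- fps_X * (1 - fps_X)"] by (rule sum.cong[OF refl], rule f) simp_all
    also have "truncated n = 1 + (\<Sum>i=1..<n - 1. B n i * (\<Sum>a=1..<i. fps_X ^ a) * truncated (n - i)) + (\<Sum>a=1..<n - 1. fps_X ^ a)"
      by (rule truncated.simps)
    also have "fps_X ^ n = fps_X * (fps_X ^ (n - 1) :: rat fps)" using 3 by simp
    also have "fps_X ^ (n - 1) = fps_X - (1 - fps_X) * (\<Sum>a=1..<n - 1. fps_X ^ a :: rat fps)"
      using geometric_from_1[of "n - 1"] 3 by simp
    finally show ?thesis using 3 by (simp add: algebra_simps)
  qed (auto simp: B_0 B_self derangement_def)
qed

definition q_egf :: "(nat \<Rightarrow> rat fps) \<Rightarrow> rat fps fps" where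
  "q_egf f = Abs_fps (\<lambda>n. fps_const (1 / q_fact q n) * f n)"

lemma q_egf_mult: "q_egf f * q_egf g = q_egf (\<lambda>n. \<Sum>i\<le>n. B n i * f i * g (n - i))"
proof (rule fps_ext)
  fix n
  have e: "fps_const (1 / q_fact q i) * f i * (fps_const (1 / q_fact q (n - i)) * g (n - i))
      = fps_const (1 / q_fact q n) * (B n i * f i * g (n - i))" for i
  proof -
    have "fps_const (1 / q_fact q i) * fps_const (1 / q_fact q (n - i)) = fps_const (1 / q_fact q n) * B n i"
      by (simp add: q_binomial_def)
    moreover have "a * x * (b * y) = c * (d * x * y)" if "a * b = c * d" for a b c d x y :: "rat fps"
    proof -
      have "a * x * (b * y) = a * b * (x * y)" by (simp only: ac_simps)
      then show ?thesis unfolding that by (simp only: ac_simps)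
    qed
    ultimately show ?thesis by blast
  qed
  show "fps_nth (q_egf f * q_egf g) n = fps_nth (q_egf (\<lambda>n. \<Sum>i\<le>n. B n i * f i * g (n - i))) n"
    unfolding q_egf_def fps_mult_nth fps_nth_Abs_fps sum_distrib_left atMost_atLeast0 by (simp only: e)
qed

lemma q_egf_eq_iff: "q_egf f = q_egf g \<longleftrightarrow> f = g"
proof
  assume "q_egf f = q_egf g"
  then have "fps_const (1 / q_fact q n) * f n = fps_const (1 / q_fact q n) * g n" for n
    by (simp add: q_egf_def fps_eq_iff[of "Abs_fps _"])
  moreover have "fps_const (1 / q_fact q n) \<noteq> 0" for n by simp
  ultimately show "f = g" by (auto simp: fun_eq_iff)
qed simp

text \<open>Both recursions have the common kernel \<open>e(t z) - t e(z)\<close>, with \<open>e\<close> the \<open>q\<close>-exponential series,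
  and right-hand sides that differ by a factor \<open>e(z)\<close>.\<close>

lemma q_Eulerian_derangement: "q_Eulerian n q = (\<Sum>k\<le>n. B n k * derangement (n - k))"
proof -
  let ?D = "q_egf (\<lambda>i. fps_X ^ i - fps_X)" and ?e = "q_egf (\<lambda>_. 1)"
  have "?D * q_egf (\<lambda>n. q_Eulerian n q) = q_egf (\<lambda>n. 1 - fps_X)"
    unfolding q_egf_mult q_Eulerian_recursion ..
  also have "\<dots> = ?e * q_egf (\<lambda>n. if n = 0 then 1 - fps_X else 0)"
  proof -
    have "(\<Sum>i\<le>n. B n i * 1 * (if n - i = 0 then 1 - fps_X else 0)) = 1 - fps_X" for n
    proof -
      have "(\<Sum>i\<le>n. B n i * 1 * (if n - i = 0 then 1 - fps_X else 0)) = (\<Sum>i\<in>{n}. B n i * 1 * (if n - i = 0 then 1 - fps_X else 0))"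
        by (rule sum.mono_neutral_right) auto
      then show ?thesis by (simp add: B_self)
    qed
    then show ?thesis unfolding q_egf_mult by presburger
  qed
  also have "\<dots> = ?e * (?D * q_egf derangement)"
    unfolding q_egf_mult[of _ derangement] derangement_recursion ..
  finally have "?D * q_egf (\<lambda>n. q_Eulerian n q) = ?D * (?e * q_egf derangement)" by (simp only: ac_simps)
  moreover have "?D \<noteq> 0"
  proof
    assume "?D = 0"
    then have "fps_nth ?D 0 = 0" by simp
    then show False using fps_X_neq_1 by (simp add: q_egf_def)
  qed
  ultimately have "q_egf (\<lambda>n. q_Eulerian n q) = ?e * q_egf derangement" by (simp only: mult_left_cancel simp_thms)
  then have "(\<lambda>n. q_Eulerian n q) = (\<lambda>n. \<Sum>k\<le>n. B n k * 1 * derangement (n - k))"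
    unfolding q_egf_mult q_egf_eq_iff .
  then show ?thesis by (simp add: fun_eq_iff)
qed

text \<open>After multiplication by \<open>1 - t\<close> the right-hand side becomes the sum of \<open>B n k * (1 - t ^ k)\<close> times
  \<open>derangement (n - k)\<close>, to which both \<open>derangement_recursion\<close> and \<open>q_Eulerian_derangement\<close> apply.\<close>

lemma q_Eulerian_truncated_chains:
  assumes "n \<ge> 2"
  shows "q_Eulerian n q = 1 + (\<Sum>k=1..<n - 1. B n k * (\<Sum>a=1..<Suc k. fps_X ^ a) * truncated (n - k)) + (\<Sum>a=1..<n. fps_X ^ a)"
proof -
  let ?T = "\<Sum>k=1..<n - 1. B n k * (\<Sum>a=1..<Suc k. fps_X ^ a) * truncated (n - k)"
  let ?f = "\<lambda>k. B n k * (1 - fps_X ^ k) * derangement (n - k)"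
  have f: "?f k = (1 - fps_X) * (B n k * (\<Sum>a=1..<Suc k. fps_X ^ a) * truncated (n - k))" if "1 \<le> k" "k < n - 1" for k
  proof -
    have "derangement (n - k) = fps_X * truncated (n - k)"
      unfolding derangement_def using that by (auto simp: less_diff_conv)
    moreover have "(1 - fps_X ^ k) * fps_X = (1 - fps_X) * (\<Sum>a=1..<Suc k. fps_X ^ a :: rat fps)"
      using geometric_from_1[of "Suc k"] by (simp add: algebra_simps)
    moreover have "b * y * (x * t) = c * (b * s * t)" if "y * x = c * s" for b c s t x y :: "rat fps"
    proof -
      have "b * y * (x * t) = y * x * (b * t)" by (simp only: ac_simps)
      then show ?thesis unfolding that by (simp only: ac_simps)
    qed
    ultimately show ?thesis by metis
  qed
  have "{..n} = insert 0 (insert (n - 1) (insert n {1..<n - 1}))" using assms by auto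
  then have "sum ?f {..n} = ?f 0 + ?f (n - 1) + ?f n + sum ?f {1..<n - 1}" using assms by simp
  also have "?f 0 + ?f (n - 1) + ?f n = 1 - fps_X ^ n" using assms by (simp add: B_self derangement_def)
  also have "sum ?f {1..<n - 1} = (1 - fps_X) * ?T"
    unfolding sum_distrib_left[of "1 - fps_X"] by (rule sum.cong[OF refl], rule f) simp_all
  also have "1 - fps_X ^ n = (1 - fps_X) * (1 + (\<Sum>a=1..<n. fps_X ^ a :: rat fps))"
    using geometric_from_1[of n] assms by (simp add: distrib_left)
  finally have "sum ?f {..n} = (1 - fps_X) * (1 + ?T + (\<Sum>a=1..<n. fps_X ^ a))"
    by (simp only: distrib_left ac_simps)
  moreover have "sum ?f {..n} = (1 - fps_X) * q_Eulerian n q"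
  proof -
    have "sum ?f {..n} = (\<Sum>k\<le>n. B n k * derangement (n - k)) - (\<Sum>k\<le>n. B n k * fps_X ^ k * derangement (n - k))"
      by (simp add: sum_subtractf[symmetric] algebra_simps)
    moreover have "(\<Sum>k\<le>n. B n k * fps_X ^ k * derangement (n - k)) = fps_X * (\<Sum>k\<le>n. B n k * derangement (n - k))"
      using derangement_recursion[of n] assms
      by (simp add: left_diff_distrib right_diff_distrib sum_subtractf sum_distrib_left ac_simps)
    ultimately show ?thesis unfolding q_Eulerian_derangement by (simp add: left_diff_distrib)
  qed
  ultimately have "(1 - fps_X) * q_Eulerian n q = (1 - fps_X) * (1 + ?T + (\<Sum>a=1..<n. fps_X ^ a))" by metis
  then show ?thesis unfolding mult_left_cancel[OF fps_X_neq_1] .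
qed

end

section \<open>The lattice of flats of a uniform matroid\<close>

lemma dim_remove_0: "vec.dim (V - {0 :: 'k::{field,finite} ^ 'n}) = vec.dim V"
  by (metis vec.dim_span vec.span_delete_0)

lemma remove_0_subset_iff:
  fixes V W :: "('k::{field,finite} ^ 'n) set"
  assumes "vec.subspace V" "vec.subspace W"
  shows "V - {0} \<subseteq> W - {0} \<longleftrightarrow> V \<subseteq> W"
  using vec.subspace_0[OF assms(2)] by auto

lemma remove_0_eq_iff:
  fixes V W :: "('k::{field,finite} ^ 'n) set"
  assumes "vec.subspace V" "vec.subspace W"
  shows "V - {0} = W - {0} \<longleftrightarrow> V = W"
  using remove_0_subset_iff[OF assms] remove_0_subset_iff[OF assms(2,1)] by blast

lemma remove_0_psubset_iff:
  fixes V W :: "('k::{field,finite} ^ 'n) set"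
  assumes "vec.subspace V" "vec.subspace W"
  shows "V - {0} \<subset> W - {0} \<longleftrightarrow> V \<subset> W"
  unfolding psubset_eq remove_0_subset_iff[OF assms] remove_0_eq_iff[OF assms] ..

lemma dim_less:
  fixes V W :: "('k::{field,finite} ^ 'n) set"
  assumes "vec.subspace V" "vec.subspace W" "V \<subset> W"
  shows "vec.dim V < vec.dim W"
  using vec.dim_psubset[of V W] assms by (simp add: vec.span_eq_iff[THEN iffD2])

text \<open>Adding a vector to a subspace of dimension \<open>r - 1\<close> generates the whole space as a flat; hence the rank is
  the dimension truncated at \<open>r\<close>.\<close>

theorem q_uniform_chow_presentation:
  assumes r: "1 \<le> r" "r \<le> CARD('n)"
  shows "chow_presentation (q_uniform_ground :: ('k::{field,finite} ^ 'n) set) (q_uniform_flats r) (\<lambda>F. min r (vec.dim F))"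
proof -
  let ?E = "q_uniform_ground :: ('k ^ 'n) set" and ?L = "q_uniform_flats r :: ('k ^ 'n) set set"
  interpret M: loopless_matroid ?E ?L by (rule q_uniform_loopless_matroid[OF r(1)])
  have dim_UNIV: "vec.dim (UNIV :: ('k ^ 'n) set) = CARD('n)" by (simp add: vec.dim_UNIV card_cart_basis)
  show ?thesis
  proof
    fix F i assume "F \<in> ?L" and i: "i \<in> ?E - F"
    then obtain V where V: "F = V - {0}" "vec.subspace V" "vec.dim V < r \<or> V = UNIV"
      unfolding q_uniform_flats_def by auto
    have iV: "i \<noteq> 0" "i \<notin> V" using i V by (auto simp: q_uniform_ground_def)
    then have dV: "vec.dim V < r" using V(3) by auto
    define S where "S = vec.span (insert i V)"
    define C where "C = (if Suc (vec.dim V) < r then S else UNIV)"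
    have VV: "vec.span V = V" using V(2) by (simp add: vec.span_eq_iff)
    have dS: "vec.dim S = Suc (vec.dim V)" using iV by (simp add: S_def vec.dim_insert VV)
    have SW: "S \<subseteq> W" if "vec.subspace W" "insert i F \<subseteq> W - {0}" for W
      unfolding S_def using that V vec.subspace_0[OF that(1)] by (intro vec.span_minimal) auto
    have "\<Inter>{H \<in> ?L. insert i F \<subseteq> H} = C - {0}"
    proof (intro subset_antisym Inter_greatest)
      have "vec.subspace S" by (simp add: S_def)
      then have "vec.subspace C" "vec.dim C < r \<or> C = UNIV" using dS by (simp_all add: C_def)
      then have "C - {0} \<in> ?L" unfolding q_uniform_flats_def by blast
      moreover have "insert i V \<subseteq> C"
        unfolding C_def S_def using vec.span_superset[of "insert i V"] by simp
      then have "insert i F \<subseteq> C - {0}" using iV(1) V(1) by blast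
      ultimately show "\<Inter>{H \<in> ?L. insert i F \<subseteq> H} \<subseteq> C - {0}" by blast
    next
      fix H assume "H \<in> {H \<in> ?L. insert i F \<subseteq> H}"
      then obtain W where W: "H = W - {0}" "vec.subspace W" "vec.dim W < r \<or> W = UNIV" "insert i F \<subseteq> W - {0}"
        unfolding q_uniform_flats_def by auto
      have "S \<subseteq> W" by (rule SW) (use W in auto)
      then have "C \<subseteq> W" using W(3) vec.dim_subset[of S W] dS by (auto simp: C_def)
      then show "C - {0} \<subseteq> H" using W by auto
    qed
    then show "min r (vec.dim (\<Inter>{H \<in> ?L. insert i F \<subseteq> H})) = Suc (min r (vec.dim F))"
      using dV r by (simp add: dim_remove_0 V(1) C_def dS card_cart_basis)
  qed (use M.finite_ground M.flats_subset M.ground_flat M.loopless M.inter_flat in auto)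
qed

lemma sum_flats_above:
  fixes V :: "('k::{field,finite} ^ 'n) set"
  assumes V: "vec.subspace V" "vec.dim V < r" and r: "r \<le> CARD('n)"
    and g: "\<And>W. vec.subspace W \<Longrightarrow> V \<subset> W \<Longrightarrow> vec.dim W < r \<Longrightarrow> g (W - {0}) = c (vec.dim W - vec.dim V)"
  shows "(\<Sum>G | G \<in> q_uniform_flats r \<and> V - {0} \<subset> G. g G)
    = (\<Sum>k=1..<r - vec.dim V. fps_const (q_binomial (of_nat CARD('k)) (CARD('n) - vec.dim V) k) * c k)
      + (g q_uniform_ground :: rat fps)"
proof -
  let ?f = "\<lambda>W :: ('k ^ 'n) set. W - {0}" and ?v = "vec.dim V"
  let ?U = "\<Union>k\<in>{1..<r - ?v}. ?f ` extensions V k"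
  have dim_UNIV: "vec.dim (UNIV :: ('k ^ 'n) set) = CARD('n)" by (simp add: vec.dim_UNIV card_cart_basis)
  have ext: "vec.subspace W" "V \<subset> W" "vec.dim W < r" "vec.dim W - ?v = k" if "W \<in> extensions V k" "k \<in> {1..<r - ?v}" for W k
    using that by (auto simp: extensions_def)
  have split: "{G. G \<in> q_uniform_flats r \<and> V - {0} \<subset> G} = insert q_uniform_ground ?U"
  proof (intro subset_antisym subsetI)
    fix G assume "G \<in> {G. G \<in> q_uniform_flats r \<and> V - {0} \<subset> G}"
    then obtain W where W: "G = W - {0}" "vec.subspace W" "vec.dim W < r \<or> W = UNIV" "V - {0} \<subset> W - {0}"
      unfolding q_uniform_flats_def by blast
    show "G \<in> insert q_uniform_ground ?U"
    proof (cases "W = UNIV")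
      case False
      have "V \<subset> W" using W(4) remove_0_psubset_iff[OF V(1) W(2)] by blast
      moreover from this have "?v < vec.dim W" using dim_less V W by blast
      ultimately have "W \<in> extensions V (vec.dim W - ?v)" "vec.dim W - ?v \<in> {1..<r - ?v}"
        using W False by (auto simp: extensions_def)
      then show ?thesis using W by blast
    qed (use W in \<open>simp add: q_uniform_ground_def\<close>)
  next
    fix G assume "G \<in> insert q_uniform_ground ?U"
    then consider "G = UNIV - {0}" | W k where "G = W - {0}" "W \<in> extensions V k" "k \<in> {1..<r - ?v}"
      unfolding q_uniform_ground_def by blast
    then show "G \<in> {G. G \<in> q_uniform_flats r \<and> V - {0} \<subset> G}"
    proof cases
      case 1
      have "V \<subset> UNIV" using V(2) r dim_UNIV by auto
      then show ?thesis using 1 remove_0_psubset_iff[OF V(1) vec.subspace_UNIV] unfolding q_uniform_flats_def by auto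
    next
      case 2
      then show ?thesis using ext[OF 2(2,3)] remove_0_psubset_iff[OF V(1), of W] unfolding q_uniform_flats_def by auto
    qed
  qed
  have "q_uniform_ground \<notin> ?U"
  proof
    assume "q_uniform_ground \<in> ?U"
    then obtain W k where W: "W \<in> extensions V k" "k \<in> {1..<r - ?v}" "UNIV - {0} = W - {0}"
      unfolding q_uniform_ground_def by blast
    then have "W = UNIV" using remove_0_eq_iff[OF vec.subspace_UNIV ext(1)[OF W(1,2)]] by simp
    then show False using ext(3)[OF W(1,2)] r dim_UNIV by simp
  qed
  then have "(\<Sum>G | G \<in> q_uniform_flats r \<and> V - {0} \<subset> G. g G) = g q_uniform_ground + sum g ?U"
    unfolding split by simp
  also have "sum g ?U = (\<Sum>k=1..<r - ?v. sum g (?f ` extensions V k))"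
  proof (rule sum.UNION_disjoint)
    show "\<forall>k\<in>{1..<r - ?v}. \<forall>l\<in>{1..<r - ?v}. k \<noteq> l \<longrightarrow> ?f ` extensions V k \<inter> ?f ` extensions V l = {}"
    proof (intro ballI impI, rule ccontr)
      fix k l assume kl: "k \<in> {1..<r - ?v}" "l \<in> {1..<r - ?v}" "k \<noteq> l" "?f ` extensions V k \<inter> ?f ` extensions V l \<noteq> {}"
      then obtain W W' where W: "W \<in> extensions V k" "W' \<in> extensions V l" "W - {0} = W' - {0}" by blast
      then have "W = W'" using remove_0_eq_iff[OF ext(1)[OF W(1) kl(1)] ext(1)[OF W(2) kl(2)]] by blast
      then show False using ext(4)[OF W(1) kl(1)] ext(4)[OF W(2) kl(2)] kl(3) by simp
    qed
  qed auto
  also have "\<dots> = (\<Sum>k=1..<r - ?v. fps_const (q_binomial (of_nat CARD('k)) (CARD('n) - ?v) k) * c k)"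
  proof (rule sum.cong[OF refl])
    fix k assume k: "k \<in> {1..<r - ?v}"
    have "inj_on ?f (extensions V k)"
      by (rule inj_onI) (metis ext(1) k remove_0_eq_iff)
    then have "sum g (?f ` extensions V k) = (\<Sum>W\<in>extensions V k. g (W - {0}))" by (simp add: sum.reindex)
    also have "\<dots> = (\<Sum>W\<in>extensions V k. c k)"
      by (rule sum.cong[OF refl]) (use g ext k in metis)
    also have "\<dots> = fps_const (rat_of_nat (card (extensions V k))) * c k" by (simp add: fps_of_nat)
    also have "rat_of_nat (card (extensions V k)) = q_binomial (of_nat CARD('k)) (CARD('n) - ?v) k"
      by (rule card_extensions) (use V r k in auto)
    finally show "sum g (?f ` extensions V k) = fps_const (q_binomial (of_nat CARD('k)) (CARD('n) - ?v) k) * c k" .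
  qed
  finally show ?thesis by (simp only: add.commute)
qed

text \<open>All intervals above flats of the same dimension look alike, so a solution \<open>h\<close> of the numerical
  recursion gives the chain series.\<close>

theorem q_uniform_Hilb:
  fixes h :: "nat \<Rightarrow> rat fps"
  defines "q \<equiv> rat_of_nat CARD('k::{field,finite})"
  assumes r: "1 \<le> r" "r \<le> CARD('n)"
    and h: "\<And>v. v < r \<Longrightarrow> h (CARD('n) - v) = 1 + (\<Sum>k=1..<r - v. fps_const (q_binomial q (CARD('n) - v) k)
      * ((\<Sum>a=1..<k. fps_X ^ a) * h (CARD('n) - v - k))) + (\<Sum>a=1..<r - v. fps_X ^ a)"
  shows "augmented_chow_Hilb q_uniform_ground (q_uniform_flats r :: ('k ^ 'n) set set)
    = 1 + (\<Sum>k=1..<r. fps_const (q_binomial q CARD('n) k) * ((\<Sum>a=1..<Suc k. fps_X ^ a) * h (CARD('n) - k)))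
      + (\<Sum>a=1..<Suc r. fps_X ^ a)"
proof -
  let ?E = "q_uniform_ground :: ('k ^ 'n) set" and ?L = "q_uniform_flats r :: ('k ^ 'n) set set"
  interpret M: chow_presentation ?E ?L "\<lambda>F. min r (vec.dim F)"
    by (rule q_uniform_chow_presentation[OF r])
  have rE: "min r (vec.dim ?E) = r"
    using r by (simp add: q_uniform_ground_def dim_remove_0 vec.dim_UNIV card_cart_basis)
  have top: "M.chain_series (Some ?E) = 1"
  proof -
    have "{G. G \<in> ?L \<and> M.above (Some ?E) G} = {}" using M.flat_subset by auto
    then show ?thesis by (subst M.chain_series_recursion) (simp only: sum.empty add_0_right)
  qed
  have step: "M.chain_series (Some (V - {0})) = h (CARD('n) - vec.dim V)" if "vec.subspace V" "vec.dim V < r" for V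
    using that
  proof (induction "r - vec.dim V" arbitrary: V rule: less_induct)
    case less
    let ?v = "vec.dim V"
    let ?g = "\<lambda>G. (\<Sum>a=1..<M.gap (Some (V - {0})) G. fps_X ^ a) * M.chain_series (Some G)"
    have "M.chain_series (Some (V - {0})) = 1 + (\<Sum>G | G \<in> ?L \<and> V - {0} \<subset> G. ?g G)"
      by (subst M.chain_series_recursion) simp
    also have "(\<Sum>G | G \<in> ?L \<and> V - {0} \<subset> G. ?g G)
        = (\<Sum>k=1..<r - ?v. fps_const (q_binomial q (CARD('n) - ?v) k) * ((\<Sum>a=1..<k. fps_X ^ a) * h (CARD('n) - ?v - k))) + ?g ?E"
      unfolding q_def
    proof (rule sum_flats_above[OF less.prems r(2)])
      fix W :: "('k ^ 'n) set" assume W: "vec.subspace W" "V \<subset> W" "vec.dim W < r"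
      have "?v < vec.dim W" using dim_less less.prems(1) W by blast
      then show "?g (W - {0}) = (\<Sum>a=1..<vec.dim W - ?v. fps_X ^ a) * h (CARD('n) - ?v - (vec.dim W - ?v))"
        using less.hyps[of W] W less.prems by (simp add: dim_remove_0)
    qed
    also have "?g ?E = (\<Sum>a=1..<r - ?v. fps_X ^ a)"
      using less.prems by (simp add: top rE dim_remove_0)
    finally show ?case using h[OF less.prems(2)] by (simp only: add.assoc)
  qed
  let ?g = "\<lambda>G. (\<Sum>a=1..<M.gap None G. fps_X ^ a) * M.chain_series (Some G)"
  have zero: "vec.subspace {0 :: 'k ^ 'n}" "vec.dim {0 :: 'k ^ 'n} = 0" by (auto simp: vec.subspace_def)
  have flats: "{G. G \<in> ?L \<and> M.above None G} = insert {} {G. G \<in> ?L \<and> {0} - {0} \<subset> G}" using M.empty_in by auto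
  have "(\<Sum>G | G \<in> ?L \<and> M.above None G. ?g G) = ?g {} + (\<Sum>G | G \<in> ?L \<and> {0} - {0} \<subset> G. ?g G)"
    unfolding flats by (rule sum.insert) (use M.finite_L in auto)
  also have "?g {} = 0" by simp
  also have "(\<Sum>G | G \<in> ?L \<and> {0} - {0} \<subset> G. ?g G)
      = (\<Sum>k=1..<r - vec.dim {0 :: 'k ^ 'n}. fps_const (q_binomial q (CARD('n) - vec.dim {0 :: 'k ^ 'n}) k)
          * ((\<Sum>a=1..<Suc k. fps_X ^ a) * h (CARD('n) - k))) + ?g ?E"
    unfolding q_def
  proof (rule sum_flats_above[OF zero(1) _ r(2)])
    show "vec.dim {0 :: 'k ^ 'n} < r" using r zero by simp
    fix W :: "('k ^ 'n) set" assume "vec.subspace W" "vec.dim W < r"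
    then show "?g (W - {0}) = (\<Sum>a=1..<Suc (vec.dim W - vec.dim {0 :: 'k ^ 'n}). fps_X ^ a) * h (CARD('n) - (vec.dim W - vec.dim {0 :: 'k ^ 'n}))"
      using step[of W] by (simp add: dim_remove_0 zero del: sum.op_ivl_Suc)
  qed
  also have "?g ?E = (\<Sum>a=1..<Suc r. fps_X ^ a)" by (simp add: top rE del: sum.op_ivl_Suc)
  finally show ?thesis
    unfolding M.Hilb_eq_chain_series by (subst M.chain_series_recursion) (simp add: zero(2) add.assoc del: sum.op_ivl_Suc)
qed

section \<open>The Hilbert series of the uniform matroids\<close>

theorem corollary1p4:
  fixes n q :: nat
  assumes "q = CARD('k::{field,finite})" and "n = CARD('n::finite)"
  shows
    "(augmented_chow_Hilb q_uniform_ground (q_uniform_flats n :: ('k ^ 'n) set set) =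
        (\<Sum>\<sigma>\<in>decorated_permutations n.
          fps_const (of_nat q powi (dmaj n \<sigma> - dexc n \<sigma>)) * fps_X ^ nat (dexc n \<sigma> + 1)) \<and>
      (\<Sum>\<sigma>\<in>decorated_permutations n.
          fps_const (of_nat q powi (dmaj n \<sigma> - dexc n \<sigma>)) * fps_X ^ nat (dexc n \<sigma> + 1)) =
        binomial_q_Eulerian n (of_nat q :: rat)) \<and>
     (n \<ge> 2 \<longrightarrow>
      augmented_chow_Hilb q_uniform_ground (q_uniform_flats (n - 1) :: ('k ^ 'n) set set) =
        (\<Sum>\<sigma> | \<sigma> permutes {1..n}.
          fps_const (of_nat q powi (int (maj n \<sigma>) - int (exc n \<sigma>))) * fps_X ^ exc n \<sigma>) \<and>
      (\<Sum>\<sigma> | \<sigma> permutes {1..n}.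
          fps_const (of_nat q powi (int (maj n \<sigma>) - int (exc n \<sigma>))) * fps_X ^ exc n \<sigma>) =
        q_Eulerian n (of_nat q :: rat))"
proof -
  let ?q = "rat_of_nat q"
  interpret base_q ?q using base_q_card_field[where 'k = 'k] unfolding assms(1) .
  have n1: "1 \<le> n" using assms(2) zero_less_card_finite[where 'a = 'n] by linarith
  have last: "(\<Sum>k=1..m. f k) = (\<Sum>k=1..<m. f k) + f m" if "1 \<le> m" for m and f :: "nat \<Rightarrow> rat fps"
  proof -
    have "{1..m} = insert m {1..<m}" using that by auto
    then show ?thesis by (simp add: add.commute)
  qed
  have full: "augmented_chow_Hilb q_uniform_ground (q_uniform_flats n :: ('k ^ 'n) set set) = binomial_q_Eulerian n ?q"
  proof -
    have rec: "q_Eulerian (n - v) ?q = 1 + (\<Sum>k=1..<n - v. B (n - v) k * ((\<Sum>a=1..<k. fps_X ^ a) * q_Eulerian (n - v - k) ?q))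
        + (\<Sum>a=1..<n - v. fps_X ^ a)" if "v < n" for v
    proof -
      have "1 \<le> n - v" using that by simp
      show ?thesis
        by (subst q_Eulerian_chains, unfold last[OF \<open>1 \<le> n - v\<close>]) (simp add: B_self q_Eulerian_0 mult.assoc add.assoc)
    qed
    have "augmented_chow_Hilb q_uniform_ground (q_uniform_flats n :: ('k ^ 'n) set set)
        = 1 + (\<Sum>k=1..<n. B n k * ((\<Sum>a=1..<Suc k. fps_X ^ a) * q_Eulerian (n - k) ?q)) + (\<Sum>a=1..<Suc n. fps_X ^ a)"
      by (unfold assms, intro q_uniform_Hilb) (insert n1[unfolded assms], linarith, linarith, rule rec[unfolded assms])
    also have "\<dots> = binomial_q_Eulerian n ?q"
      unfolding binomial_q_Eulerian_chains last[OF n1] by (simp add: B_self q_Eulerian_0 mult.assoc add.assoc del: sum.op_ivl_Suc)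
    finally show ?thesis .
  qed
  have truncated: "augmented_chow_Hilb q_uniform_ground (q_uniform_flats (n - 1) :: ('k ^ 'n) set set) = q_Eulerian n ?q"
    if n2: "2 \<le> n"
  proof -
    have rec: "truncated (n - v) = 1 + (\<Sum>k=1..<n - 1 - v. B (n - v) k * ((\<Sum>a=1..<k. fps_X ^ a) * truncated (n - v - k)))
        + (\<Sum>a=1..<n - 1 - v. fps_X ^ a)" for v
      by (subst truncated.simps) (simp add: mult.assoc)
    have "augmented_chow_Hilb q_uniform_ground (q_uniform_flats (n - 1) :: ('k ^ 'n) set set)
        = 1 + (\<Sum>k=1..<n - 1. B n k * ((\<Sum>a=1..<Suc k. fps_X ^ a) * truncated (n - k))) + (\<Sum>a=1..<Suc (n - 1). fps_X ^ a)"
      by (unfold assms, rule q_uniform_Hilb) (insert n2[unfolded assms], linarith, linarith, rule rec[unfolded assms])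
    also have "\<dots> = q_Eulerian n ?q"
      unfolding q_Eulerian_truncated_chains[OF n2] using n2 by (simp add: mult.assoc del: sum.op_ivl_Suc)
    finally show ?thesis .
  qed
  show ?thesis
    unfolding decorated_sum full q_Eulerian_def[symmetric] using truncated by simp
qed

end
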